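(* Let $(A, \sim_A)$ and $(B, \sim_B)$ be finite simple graphs, and let $R = `(\sim_A)$ and $S = `(\sim_B)$. Let $H$ be a nonzero finite-dimensional Hilbert space, and let $\mathcal X$ be the quantum set defined by $\mathrm{At}(\mathcal X) = \{H\}$. Consider the one-to-one correspondence between families of projections $(p_{ab} \in L(H) \,|\, a \in A,\, b \in B)$ such that $\sum_{b \in B} p_{ab} = 1_H$ for all $a \in A$ and functions $F: \mathcal X \times `A \to `B$, given by $F(H \otimes \mathbb C_a, \mathbb C_b)= L(H \otimes \mathbb C_a, \mathbb C_b)\cdot (p_{ab} \otimes 1)$ for $a \in A$ and $b \in B$. This correspondence restricts to a one-to-one correspondence between families of projections $(p_{ab} \in L(H) \,|\, a \in A, \, b \in B)$ witnessing $A \cong_q B$ and functions $F: \mathcal X \times `A \to `B$ such that (1) $[\![(\forall x \in \mathcal X)\,(\forall b_* \in `B^* )\,(\exists a \in `A)\, E_{`B}(F(x,a),b_* )]\!] = \top$; (2) $[\![(\forall (x = x_* ) \in \mathcal X \times \mathcal X^* )\, (\forall (a_1 = a_{1*}) \in `A \times `A^* )\,(\forall (a_2 = a_{2*}) \in `A \times `A^* )\,(E_{`A} (a_{1},a_{2*}) \leftrightarrow (E_{`B})_* (F_*(x_*,a_{1*}), F(x,a_{2})))]\!] = \top$; (3) $[\![(\forall (x = x_* ) \in \mathcal X \times \mathcal X^* )\, (\forall (a_1 = a_{1*}) \in `A \times `A^* )\,(\forall (a_2 = a_{2*}) \in `A \times `A^* )\,(\widehat R (a_{1},a_{2*}) \leftrightarrow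 (\widehat S)_* (F_*(x_*,a_{1*}), F(x,a_{2})))]\!] = \top$.
   Context: Witnessing. A finite simple graph $(A,\sim_A)$ is a finite set with its adjacency relation. A family of projections $(p_{ab}\in L(H)\,|\,a\in A,b\in B)$ witnesses $A\xrightarrow{q}B$ if (i) $\sum_{b\in B}p_{ab}=1_H$ for all $a\in A$, and (ii) $p_{a_1b_1}\cdot p_{a_2b_2}=0$ for all $a_1,a_2\in A$ and $b_1,b_2\in B$ satisfying either ($a_1=a_2$ and $b_1\ne b_2$) or ($a_1\sim_A a_2$ and $b_1\not\sim_B b_2$). It witnesses $A\cong_q B$ if it witnesses $A\xrightarrow{q}B$ and, with the roles of $A$ and $B$ exchanged (i.e., the family $q_{ba}=p_{ab}$), it witnesses $B\xrightarrow{q}A$. Operators. Hilbert spaces are complex. $L(H,K)$ is the space of bounded operators $H\to K$, $L(H)=L(H,H)$, $H^*=L(H,\mathbb C)$. For $a\in L(H,K)$: $a^\dagger\in L(K,H)$ is the Hermitian adjoint, $a^*\in L(K^*,H^* )$ the transpose, $a_*=(a^\dagger)^*\in L(H^*,K^* )$. Products of subspaces of operators denote linear spans of products. The identifications $X^{**}=X$, $(X\otimes Y)^*=X^*\otimes Y^*$, $\mathbb C^*=\mathbb C$, $X\otimes\mathbb C=X$ are used. Quantum sets. A quantum set $\mathcal X$ is an object uniquely determined by a set $\mathrm{At}(\mathcal X)$ of nonzero finite-dimensional Hilbert spaces, its atoms. $\mathcal X\times\mathcal Y$ has atoms $X\otimes Y$; $\mathcal X^*$ has atoms $X^*$; $\mathbf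 1$ (the empty product) has the single atom $\mathbb C$. For an ordinary set $A$, $`A$ has exactly one one-dimensional atom $\mathbb C_a$ for each $a\in A$ (distinct for distinct $a$); $`A^*$ means $(`A)^*$. Binary relations. A binary relation $R$ from $\mathcal X$ to $\mathcal Y$ is a choice of subspaces $R(X,Y)\le L(X,Y)$ for all atoms $X,Y$. Order, joins, meets and complement $\neg$ are componentwise (inclusion, span, intersection, orthogonal complement for $\langle a|b\rangle=\mathrm{Tr}(a^\dagger b)$); $\top$ and $\bot$ (or $\top_{\mathcal X}$, $\bot_{\mathcal X}$ for $\mathcal Y=\mathbf 1$) are the largest and smallest. $(S\circ R)(X,Z)=\sum_Y S(Y,Z)\cdot R(X,Y)$; $(R\times S)(X\otimes X',Y\otimes Y')=R(X,Y)\otimes S(X',Y')$; $R^\dagger(Y,X)=\{r^\dagger: r\in R(X,Y)\}$; $R_*(X^*,Y^* )=\{r_*: r\in R(X,Y)\}$; $I_{\mathcal X}(X,X)=\mathbb C1_X$, with other components $0$. A function $F:\mathcal X\to\mathcal Y$ is a binary relation with $F^\dagger\circ F\ge I_{\mathcal X}$ and $F\circ F^\dagger\le I_{\mathcal Y}$. For an ordinary binary relation $r\subseteq A\times B$, $`r(\mathbb C_a,\mathbb C_b)=L(\mathbb C_a,\mathbb C_b)$ if $(a,b)\in r$ and $0$ otherwise. A relation of arity $(\mathcal X_1,\dots,\mathcal X_n)$ is a binary relation $R$ from $\mathcal X_1\times\cdots\times\mathcal X_n$ to $\mathbf 1$; write $R(X_1\otimes\cdots\otimes X_n)$ for $R(X_1\otimes\cdots\otimes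 X_n,\mathbb C)$; its conjugate $R_*$ has arity $(\mathcal X_1^*,\dots,\mathcal X_n^* )$. The equality relation $E_{\mathcal X}$ of arity $(\mathcal X,\mathcal X^* )$ has $E_{\mathcal X}(X\otimes X^* )=\mathbb C\epsilon_X$, with $\epsilon_X:X\otimes X^*\to\mathbb C$ evaluation, and $E_{\mathcal X}(X_1\otimes X_2^* )=0$ for $X_1\ne X_2$; thus $(E_{`B})_*$ has arity $(`B^*,`B)$. For a binary relation $B$ from $\mathcal X$ to $\mathcal Y$, $\widehat B=E_{\mathcal Y}\circ(B\times I_{\mathcal Y^*})$, of arity $(\mathcal X,\mathcal Y^* )$; so $(\widehat B)_*$ has arity $(\mathcal X^*,\mathcal Y)$. Formulas. Each quantum set is a sort with infinitely many variables. Nonduplicating terms of sort $\mathcal Y$: variables of sort $\mathcal Y$, and $F(s_1,\dots,s_m)$ with $F:\mathcal X_1\times\cdots\times\mathcal X_m\to\mathcal Y$ a function and $s_i$ nonduplicating terms of sorts $\mathcal X_i$, no two sharing a variable. Nonduplicating atomic formulas: $R(t_1,\dots,t_n)$ with $R$ a relation of arity $(\mathcal Y_1,\dots,\mathcal Y_n)$ and $t_i$ nonduplicating terms of sorts $\mathcal Y_i$, no two sharing a variable. Formulas are built from these with connectives and quantifiers. Interpretation. For distinct variables $x_i$ of sorts $\mathcal X_i$ including the free variables of $\phi$, $[\![\phi]\!]=[\![(x_1,\dots,x_n)\in\mathcal X_1\times\cdots\times\mathcal X_n\,|\,\phi]\!]$ is a relation of arity $(\mathcal X_1,\dots,\mathcal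 X_n)$ (for a sentence, $\top$ or $\bot$), defined recursively. For a permutation $\pi$ of $\{1,\dots,n\}$, $m\le n$ and $R$ of arity $(\mathcal X_{\pi(1)},\dots,\mathcal X_{\pi(m)})$, $[\![R(x_{\pi(1)},\dots,x_{\pi(m)})]\!](X_1\otimes\cdots\otimes X_n)=(R\times\top_{\mathcal X_{\pi(m+1)}}\times\cdots\times\top_{\mathcal X_{\pi(n)}})(X_{\pi(1)}\otimes\cdots\otimes X_{\pi(n)})\cdot u_\pi$, where $u_\pi$ is the unitary permuting tensor factors. $[\![\neg\phi]\!]=\neg[\![\phi]\!]$; $[\![\phi\wedge\psi]\!]=[\![\phi]\!]\wedge[\![\psi]\!]$; $[\![(x_1,\dots,x_n)\,|\,(\forall x\in\mathcal X)\,\phi]\!]=\sup\{R \text{ of arity }(\mathcal X_1,\dots,\mathcal X_n): \top_{\mathcal X}\times R\le[\![(x,x_1,\dots,x_n)\,|\,\phi]\!]\}$. Abbreviations: $\phi\vee\psi$ is $\neg(\neg\phi\wedge\neg\psi)$; $\exists$ is $\neg\forall\neg$; $\phi\to\psi$ is $\neg\phi\vee(\phi\wedge\psi)$; $\phi\leftrightarrow\psi$ is $(\phi\to\psi)\wedge(\psi\to\phi)$; $(\forall(x=x_* )\in\mathcal X\times\mathcal X^* )\,\phi$ is $(\forall x_*\in\mathcal X^* )(\forall x\in\mathcal X)(E_{\mathcal X}(x,x_* )\to\phi)$, with $x,x_*$ distinct variables; $(\exists(x=x_* )\in\mathcal X\times\mathcal X^* )\,\phi$ is $\neg(\forall(x=x_*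 )\in\mathcal X\times\mathcal X^* )\,\neg\phi$. If not all $t_i$ are variables, $R(t_1,\dots,t_n)$ abbreviates $(\exists(y_n=y_{n*})\in\mathcal Y_n\times\mathcal Y_n^* )\cdots(\exists(y_1=y_{1*})\in\mathcal Y_1\times\mathcal Y_1^* )(R(y_1,\dots,y_n)\wedge t_1\curvearrowright y_{1*}\wedge\cdots\wedge t_n\curvearrowright y_{n*})$ with all $y_i,y_{i*}$ new variables, where $t\curvearrowright y_*$ is $E_{\mathcal Y}(t,y_* )$ if $t$ is a variable and $\widehat F(s_1,\dots,s_m,y_* )$ if $t=F(s_1,\dots,s_m)$. *)

theory Defs
  imports Complex_Main "HOL-Library.FuncSet" "HOL-Library.Function_Algebras"
begin

class complex_inner = ab_group_add +
  fixes scaleC :: "complex \<Rightarrow> 'a \<Rightarrow> 'a"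
    and cinner :: "'a \<Rightarrow> 'a \<Rightarrow> complex"
  assumes scaleC_add_right: "scaleC c (x + y) = scaleC c x + scaleC c y"
    and scaleC_add_left: "scaleC (c + d) x = scaleC c x + scaleC d x"
    and scaleC_scaleC: "scaleC c (scaleC d x) = scaleC (c * d) x"
    and scaleC_one: "scaleC 1 x = x"
    and cinner_add_right: "cinner x (y + z) = cinner x y + cinner x z"
    and cinner_scaleC_right: "cinner x (scaleC c y) = c * cinner x y"
    and cinner_commute: "cinner x y = cnj (cinner y x)"
    and cinner_ge_zero: "0 \<le> Re (cinner x x)"
    and cinner_eq_zero_iff: "cinner x x = 0 \<longleftrightarrow> x = 0"

global_interpretation hilb: vector_space "scaleC :: complex \<Rightarrow> 'a::complex_inner \<Rightarrow> 'a"
  by unfold_locales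
    (simp_all add: scaleC_add_right scaleC_add_left scaleC_scaleC scaleC_one)

definition orthonormal_basis :: "'h::complex_inner set \<Rightarrow> bool" where
  "orthonormal_basis E \<longleftrightarrow>
     finite E \<and> hilb.span E = UNIV \<and>
     (\<forall>e\<in>E. \<forall>f\<in>E. cinner e f = (if e = f then 1 else 0))"

lemma orthonormal_basis_exists:
  assumes "finite S" and "hilb.span S = (UNIV :: 'h::complex_inner set)"
  shows "\<exists>E::'h set. orthonormal_basis E"
proof -
  have "\<exists>E::'h set. finite E \<and> hilb.span E = hilb.span S \<and>
          (\<forall>e\<in>E. \<forall>f\<in>E. cinner e f = (if e = f then 1 else 0))"
    using assms(1)
  proof (induction S)
    case empty
    then show ?case by (intro exI[of _ "{}"]) simp
  next
    case (insert v S)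
    then obtain E :: "'h set" where E: "finite E" "hilb.span E = hilb.span S"
      and orth: "\<And>e f. e \<in> E \<Longrightarrow> f \<in> E \<Longrightarrow> cinner e f = (if e = f then 1 else 0)"
      by blast
    have ci0: "cinner x (0::'h) = 0" for x
      using cinner_scaleC_right[of x 0 0] by simp
    have cisum: "cinner x (\<Sum>e\<in>F. g e) = (\<Sum>e\<in>F. cinner x (g e))" for x :: 'h and F and g :: "'h \<Rightarrow> 'h"
      by (induction F rule: infinite_finite_induct) (simp_all add: ci0 cinner_add_right)
    define s where "s = (\<Sum>e\<in>E. scaleC (cinner e v) e)"
    define w where "w = v - s"
    have s: "s \<in> hilb.span E"
      unfolding s_def by (intro hilb.span_sum hilb.span_scale hilb.span_base)
    have v: "v = w + s" by (simp add: w_def)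
    have ew: "cinner e w = 0" if "e \<in> E" for e
    proof -
      have "cinner e s = (\<Sum>f\<in>E. if e = f then cinner f v else 0)"
        unfolding s_def cisum cinner_scaleC_right
        by (rule sum.cong) (auto simp: orth that)
      then have "cinner e s = cinner e v"
        using E(1) that by simp
      then show ?thesis
        using cinner_add_right[of e w s] v by simp
    qed
    show ?case
    proof (cases "w = 0")
      case True
      then have "v \<in> hilb.span S" using v s E(2) by simp
      then have "hilb.span (insert v S) = hilb.span S"
        by (rule hilb.span_redundant)
      then show ?thesis using E orth by auto
    next
      case False
      define c where "c = complex_of_real (1 / sqrt (Re (cinner w w)))"
      define u where "u = scaleC c w"
      have im: "cinner w w = complex_of_real (Re (cinner w w))"
        using cinner_commute[of w w] by (metis Reals_cnj_iff of_real_Re)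
      have pos: "Re (cinner w w) > 0"
        using cinner_ge_zero[of w] im cinner_eq_zero_iff[of w] False by (metis less_eq_real_def of_real_0)
      have c0: "c \<noteq> 0" using pos by (simp add: c_def)
      have wu: "w = scaleC (inverse c) u"
        using c0 by (simp add: u_def scaleC_scaleC scaleC_one)
      have eu: "cinner e u = 0" "cinner u e = 0" if "e \<in> E" for e
        using ew[OF that] cinner_commute[of u e] by (simp_all add: u_def cinner_scaleC_right)
      have "cinner u u = c * (cnj c * cinner w w)"
        using cinner_commute[of u w] im
        by (simp add: u_def cinner_scaleC_right) (metis complex_cnj_complex_of_real complex_cnj_mult mult.commute)
      also have "\<dots> = complex_of_real ((1 / sqrt (Re (cinner w w)))^2 * Re (cinner w w))"
        by (subst im) (simp add: c_def power2_eq_square flip: of_real_mult)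
      also have "\<dots> = 1" using pos by (simp add: power_divide)
      finally have uu: "cinner u u = 1" .
      have "hilb.span (insert u E) = hilb.span (insert v S)"
      proof (rule antisym; rule hilb.span_minimal[OF _ hilb.subspace_span])
        have 1: "E \<subseteq> hilb.span (insert v S)"
          using E(2) hilb.span_superset[of E] hilb.span_mono[of S "insert v S"] by blast
        then have "s \<in> hilb.span (insert v S)"
          using s hilb.span_minimal[OF 1 hilb.subspace_span] by blast
        then have "u \<in> hilb.span (insert v S)"
          unfolding u_def w_def by (intro hilb.span_scale hilb.span_diff) (auto intro: hilb.span_base)
        with 1 show "insert u E \<subseteq> hilb.span (insert v S)" by blast
        have 2: "hilb.span E \<subseteq> hilb.span (insert u E)" by (rule hilb.span_mono) blast
        have "v \<in> hilb.span (insert u E)"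
          unfolding v wu using s 2 by (intro hilb.span_add hilb.span_scale) (auto intro: hilb.span_base)
        then show "insert v S \<subseteq> hilb.span (insert u E)"
          using 2 E(2) hilb.span_superset[of S] by blast
      qed
      moreover have "u \<notin> E"
        using eu(1)[of u] uu by auto
      ultimately show ?thesis
        using E(1) orth eu uu by (intro exI[of _ "insert u E"]) auto
    qed
  qed
  then show ?thesis using assms(2) by (auto simp: orthonormal_basis_def)
qed

text \<open>Boundedness is automatic for linear maps in finite dimension.\<close>

definition projections :: "('h::complex_inner \<Rightarrow> 'h) set" where
  "projections = {p. Vector_Spaces.linear scaleC scaleC p \<and> p \<circ> p = p \<and>
                     (\<forall>x y. cinner (p x) y = cinner x (p y))}"

definition simple_graph :: "'v set \<Rightarrow> ('v \<times> 'v) set \<Rightarrow> bool" where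
  "simple_graph A adj \<longleftrightarrow> finite A \<and> adj \<subseteq> A \<times> A \<and> sym adj \<and> irrefl adj"

definition sums_to_one :: "'v set \<Rightarrow> 'w set \<Rightarrow> ('v \<times> 'w \<Rightarrow> 'h::complex_inner \<Rightarrow> 'h) \<Rightarrow> bool" where
  "sums_to_one A B p \<longleftrightarrow> (\<forall>a\<in>A. (\<Sum>b\<in>B. p (a, b)) = id)"

definition witnesses_hom ::
    "'v set \<Rightarrow> ('v \<times> 'v) set \<Rightarrow> 'w set \<Rightarrow> ('w \<times> 'w) set \<Rightarrow> ('v \<times> 'w \<Rightarrow> 'h::complex_inner \<Rightarrow> 'h) \<Rightarrow> bool" where
  "witnesses_hom A adjA B adjB p \<longleftrightarrow>
     sums_to_one A B p \<and>
     (\<forall>a1\<in>A. \<forall>a2\<in>A. \<forall>b1\<in>B. \<forall>b2\<in>B.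
        (a1 = a2 \<and> b1 \<noteq> b2) \<or> ((a1, a2) \<in> adjA \<and> (b1, b2) \<notin> adjB) \<longrightarrow>
        p (a1, b1) \<circ> p (a2, b2) = (\<lambda>_. 0))"

definition witnesses_iso ::
    "'v set \<Rightarrow> ('v \<times> 'v) set \<Rightarrow> 'w set \<Rightarrow> ('w \<times> 'w) set \<Rightarrow> ('v \<times> 'w \<Rightarrow> 'h::complex_inner \<Rightarrow> 'h) \<Rightarrow> bool" where
  "witnesses_iso A adjA B adjB p \<longleftrightarrow>
     witnesses_hom A adjA B adjB p \<and> witnesses_hom B adjB A adjA (\<lambda>(b, a). p (a, b))"

text \<open>
  An atom is a nonzero finite-dimensional Hilbert space, presented by (labels of) the vectors of
  an orthonormal basis.  The dual atom is presented by the dual basis, labelled in the same way.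
  The tensor product of atoms \<open>X1, \<dots>, Xn\<close> is the list \<open>[X1, \<dots>, Xn]\<close>, with the
  product basis; the empty list is the unit \<open>\<complex>\<close>.  Thus associativity and
  unitality of the tensor product, \<open>X** = X\<close>, \<open>\<complex>* = \<complex>\<close> and
  \<open>(X \<otimes> Y)* = X* \<otimes> Y*\<close> hold on the nose.
\<close>

datatype 'i atom = Space "'i set" | DualSpace "'i set"

fun basis :: "'i atom \<Rightarrow> 'i set" where
  "basis (Space I) = I"
| "basis (DualSpace I) = I"

fun dual_atom :: "'i atom \<Rightarrow> 'i atom" where
  "dual_atom (Space I) = DualSpace I"
| "dual_atom (DualSpace I) = Space I"

definition idx :: "'i atom list \<Rightarrow> 'i list set" where
  "idx X = listset (map basis X)"

type_synonym 'i qset = "'i atom set"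

definition dual :: "'i qset \<Rightarrow> 'i qset" where
  "dual Q = dual_atom ` Q"

text \<open>
  An operator is given by its matrix in the product bases; the first argument is the row (an
  index of the target), the second one the column (an index of the source).
\<close>

type_synonym 'i oper = "'i list \<Rightarrow> 'i list \<Rightarrow> complex"

definition scale_op :: "complex \<Rightarrow> 'i oper \<Rightarrow> 'i oper" where
  "scale_op c a = (\<lambda>i j. c * a i j)"

global_interpretation oper: vector_space "scale_op :: complex \<Rightarrow> 'i oper \<Rightarrow> 'i oper"
  by unfold_locales (auto simp: scale_op_def fun_eq_iff algebra_simps)

definition L :: "'i atom list \<Rightarrow> 'i atom list \<Rightarrow> 'i oper set" where
  "L X Y = {a. \<forall>i j. a i j \<noteq> 0 \<longrightarrow> i \<in> idx Y \<and> j \<in> idx X}"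

text \<open>\<open>op_mult Y b a\<close> is the product of \<open>a \<in> L X Y\<close> and \<open>b \<in> L Y Z\<close>.\<close>

definition op_mult :: "'i atom list \<Rightarrow> 'i oper \<Rightarrow> 'i oper \<Rightarrow> 'i oper" where
  "op_mult Y b a = (\<lambda>i k. \<Sum>j\<in>idx Y. b i j * a j k)"

definition op_one :: "'i atom list \<Rightarrow> 'i oper" where
  "op_one X = (\<lambda>i j. if i \<in> idx X \<and> i = j then 1 else 0)"

text \<open>\<open>op_tensor m n a b\<close> is \<open>a \<otimes> b\<close> where the source and the target of
  \<open>a\<close> are tensor products of \<open>m\<close> and \<open>n\<close> atoms, respectively.\<close>

definition op_tensor :: "nat \<Rightarrow> nat \<Rightarrow> 'i oper \<Rightarrow> 'i oper \<Rightarrow> 'i oper" where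
  "op_tensor m n a b = (\<lambda>i j. a (take n i) (take m j) * b (drop n i) (drop m j))"

definition op_adj :: "'i oper \<Rightarrow> 'i oper" where
  "op_adj a = (\<lambda>i j. cnj (a j i))"

text \<open>In dual bases the transpose of an operator has the transposed matrix.\<close>

definition op_transpose :: "'i oper \<Rightarrow> 'i oper" where
  "op_transpose a = (\<lambda>i j. a j i)"

definition op_conj :: "'i oper \<Rightarrow> 'i oper" where
  "op_conj a = op_transpose (op_adj a)"

definition op_trace :: "'i atom list \<Rightarrow> 'i oper \<Rightarrow> complex" where
  "op_trace X a = (\<Sum>i\<in>idx X. a i i)"

text \<open>The unitary taking \<open>e\<^sub>1 \<otimes> \<dots> \<otimes> e\<^sub>n\<close> to the tensor product of the
  vectors \<open>e\<close> at the (0-based) positions listed in \<open>js\<close>.\<close>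

definition op_permute :: "nat list \<Rightarrow> 'i atom list \<Rightarrow> 'i oper" where
  "op_permute js X = (\<lambda>i j. if j \<in> idx X \<and> i = map ((!) j) js then 1 else 0)"

text \<open>\<open>src\<close> and \<open>tgt\<close> are lists of factors; a relation of arity \<open>Xs\<close>
  is a binary relation with \<open>src = Xs\<close> and \<open>tgt = []\<close>.\<close>

datatype 'i brel =
  Brel (src: "'i qset list") (tgt: "'i qset list")
       (cmpt: "'i atom list \<Rightarrow> 'i atom list \<Rightarrow> 'i oper set")

text \<open>Components at lists of atoms outside \<open>src\<close> and \<open>tgt\<close> are normalized to the zero
  space, so that equality of binary relations is equality of their components.\<close>

definition mk_brel ::
    "'i qset list \<Rightarrow> 'i qset list \<Rightarrow> ('i atom list \<Rightarrow> 'i atom list \<Rightarrow> 'i oper set) \<Rightarrow> 'i brel" where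
  "mk_brel Xs Ys f =
     Brel Xs Ys (\<lambda>X Y. if X \<in> listset Xs \<and> Y \<in> listset Ys then f X Y else {0})"

definition brels :: "'i qset list \<Rightarrow> 'i qset list \<Rightarrow> 'i brel set" where
  "brels Xs Ys = {R. src R = Xs \<and> tgt R = Ys \<and>
     (\<forall>X Y. if X \<in> listset Xs \<and> Y \<in> listset Ys
            then oper.subspace (cmpt R X Y) \<and> cmpt R X Y \<subseteq> L X Y
            else cmpt R X Y = {0})}"

definition rel_le :: "'i brel \<Rightarrow> 'i brel \<Rightarrow> bool" where
  "rel_le R S \<longleftrightarrow> src R = src S \<and> tgt R = tgt S \<and> (\<forall>X Y. cmpt R X Y \<subseteq> cmpt S X Y)"

definition rel_top :: "'i qset list \<Rightarrow> 'i qset list \<Rightarrow> 'i brel" where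
  "rel_top Xs Ys = mk_brel Xs Ys L"

definition rel_meet :: "'i brel \<Rightarrow> 'i brel \<Rightarrow> 'i brel" where
  "rel_meet R S = mk_brel (src R) (tgt R) (\<lambda>X Y. cmpt R X Y \<inter> cmpt S X Y)"

definition rel_sup :: "'i qset list \<Rightarrow> 'i qset list \<Rightarrow> 'i brel set \<Rightarrow> 'i brel" where
  "rel_sup Xs Ys \<R> = mk_brel Xs Ys (\<lambda>X Y. oper.span (\<Union>R\<in>\<R>. cmpt R X Y))"

definition rel_neg :: "'i brel \<Rightarrow> 'i brel" where
  "rel_neg R = mk_brel (src R) (tgt R)
     (\<lambda>X Y. {b \<in> L X Y. \<forall>a\<in>cmpt R X Y. op_trace X (op_mult Y (op_adj a) b) = 0})"

definition rel_id :: "'i qset list \<Rightarrow> 'i brel" where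
  "rel_id Xs = mk_brel Xs Xs (\<lambda>X Y. if X = Y then oper.span {op_one X} else {0})"

definition rel_comp :: "'i brel \<Rightarrow> 'i brel \<Rightarrow> 'i brel" where
  "rel_comp S R = mk_brel (src R) (tgt S)
     (\<lambda>X Z. oper.span {op_mult Y s r |Y s r. Y \<in> listset (tgt R) \<and> s \<in> cmpt S Y Z \<and> r \<in> cmpt R X Y})"

definition rel_times :: "'i brel \<Rightarrow> 'i brel \<Rightarrow> 'i brel" where
  "rel_times R S =
     (let m = length (src R); n = length (tgt R) in
      mk_brel (src R @ src S) (tgt R @ tgt S)
        (\<lambda>X Y. oper.span {op_tensor m n r s |r s.
                  r \<in> cmpt R (take m X) (take n Y) \<and> s \<in> cmpt S (drop m X) (drop n Y)}))"

definition rel_adj :: "'i brel \<Rightarrow> 'i brel" where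
  "rel_adj R = mk_brel (tgt R) (src R) (\<lambda>Y X. op_adj ` cmpt R X Y)"

definition rel_conjugate :: "'i brel \<Rightarrow> 'i brel" where
  "rel_conjugate R = mk_brel (map dual (src R)) (map dual (tgt R))
     (\<lambda>X Y. op_conj ` cmpt R (map dual_atom X) (map dual_atom Y))"

definition qfunctions :: "'i qset list \<Rightarrow> 'i qset list \<Rightarrow> 'i brel set" where
  "qfunctions Xs Ys = {F \<in> brels Xs Ys.
     rel_le (rel_id Xs) (rel_comp (rel_adj F) F) \<and> rel_le (rel_comp F (rel_adj F)) (rel_id Ys)}"

definition evaluation :: "'i atom \<Rightarrow> 'i oper" where
  "evaluation X = (\<lambda>i j. if i = [] \<and> (\<exists>e\<in>basis X. j = [e, e]) then 1 else 0)"

definition rel_eq :: "'i qset \<Rightarrow> 'i brel" where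
  "rel_eq Q = mk_brel [Q, dual Q] []
     (\<lambda>X _. if X ! 1 = dual_atom (X ! 0) then oper.span {evaluation (X ! 0)} else {0})"

definition rel_hat :: "'i brel \<Rightarrow> 'i brel" where
  "rel_hat B = (let Q = hd (tgt B) in rel_comp (rel_eq Q) (rel_times B (rel_id [dual Q])))"

text \<open>A variable is given by its sort, a level and a number.  The variables introduced when
  nonvariable terms are expanded have positive level; formulas are meant to be written with
  variables of level 0, so that the introduced variables are new.\<close>

datatype 'i var = Var (vsort: "'i qset") (level: nat) (number: nat)

datatype 'i trm = V (the_var: "'i var") | App "'i brel" "'i trm list"

fun trm_sort :: "'i trm \<Rightarrow> 'i qset" where
  "trm_sort (V v) = vsort v"
| "trm_sort (App F ts) = hd (tgt F)"

primrec trm_weight :: "'i trm \<Rightarrow> nat" where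
  "trm_weight (V v) = 1"
| "trm_weight (App F ts) = Suc (Suc (sum_list (map trm_weight ts)))"

datatype 'i fm = Rel "'i brel" "'i var list" | Neg "'i fm" | Conj "'i fm" "'i fm" | Forall "'i var" "'i fm"

definition Or :: "'i fm \<Rightarrow> 'i fm \<Rightarrow> 'i fm" where
  "Or \<phi> \<psi> = Neg (Conj (Neg \<phi>) (Neg \<psi>))"

definition Exists :: "'i var \<Rightarrow> 'i fm \<Rightarrow> 'i fm" where
  "Exists x \<phi> = Neg (Forall x (Neg \<phi>))"

definition Imp :: "'i fm \<Rightarrow> 'i fm \<Rightarrow> 'i fm" where
  "Imp \<phi> \<psi> = Or (Neg \<phi>) (Conj \<phi> \<psi>)"

definition Iff :: "'i fm \<Rightarrow> 'i fm \<Rightarrow> 'i fm" where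
  "Iff \<phi> \<psi> = Conj (Imp \<phi> \<psi>) (Imp \<psi> \<phi>)"

text \<open>Quantification over \<open>(x = x') \<in> Q \<times> Q*\<close>, where \<open>Q\<close> is the sort of \<open>x\<close>;
  \<open>x'\<close> is to have sort \<open>dual Q\<close>.\<close>

definition ForallEq :: "'i var \<Rightarrow> 'i var \<Rightarrow> 'i fm \<Rightarrow> 'i fm" where
  "ForallEq x x' \<phi> = Forall x' (Forall x (Imp (Rel (rel_eq (vsort x)) [x, x']) \<phi>))"

definition ExistsEq :: "'i var \<Rightarrow> 'i var \<Rightarrow> 'i fm \<Rightarrow> 'i fm" where
  "ExistsEq x x' \<phi> = Neg (ForallEq x x' (Neg \<phi>))"

text \<open>\<open>atomic_at d R ts\<close> is the formula abbreviated by \<open>R(ts)\<close>, all new variables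
  having level at least \<open>d\<close>.  Since \<open>fold\<close> applies its function to the last list element
  outermost, the quantifier prefix starts with the variables for the last term.\<close>

function atomic_at :: "nat \<Rightarrow> 'i brel \<Rightarrow> 'i trm list \<Rightarrow> 'i fm"
  and graph_at :: "nat \<Rightarrow> 'i trm \<Rightarrow> 'i var \<Rightarrow> 'i fm" where
  "atomic_at d R ts =
     (if \<forall>t\<in>set ts. is_V t then Rel R (map the_var ts)
      else let n = length ts;
               y = (\<lambda>i. Var (trm_sort (ts ! i)) d (2 * i));
               y' = (\<lambda>i. Var (dual (trm_sort (ts ! i))) d (2 * i + 1))
           in fold (\<lambda>i. ExistsEq (y i) (y' i)) [0..<n]
                (foldl Conj (Rel R (map y [0..<n]))
                   (map (\<lambda>i. graph_at (Suc d) (ts ! i) (y' i)) [0..<n])))"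
| "graph_at d (V v) y' = Rel (rel_eq (vsort v)) [v, y']"
| "graph_at d (App F ss) y' = atomic_at d (rel_hat F) (ss @ [V y'])"
  by pat_completeness auto
termination
proof (relation "measure (\<lambda>z. case z of Inl (d, R, ts) \<Rightarrow> 2 * sum_list (map trm_weight ts) + 1
                                    | Inr (d, t, y) \<Rightarrow> 2 * trm_weight t)", goal_cases)
  case (2 d R ts n y y' i)
  then have "trm_weight (ts ! i) \<le> sum_list (map trm_weight ts)"
    by (intro member_le_sum_list) auto
  then show ?case by simp
qed simp_all

definition atomic :: "'i brel \<Rightarrow> 'i trm list \<Rightarrow> 'i fm" where
  "atomic R ts = atomic_at 1 R ts"

definition position :: "'i var list \<Rightarrow> 'i var \<Rightarrow> nat" where
  "position \<Gamma> v = (LEAST i. i < length \<Gamma> \<and> \<Gamma> ! i = v)"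

text \<open>\<open>interp \<phi> [x1, \<dots>, xn]\<close> is the relation
  \<open>\<lbrakk>(x1, \<dots>, xn) \<in> X1 \<times> \<dots> \<times> Xn | \<phi>\<rbrakk>\<close>.  In the atomic case
  \<open>js @ ks\<close> lists the values of the permutation \<open>\<pi>\<close>.\<close>

primrec interp :: "'i fm \<Rightarrow> 'i var list \<Rightarrow> 'i brel" where
  "interp (Rel R vs) \<Gamma> =
     (let js = map (position \<Gamma>) vs;
          ks = filter (\<lambda>i. i \<notin> set js) [0..<length \<Gamma>];
          R' = foldl rel_times R (map (\<lambda>k. rel_top [vsort (\<Gamma> ! k)] []) ks)
      in mk_brel (map vsort \<Gamma>) []
           (\<lambda>X _. let X' = map ((!) X) (js @ ks)
                  in (\<lambda>r. op_mult X' r (op_permute (js @ ks) X)) ` cmpt R' X' []))"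
| "interp (Neg \<phi>) \<Gamma> = rel_neg (interp \<phi> \<Gamma>)"
| "interp (Conj \<phi> \<psi>) \<Gamma> = rel_meet (interp \<phi> \<Gamma>) (interp \<psi> \<Gamma>)"
| "interp (Forall x \<phi>) \<Gamma> =
     rel_sup (map vsort \<Gamma>) []
       {R \<in> brels (map vsort \<Gamma>) []. rel_le (rel_times (rel_top [vsort x] []) R) (interp \<phi> (x # \<Gamma>))}"

definition holds :: "'i fm \<Rightarrow> bool" where
  "holds \<phi> \<longleftrightarrow> interp \<phi> [] = rel_top [] []"

text \<open>Basis labels: vectors of the Hilbert space \<open>H\<close>, and for each element \<open>a\<close> of an
  ordinary set the unit vector of \<open>\<complex>\<^sub>a\<close>.\<close>

type_synonym ('h, 'v) label = "'h + 'v"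

definition point :: "'v \<Rightarrow> ('h, 'v) label atom" where
  "point a = Space {Inr a}"

definition classical :: "'v set \<Rightarrow> ('h, 'v) label qset" where
  "classical A = point ` A"

definition classical_rel :: "'v set \<Rightarrow> 'v set \<Rightarrow> ('v \<times> 'v) set \<Rightarrow> ('h, 'v) label brel" where
  "classical_rel A B r = mk_brel [classical A] [classical B]
     (\<lambda>X Y. if \<exists>(a, b)\<in>r. X = [point a] \<and> Y = [point b] then L X Y else {0})"

definition hspace :: "'h set \<Rightarrow> ('h, 'v) label atom" where
  "hspace E = Space (Inl ` E)"

text \<open>The matrix of an operator on \<open>H\<close> in the orthonormal basis \<open>E\<close>.\<close>

definition op_of :: "'h::complex_inner set \<Rightarrow> ('h \<Rightarrow> 'h) \<Rightarrow> ('h, 'v) label oper" where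
  "op_of E p = (\<lambda>i j. case (i, j) of
      ([Inl e], [Inl f]) \<Rightarrow> if e \<in> E \<and> f \<in> E then cinner e (p f) else 0
    | _ \<Rightarrow> 0)"

definition family_to_rel ::
    "'h::complex_inner set \<Rightarrow> 'v set \<Rightarrow> 'v set \<Rightarrow> ('v \<times> 'v \<Rightarrow> 'h \<Rightarrow> 'h) \<Rightarrow> ('h, 'v) label brel" where
  "family_to_rel E A B p = mk_brel [{hspace E}, classical A] [classical B]
     (\<lambda>X Y. oper.span {op_mult X l (op_tensor 1 1 (op_of E (p (a, b))) (op_one [point a])) |l a b.
                         a \<in> A \<and> b \<in> B \<and> X = [hspace E, point a] \<and> Y = [point b] \<and> l \<in> L X Y})"

end

theory Submission
  imports Defs
begin

text \<open>
  Every atom of a classical quantum set is one-dimensional, so a relation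
  \<open>F\<close> from \<open>\<X> \<times> `A\<close> to \<open>`B\<close> is a choice of spaces \<open>W a b\<close> of
  functionals on \<open>H\<close>.  That \<open>F\<close> is a function means, for each \<open>a\<close>, that the spaces
  \<open>W a b\<close> are mutually orthogonal and that the identity of \<open>H\<close> is a sum of operators
  \<open>T b\<close> in \<open>W\<^sup>\<dagger> \<cdot> W\<close>, where \<open>W = W a b\<close>.  Orthogonality
  makes the \<open>T b\<close> annihilate one another, so multiplying the decomposition of the identity
  by \<open>T b\<close> gives \<open>T b = T b \<cdot> T b\<close> and, with adjoints,
  \<open>T b = T b \<cdot> (T b)\<^sup>\<dagger>\<close>: the \<open>T b\<close> are projections, and
  \<open>W a b\<close> consists of the functionals that \<open>T b\<close> fixes.  This is the first bijection
  (\<open>qfunction_projections\<close>, \<open>bij_betw_family_to_rel\<close>).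

  In the formulas, only \<open>x\<close> and \<open>x\<^sub>*\<close> range over something nonclassical.  Once the
  values of the classical variables are fixed, the interpretation of a formula is a subspace of the
  functionals on \<open>H\<close>, or on the tensor product of \<open>H\<close> and its dual; this subspace is
  called \<open>val\<close> below.  In terms of it, a classical universal quantifier is an intersection, an
  existential one is the double complement of a union, quantification over \<open>(a = a\<^sub>*)\<close> just
  gives both variables the same value, and an equivalence whose left side is \<open>\<top>\<close> or
  \<open>\<bottom>\<close> is the closure or the complement of its right side.  This rests on the Galois
  connection given by orthogonal complements, a space being closed if it is its own double complement,
  and on the fact that a space meets its complement only in 0.

  In the second and third sentence the outermost quantifier asks whether the evaluation functional \<open>\<epsilon>\<close>
  belongs to what follows it.  Identify functionals on the tensor product of \<open>H\<close> and its dual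
  with matrices, so that \<open>\<epsilon>\<close> is the identity matrix.  For values \<open>a, a'\<close> of the two
  quantified variables, the right side of the equivalence is the closure of the sum, over the related
  pairs \<open>(b, b')\<close>, of the matrices fixed by \<open>p (a', b')\<close> on the left and by
  \<open>p (a, b)\<close> on the right, up to complex conjugation.  The spaces belonging to different pairs
  are orthogonal, and \<open>\<epsilon>\<close> is the sum of the products \<open>p (a', b') \<cdot> p (a, b)\<close>,
  one in each space.  Hence \<open>\<epsilon>\<close> lies in the closed sum exactly if the products for
  unrelated pairs vanish, and is orthogonal to it exactly if the products for related pairs vanish
  (\<open>resolution_perp\<close>, \<open>evaluation_sandwiched\<close>, \<open>holds_comparison\<close>).  So these
  sentences say that \<open>p (a', b') \<cdot> p (a, b) = 0\<close> whenever exactly one of the pairs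
  \<open>(a, a')\<close> and \<open>(b, b')\<close> is related, by equality in the second sentence and by adjacency in
  the third.  Given the second, the projections \<open>p (a, b)\<close> for fixed \<open>b\<close> are mutually
  orthogonal, and the first, which says that their ranges span \<open>H\<close>, becomes \<open>(\<Sum>a\<in>A. p (a, b)) = id\<close> (\<open>holds_surjective\<close>).
  Together these are the conditions for witnessing the isomorphism (\<open>witnesses_iso_iff\<close>).
\<close>

section \<open>Index sets, functionals and relations\<close>

lemma in_listset: "xs \<in> listset As \<longleftrightarrow> list_all2 (\<in>) xs As"
  by (induction As arbitrary: xs) (auto simp: set_Cons_def list_all2_Cons2)

lemma in_idx: "j \<in> idx X \<longleftrightarrow> list_all2 (\<lambda>l A. l \<in> basis A) j X"
  by (simp add: idx_def in_listset list.rel_map)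

lemma idx_Nil [simp]: "idx [] = {[]}"
  by (auto simp: in_idx)

lemma in_idx_append:
  "length i = length X \<Longrightarrow> i @ j \<in> idx (X @ Y) \<longleftrightarrow> i \<in> idx X \<and> j \<in> idx Y"
  by (auto simp: in_idx list_all2_append dest: list_all2_lengthD)

lemma in_idx_appendE:
  assumes "k \<in> idx (X @ Y)"
  obtains i j where "k = i @ j" "i \<in> idx X" "j \<in> idx Y"
  using assms by (auto simp: in_idx list_all2_append2)

lemma in_idx_append_iff:
  "k \<in> idx (X @ Y) \<longleftrightarrow> take (length X) k \<in> idx X \<and> drop (length X) k \<in> idx Y"
proof
  assume "k \<in> idx (X @ Y)"
  then obtain i j where k: "k = i @ j" "i \<in> idx X" "j \<in> idx Y"
    by (rule in_idx_appendE)
  moreover have "length i = length X"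
    using k(2) by (simp add: in_idx list_all2_lengthD)
  ultimately show "take (length X) k \<in> idx X \<and> drop (length X) k \<in> idx Y"
    by simp
next
  assume *: "take (length X) k \<in> idx X \<and> drop (length X) k \<in> idx Y"
  have "length (take (length X) k) = length X"
    using * by (meson in_idx list_all2_lengthD)
  from in_idx_append[OF this, of "drop (length X) k" Y] * show "k \<in> idx (X @ Y)"
    by simp
qed

lemma in_idx_map:
  "j \<in> idx (map \<alpha> \<Gamma>) \<Longrightarrow> length j = length \<Gamma>"
  by (auto simp: in_idx dest: list_all2_lengthD)

lemma map_in_idx: "map \<eta> \<Gamma> \<in> idx (map \<alpha> \<Gamma>) \<longleftrightarrow> (\<forall>v\<in>set \<Gamma>. \<eta> v \<in> basis (\<alpha> v))"
  by (simp add: in_idx list.rel_map list.rel_refl_strong list_all2_same)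

lemma finite_idx:
  assumes "\<And>A. A \<in> set X \<Longrightarrow> finite (basis A)"
  shows "finite (idx X)"
  using assms
proof (induction X)
  case (Cons A X)
  have "idx (A # X) = (\<lambda>(l, j). l # j) ` (basis A \<times> idx X)"
    by (auto simp: idx_def set_Cons_def)
  then show ?case using Cons by simp
qed simp

lemma L_iff: "g \<in> L X [] \<longleftrightarrow> (\<forall>i j. g i j \<noteq> 0 \<longrightarrow> i = [] \<and> j \<in> idx X)"
  by (auto simp: L_def)

lemma functional_eqI:
  assumes "f \<in> L X []" "g \<in> L X []" "\<And>j. j \<in> idx X \<Longrightarrow> f [] j = g [] j"
  shows "f = g"
proof (intro ext)
  fix i j show "f i j = g i j"
    using assms unfolding L_iff by metis
qed

lemma subspace_L: "oper.subspace (L X Y)"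
  unfolding oper.subspace_def L_def scale_op_def plus_fun_def zero_fun_def by auto (metis add_0)+

lemma cmpt_mk_brel [simp]:
  "X \<in> listset Xs \<Longrightarrow> Y \<in> listset Ys \<Longrightarrow> cmpt (mk_brel Xs Ys f) X Y = f X Y"
  by (simp add: mk_brel_def)

lemma src_mk_brel [simp]: "src (mk_brel Xs Ys f) = Xs"
  and tgt_mk_brel [simp]: "tgt (mk_brel Xs Ys f) = Ys"
  by (simp_all add: mk_brel_def)

lemma cmpt_mk_brel_outside:
  "\<not> (X \<in> listset Xs \<and> Y \<in> listset Ys) \<Longrightarrow> cmpt (mk_brel Xs Ys f) X Y = {0}"
  by (auto simp: mk_brel_def)

lemma Nil_in_listset [simp]: "X \<in> listset [] \<longleftrightarrow> X = []"
  by simp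

lemma map_in_listset:
  "map \<alpha> vs \<in> listset (map f vs) \<longleftrightarrow> (\<forall>v\<in>set vs. \<alpha> v \<in> f v)"
  by (simp add: in_listset list.rel_map list_all2_same)

lemma src_interp [simp]: "src (interp \<phi> \<Gamma>) = map vsort \<Gamma>"
  and tgt_interp [simp]: "tgt (interp \<phi> \<Gamma>) = []"
  by (induction \<phi> arbitrary: \<Gamma>) (simp_all add: Let_def rel_neg_def rel_meet_def rel_sup_def)

section \<open>Components of the interpretation of a formula\<close>

text \<open>
  The Hilbert-Schmidt inner product of two functionals.  It is the trace form that defines negation
  in arity \<open>X\<close>, because the target of a functional is one-dimensional.
\<close>

definition pairing :: "'i atom list \<Rightarrow> 'i oper \<Rightarrow> 'i oper \<Rightarrow> complex" where
  "pairing X f g = (\<Sum>j\<in>idx X. cnj (f [] j) * g [] j)"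

lemma cmpt_interp_Neg:
  assumes "X \<in> listset (map vsort \<Gamma>)"
  shows "cmpt (interp (Neg \<phi>) \<Gamma>) X [] =
    {g \<in> L X []. \<forall>f\<in>cmpt (interp \<phi> \<Gamma>) X []. pairing X f g = 0}"
  using assms
  by (simp add: rel_neg_def op_trace_def op_mult_def op_adj_def pairing_def)

lemma cmpt_interp_Conj:
  assumes "X \<in> listset (map vsort \<Gamma>)"
  shows "cmpt (interp (Conj \<phi> \<psi>) \<Gamma>) X [] = cmpt (interp \<phi> \<Gamma>) X [] \<inter> cmpt (interp \<psi> \<Gamma>) X []"
  using assms by (simp add: rel_meet_def)

lemma src_foldl_top:
  "src (foldl rel_times R (map (\<lambda>Q. rel_top [Q] []) Qs)) = src R @ Qs"
  "tgt (foldl rel_times R (map (\<lambda>Q. rel_top [Q] []) Qs)) = tgt R"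
  by (induction Qs arbitrary: R) (simp_all add: rel_times_def rel_top_def Let_def)

lemma subspace_slices:
  assumes "oper.subspace U"
  shows "oper.subspace {g \<in> L X []. \<forall>z\<in>Z. (\<lambda>u y. g u (y @ z)) \<in> U}"
proof -
  let ?s = "\<lambda>g z u y. g u (y @ z)"
  have 1: "?s (f + g) z = ?s f z + ?s g z" for f g :: "'a oper" and z
    by (simp only: plus_fun_def)
  have 2: "?s (scale_op c f) z = scale_op c (?s f z)" for c and f :: "'a oper" and z
    by (simp only: scale_op_def)
  have 3: "?s (0::'a oper) z = 0" for z
    by (simp only: zero_fun_def)
  show ?thesis
    using assms subspace_L[of X "[]"] unfolding oper.subspace_def mem_Collect_eq
    by (simp only: 1 2 3) blast
qed

text \<open>
  A functional on a tensor product is the sum, over the basis of the second factor, of its slices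
  tensored with the dual basis vectors.  So multiplying a relation by \<open>\<top>\<close> leaves exactly the
  functionals all of whose slices satisfy the relation.
\<close>

lemma cmpt_times_top:
  assumes R: "tgt R = []" "Y \<in> listset (src R)"
    and U: "oper.subspace (cmpt R Y [])" "cmpt R Y [] \<subseteq> L Y []"
    and Z: "Z \<in> Q" "finite (basis Z)"
  shows "cmpt (rel_times R (rel_top [Q] [])) (Y @ [Z]) [] =
    {g \<in> L (Y @ [Z]) []. \<forall>z\<in>idx [Z]. (\<lambda>u y. g u (y @ z)) \<in> cmpt R Y []}"
proof -
  have len: "length (src R) = length Y"
    using R(2) by (simp add: in_listset list_all2_lengthD)
  have XZ: "Y @ [Z] \<in> listset (src R @ [Q])" "[Z] \<in> listset [Q]"
    using R(2) Z by (simp_all add: in_listset list_all2_append list_all2_lengthD)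
  have eq: "cmpt (rel_times R (rel_top [Q] [])) (Y @ [Z]) [] =
    oper.span {op_tensor (length Y) 0 r s |r s. r \<in> cmpt R Y [] \<and> s \<in> L [Z] []}"
    using XZ R len unfolding rel_times_def rel_top_def Let_def by simp
  show ?thesis unfolding eq
  proof (intro equalityI)
    show "oper.span {op_tensor (length Y) 0 r s |r s. r \<in> cmpt R Y [] \<and> s \<in> L [Z] []} \<subseteq>
      {g \<in> L (Y @ [Z]) []. \<forall>z\<in>idx [Z]. (\<lambda>u y. g u (y @ z)) \<in> cmpt R Y []}"
    proof (rule oper.span_minimal[OF _ subspace_slices[OF U(1)]], clarify, intro conjI ballI)
      fix r s :: "'a oper" assume r: "r \<in> cmpt R Y []" and s: "s \<in> L [Z] []"
      have rL: "r \<in> L Y []" using r U by auto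
      show "op_tensor (length Y) 0 r s \<in> L (Y @ [Z]) []"
        using rL s unfolding L_iff op_tensor_def by (auto simp: in_idx_append_iff)
      fix z assume z: "z \<in> idx [Z]"
      have "(\<lambda>u y. op_tensor (length Y) 0 r s u (y @ z)) = scale_op (s [] z) r"
      proof (intro ext)
        fix u y
        show "op_tensor (length Y) 0 r s u (y @ z) = scale_op (s [] z) r u y"
        proof (cases "length y = length Y")
          case True
          have "r u y = 0" "s u z = 0" if "u \<noteq> []"
            using rL s that by (auto simp: L_iff)
          then show ?thesis using True
            by (cases "u = []") (simp_all add: op_tensor_def scale_op_def)
        next
          case False
          have "length z = 1" using z by (simp add: in_idx list_all2_lengthD)
          then have "length (drop (length Y) (y @ z)) \<noteq> length [Z]"
            using False by auto
          then have "drop (length Y) (y @ z) \<notin> idx [Z]"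
            unfolding in_idx by (metis list_all2_lengthD)
          then have "s (drop 0 u) (drop (length Y) (y @ z)) = 0"
            using s unfolding L_iff by metis
          moreover have "r u y = 0"
            using rL False unfolding L_iff in_idx by (metis list_all2_lengthD)
          ultimately show ?thesis by (simp add: op_tensor_def scale_op_def)
        qed
      qed
      then show "(\<lambda>u y. op_tensor (length Y) 0 r s u (y @ z)) \<in> cmpt R Y []"
        using r U(1) by (simp add: oper.subspace_scale)
    qed
    show "{g \<in> L (Y @ [Z]) []. \<forall>z\<in>idx [Z]. (\<lambda>u y. g u (y @ z)) \<in> cmpt R Y []} \<subseteq>
      oper.span {op_tensor (length Y) 0 r s |r s. r \<in> cmpt R Y [] \<and> s \<in> L [Z] []}"
    proof clarify
      fix g assume g: "g \<in> L (Y @ [Z]) []" and sl: "\<forall>z\<in>idx [Z]. (\<lambda>u y. g u (y @ z)) \<in> cmpt R Y []"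
      define e :: "'a list \<Rightarrow> 'a oper" where "e z = (\<lambda>u w. if u = [] \<and> w = z then 1 else 0)" for z
      have fin: "finite (idx [Z])" using Z by (intro finite_idx) auto
      have app: "(\<Sum>z\<in>I. f z) u y = (\<Sum>z\<in>I. f z u y)" for f :: "'a list \<Rightarrow> 'a oper" and I u y
        by (induction I rule: infinite_finite_induct) auto
      have "g = (\<Sum>z\<in>idx [Z]. op_tensor (length Y) 0 (\<lambda>u y. g u (y @ z)) (e z))"
      proof (intro ext)
        fix u k
        have "(\<Sum>z\<in>idx [Z]. op_tensor (length Y) 0 (\<lambda>u y. g u (y @ z)) (e z)) u k =
          (\<Sum>z\<in>idx [Z]. if z = drop (length Y) k then if u = [] then g [] k else 0 else 0)"
          unfolding app by (rule sum.cong) (auto simp: op_tensor_def e_def)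
        also have "\<dots> = (if drop (length Y) k \<in> idx [Z] then if u = [] then g [] k else 0 else 0)"
          using fin by simp
        also have "\<dots> = g u k"
          using g unfolding L_iff in_idx_append_iff by metis
        finally show "g u k = (\<Sum>z\<in>idx [Z]. op_tensor (length Y) 0 (\<lambda>u y. g u (y @ z)) (e z)) u k" ..
      qed
      moreover have "op_tensor (length Y) 0 (\<lambda>u y. g u (y @ z)) (e z) \<in>
          {op_tensor (length Y) 0 r s |r s. r \<in> cmpt R Y [] \<and> s \<in> L [Z] []}" if "z \<in> idx [Z]" for z
        using sl that unfolding mem_Collect_eq L_iff
        by (intro exI conjI[OF refl]) (auto simp: e_def split: if_splits)
      ultimately show "g \<in> oper.span {op_tensor (length Y) 0 r s |r s. r \<in> cmpt R Y [] \<and> s \<in> L [Z] []}"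
        by (metis (no_types, lifting) oper.span_base oper.span_sum)
    qed
  qed
qed

lemma cmpt_times_tops:
  assumes R: "tgt R = []" "Y \<in> listset (src R)"
    and U: "oper.subspace (cmpt R Y [])" "cmpt R Y [] \<subseteq> L Y []"
    and Z: "Z \<in> listset Qs" "\<And>A. A \<in> set Z \<Longrightarrow> finite (basis A)"
  shows "cmpt (foldl rel_times R (map (\<lambda>Q. rel_top [Q] []) Qs)) (Y @ Z) [] =
    {g \<in> L (Y @ Z) []. \<forall>z\<in>idx Z. (\<lambda>u y. g u (y @ z)) \<in> cmpt R Y []}"
  using Z
proof (induction Qs arbitrary: Z rule: rev_induct)
  case Nil
  then show ?case using U by (auto simp: in_idx)
next
  case (snoc Q Qs)
  then obtain Z' A where Z: "Z = Z' @ [A]" "Z' \<in> listset Qs" "A \<in> Q"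
    by (auto simp: in_listset list_all2_append2 list_all2_Cons2)
  let ?R = "foldl rel_times R (map (\<lambda>Q. rel_top [Q] []) Qs)"
  have IH: "cmpt ?R (Y @ Z') [] =
    {g \<in> L (Y @ Z') []. \<forall>z\<in>idx Z'. (\<lambda>u y. g u (y @ z)) \<in> cmpt R Y []}"
    using snoc Z by auto
  have "cmpt (rel_times ?R (rel_top [Q] [])) ((Y @ Z') @ [A]) [] =
    {g \<in> L ((Y @ Z') @ [A]) []. \<forall>z\<in>idx [A]. (\<lambda>u y. g u (y @ z)) \<in> cmpt ?R (Y @ Z') []}"
  proof (rule cmpt_times_top)
    show "Y @ Z' \<in> listset (src ?R)"
      using R Z by (auto simp: src_foldl_top in_listset list_all2_append list_all2_lengthD)
    show "oper.subspace (cmpt ?R (Y @ Z') [])"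
      unfolding IH by (rule subspace_slices[OF U(1)])
  qed (use R Z snoc IH in \<open>auto simp: src_foldl_top\<close>)
  also have "\<dots> = {g \<in> L (Y @ Z) []. \<forall>z\<in>idx Z. (\<lambda>u y. g u (y @ z)) \<in> cmpt R Y []}"
  proof (intro Collect_cong conj_cong refl)
    show "g \<in> L ((Y @ Z') @ [A]) [] \<longleftrightarrow> g \<in> L (Y @ Z) []" for g by (simp add: Z)
  next
    fix g assume g: "g \<in> L (Y @ Z) []"
    have 1: "(\<lambda>u y. g u (y @ z)) \<in> L (Y @ Z') []" if "z \<in> idx [A]" for z
    proof -
      have "length z = 1" using that by (simp add: in_idx list_all2_lengthD)
      have "y \<in> idx (Y @ Z')" if "y @ z \<in> idx ((Y @ Z') @ [A])" for y
      proof -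
        have "length (y @ z) = length ((Y @ Z') @ [A])"
          using that by (simp only: in_idx list_all2_lengthD)
        then show ?thesis using that \<open>length z = 1\<close> by (subst (asm) in_idx_append) auto
      qed
      then show ?thesis using g Z by (auto simp: L_iff)
    qed
    show "(\<forall>z\<in>idx [A]. (\<lambda>u y. g u (y @ z)) \<in> cmpt ?R (Y @ Z') []) \<longleftrightarrow>
      (\<forall>z\<in>idx Z. (\<lambda>u y. g u (y @ z)) \<in> cmpt R Y [])" (is "?l \<longleftrightarrow> ?r")
    proof
      assume ?l
      show ?r
      proof
        fix z assume "z \<in> idx Z"
        then obtain z' w where "z = z' @ w" "z' \<in> idx Z'" "w \<in> idx [A]"
          unfolding Z by (rule in_idx_appendE)
        then show "(\<lambda>u y. g u (y @ z)) \<in> cmpt R Y []"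
          using \<open>?l\<close> unfolding IH by auto
      qed
    next
      assume ?r
      show ?l
      proof
        fix w assume w: "w \<in> idx [A]"
        have "(\<lambda>u y. g u ((y @ z') @ w)) \<in> cmpt R Y []" if "z' \<in> idx Z'" for z'
        proof -
          have "z' @ w \<in> idx Z" using that w Z by (simp add: in_idx list_all2_append list_all2_appendI)
          then show ?thesis using \<open>?r\<close> by auto
        qed
        then show "(\<lambda>u y. g u (y @ w)) \<in> cmpt ?R (Y @ Z') []"
          unfolding IH using 1[OF w] by auto
      qed
    qed
  qed
  finally show ?case using Z by simp
qed

text \<open>
  The assignment \<open>\<eta>\<close> with the entries of \<open>y\<close> as new values of the variables
  \<open>vs\<close>.  Basis vectors of a tensor product over a context are handled as assignments of labels to
  variables, so that permutations of the factors disappear from the description.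
\<close>

definition override :: "('v \<Rightarrow> 'l) \<Rightarrow> 'v list \<Rightarrow> 'l list \<Rightarrow> 'v \<Rightarrow> 'l" where
  "override \<eta> vs y v = (case map_of (zip vs y) v of Some l \<Rightarrow> l | None \<Rightarrow> \<eta> v)"

lemma override_Nil [simp]: "override \<eta> [] y v = \<eta> v"
  and override_Cons [simp]: "override \<eta> (w # vs) (l # y) v = (if v = w then l else override \<eta> vs y v)"
  by (simp_all add: override_def)

lemma override_notin: "v \<notin> set vs \<Longrightarrow> override \<eta> vs y v = \<eta> v"
  by (auto simp: override_def split: option.split dest: map_of_SomeD set_zip_leftD)

lemma map_override:
  "distinct vs \<Longrightarrow> length y = length vs \<Longrightarrow> map (override \<eta> vs y) vs = y"
proof (induction vs y rule: list_induct2')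
  case (4 w vs l y)
  then have "map (override \<eta> (w # vs) (l # y)) vs = map (override \<eta> vs y) vs"
    by (intro map_cong) auto
  also have "\<dots> = y" using 4 by simp
  finally have "map (override \<eta> (w # vs) (l # y)) vs = y" .
  moreover have "override \<eta> (w # vs) (l # y) w = l" by simp
  ultimately show ?case by (simp del: override_Cons)
qed simp_all

lemma override_map: "override \<eta> vs (map \<kappa> vs) v = (if v \<in> set vs then \<kappa> v else \<eta> v)"
  by (induction vs) auto

lemma override_append:
  "length y = length vs \<Longrightarrow> override \<eta> (vs @ ws) (y @ z) v = override (override \<eta> ws z) vs y v"
  by (induction vs y rule: list_induct2') auto

lemma override_valid:
  assumes "y \<in> idx (map \<alpha> vs)" "v \<notin> set vs \<Longrightarrow> \<eta> v \<in> basis (\<alpha> v)"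
  shows "override \<eta> vs y v \<in> basis (\<alpha> v)"
proof -
  have "list_all2 (\<lambda>l w. l \<in> basis (\<alpha> w)) y vs"
    using assms(1) by (simp add: in_idx list.rel_map)
  then show ?thesis using assms(2)
    by (induction y vs rule: list_all2_induct) auto
qed

lemma position_less: "v \<in> set \<Gamma> \<Longrightarrow> position \<Gamma> v < length \<Gamma>"
  and nth_position: "v \<in> set \<Gamma> \<Longrightarrow> \<Gamma> ! position \<Gamma> v = v"
  unfolding position_def by (metis (mono_tags, lifting) LeastI in_set_conv_nth)+

lemma position_nth: "distinct \<Gamma> \<Longrightarrow> k < length \<Gamma> \<Longrightarrow> position \<Gamma> (\<Gamma> ! k) = k"
  by (metis nth_eq_iff_index_eq nth_mem nth_position position_less)

lemma brelsD:
  assumes "R \<in> brels Xs Ys"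
  shows "src R = Xs" "tgt R = Ys"
    and "X \<in> listset Xs \<Longrightarrow> Y \<in> listset Ys \<Longrightarrow> oper.subspace (cmpt R X Y)"
    and "X \<in> listset Xs \<Longrightarrow> Y \<in> listset Ys \<Longrightarrow> cmpt R X Y \<subseteq> L X Y"
    and "\<not> (X \<in> listset Xs \<and> Y \<in> listset Ys) \<Longrightarrow> cmpt R X Y = {0}"
  using assms unfolding brels_def mem_Collect_eq by (metis (no_types, lifting))+

lemma subspace_cmpt_brel: "R \<in> brels Xs Ys \<Longrightarrow> oper.subspace (cmpt R X Y)"
  using brelsD(3,5) oper.subspace_single_0 by metis

lemma cmpt_brel_subset_L: "R \<in> brels Xs Ys \<Longrightarrow> cmpt R X Y \<subseteq> L X Y"
  using brelsD(4,5)[of R Xs Ys X Y] oper.subspace_0[OF subspace_L[of X Y]]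
  by (cases "X \<in> listset Xs \<and> Y \<in> listset Ys") simp_all

text \<open>
  A functional satisfies an atomic formula if it does so as a functional of the variables \<open>vs\<close>,
  whatever basis vectors the remaining variables are fixed at.  The permutation of the factors and the
  factors \<open>\<top>\<close> of the definition are absorbed into assignments.
\<close>

lemma cmpt_interp_Rel:
  fixes R :: "'i brel"
  assumes \<Gamma>: "distinct \<Gamma>" "\<And>v. v \<in> set \<Gamma> \<Longrightarrow> \<alpha> v \<in> vsort v \<and> finite (basis (\<alpha> v))"
    and vs: "distinct vs" "set vs \<subseteq> set \<Gamma>"
    and R: "R \<in> brels (map vsort vs) []"
  shows "cmpt (interp (Rel R vs) \<Gamma>) (map \<alpha> \<Gamma>) [] =
    {g \<in> L (map \<alpha> \<Gamma>) []. \<forall>\<eta>. (\<forall>v\<in>set \<Gamma>. \<eta> v \<in> basis (\<alpha> v)) \<longrightarrow>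
      (\<lambda>u y. if y \<in> idx (map \<alpha> vs) then g u (map (override \<eta> vs y) \<Gamma>) else 0) \<in> cmpt R (map \<alpha> vs) []}"
    (is "_ = ?rhs")
proof -
  (* The variables ws are those of the context that do not occur in vs, in the order of the context. *)
  define js where "js = map (position \<Gamma>) vs"
  define ks where "ks = filter (\<lambda>i. i \<notin> set js) [0..<length \<Gamma>]"
  define ws where "ws = map ((!) \<Gamma>) ks"
  have ks: "set ks \<subseteq> {..<length \<Gamma>}" by (auto simp: ks_def)
  have js: "set js \<subseteq> {..<length \<Gamma>}" using vs position_less by (auto simp: js_def)
  have js_vs: "map ((!) \<Gamma>) js = vs"
    using vs by (auto simp: js_def intro!: map_idI nth_position)
  have ws_set: "set ws = set \<Gamma> - set vs"
  proof (intro equalityI subsetI)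
    fix v assume "v \<in> set ws"
    then obtain k where k: "v = \<Gamma> ! k" "k < length \<Gamma>" "k \<notin> set js" by (auto simp: ws_def ks_def)
    then have "v \<notin> set vs" using position_nth[OF \<Gamma>(1) k(2)] by (auto simp: js_def image_iff)
    then show "v \<in> set \<Gamma> - set vs" using k by simp
  next
    fix v assume v: "v \<in> set \<Gamma> - set vs"
    have "position \<Gamma> v \<notin> set js"
    proof
      assume "position \<Gamma> v \<in> set js"
      then obtain w where "w \<in> set vs" "position \<Gamma> v = position \<Gamma> w" by (auto simp: js_def)
      then have "v = w"
        using nth_position[of v \<Gamma>] nth_position[of w \<Gamma>] v vs(2) by auto
      then show False using \<open>w \<in> set vs\<close> v by simp
    qed
    then have "position \<Gamma> v \<in> set ks" using v position_less by (auto simp: ks_def)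
    then show "v \<in> set ws" using nth_position[of v \<Gamma>] v by (auto simp: ws_def intro!: image_eqI)
  qed
  have perm: "map ((!) (map \<kappa> \<Gamma>)) (js @ ks) = map \<kappa> (vs @ ws)" for \<kappa> :: "'i var \<Rightarrow> 'b"
  proof -
    have "map ((!) (map \<kappa> \<Gamma>)) (js @ ks) = map (\<lambda>k. \<kappa> (\<Gamma> ! k)) (js @ ks)"
      using js ks by (intro map_cong) auto
    then show ?thesis using js_vs by (simp add: ws_def flip: js_vs)
  qed
  let ?X = "map \<alpha> \<Gamma>" and ?Y = "map \<alpha> vs" and ?Z = "map \<alpha> ws"
  let ?T = "foldl rel_times R (map (\<lambda>Q. rel_top [Q] []) (map vsort ws))"
  have X: "?X \<in> listset (map vsort \<Gamma>)" using \<Gamma> by (simp add: map_in_listset)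
  have Y: "?Y \<in> listset (map vsort vs)" using \<Gamma> vs by (auto simp: map_in_listset)
  have Z: "?Z \<in> listset (map vsort ws)" using \<Gamma> ws_set by (auto simp: map_in_listset)
  have U: "oper.subspace (cmpt R ?Y [])" "cmpt R ?Y [] \<subseteq> L ?Y []"
    using subspace_cmpt_brel[OF R] cmpt_brel_subset_L[OF R] by blast+
  have T: "cmpt ?T (?Y @ ?Z) [] =
      {r \<in> L (?Y @ ?Z) []. \<forall>z\<in>idx ?Z. (\<lambda>u y. r u (y @ z)) \<in> cmpt R ?Y []}"
    by (rule cmpt_times_tops) (use R Y Z U \<Gamma> ws_set in \<open>auto simp: brels_def\<close>)
  have fin: "finite (idx (?Y @ ?Z))"
    by (rule finite_idx) (use \<Gamma> vs ws_set in auto)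
  have eq: "cmpt (interp (Rel R vs) \<Gamma>) ?X [] =
      (\<lambda>r. op_mult (?Y @ ?Z) r (op_permute (js @ ks) ?X)) ` cmpt ?T (?Y @ ?Z) []"
  proof -
    have XY: "map ((!) ?X) (js @ ks) = ?Y @ ?Z"
      using perm[of \<alpha>] by (simp only: map_append)
    have Qs: "map (\<lambda>k. rel_top [vsort (\<Gamma> ! k)] []) ks = map (\<lambda>Q. rel_top [Q] []) (map vsort ws)"
      by (simp add: ws_def)
    show ?thesis
      unfolding interp.simps Let_def js_def[symmetric] ks_def[symmetric]
      by (subst cmpt_mk_brel[OF X]) (simp_all only: XY Qs Nil_in_listset)
  qed
  have valid: "map \<kappa> (vs @ ws) \<in> idx (?Y @ ?Z)" if "map \<kappa> \<Gamma> \<in> idx ?X" for \<kappa>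
  proof -
    have "map \<kappa> (vs @ ws) \<in> idx (map \<alpha> (vs @ ws))"
      using that vs ws_set unfolding map_in_idx by auto
    then show ?thesis by simp
  qed
  have mult: "op_mult (?Y @ ?Z) r (op_permute (js @ ks) ?X) u k =
      (if k \<in> idx ?X then r u (map ((!) k) (js @ ks)) else 0)"
    for r u k
  proof (cases "k \<in> idx ?X")
    case True
    define \<kappa> where "\<kappa> = override (\<lambda>_. undefined) \<Gamma> k"
    have k: "k = map \<kappa> \<Gamma>"
      unfolding \<kappa>_def using map_override \<Gamma>(1) in_idx_map[OF True] by metis
    have "map ((!) k) (js @ ks) \<in> idx (?Y @ ?Z)"
      using valid[of \<kappa>] True unfolding k perm by simp
    then show ?thesis using True fin
      by (simp add: op_mult_def op_permute_def if_distrib[of "(*) _"] cong: if_cong)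
  qed (simp add: op_mult_def op_permute_def)
  show ?thesis unfolding eq
  proof (intro equalityI subsetI)
    fix g assume "g \<in> (\<lambda>r. op_mult (?Y @ ?Z) r (op_permute (js @ ks) ?X)) ` cmpt ?T (?Y @ ?Z) []"
    then obtain r where r: "r \<in> L (?Y @ ?Z) []" "\<And>z. z \<in> idx ?Z \<Longrightarrow> (\<lambda>u y. r u (y @ z)) \<in> cmpt R ?Y []"
      and g: "g = op_mult (?Y @ ?Z) r (op_permute (js @ ks) ?X)" unfolding T by blast
    have gr: "g u (map \<kappa> \<Gamma>) = r u (map \<kappa> (vs @ ws))" if "map \<kappa> \<Gamma> \<in> idx ?X" for \<kappa> u
      unfolding g mult using that perm[of \<kappa>] by simp
    have gL: "g \<in> L ?X []"
      using r(1) unfolding L_iff g mult by auto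
    have "(\<lambda>u y. if y \<in> idx ?Y then g u (map (override \<eta> vs y) \<Gamma>) else 0) \<in> cmpt R ?Y []"
      if \<eta>: "\<forall>v\<in>set \<Gamma>. \<eta> v \<in> basis (\<alpha> v)" for \<eta>
    proof -
      have z: "map \<eta> ws \<in> idx ?Z" using \<eta> ws_set by (simp add: map_in_idx)
      have "(\<lambda>u y. if y \<in> idx ?Y then g u (map (override \<eta> vs y) \<Gamma>) else 0) = (\<lambda>u y. r u (y @ map \<eta> ws))"
      proof (intro ext)
        fix u y
        show "(if y \<in> idx ?Y then g u (map (override \<eta> vs y) \<Gamma>) else 0) = r u (y @ map \<eta> ws)"
        proof (cases "y \<in> idx ?Y")
          case True
          then have "map (override \<eta> vs y) \<Gamma> \<in> idx ?X"
            unfolding map_in_idx using \<eta> by (auto intro: override_valid)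
          moreover have "map (override \<eta> vs y) vs = y"
            using map_override vs(1) in_idx_map[OF True] by metis
          moreover have "map (override \<eta> vs y) ws = map \<eta> ws"
            using ws_set by (auto intro: override_notin)
          ultimately show ?thesis using True by (simp only: gr map_append if_True)
        next
          case False
          then have "y @ map \<eta> ws \<notin> idx (?Y @ ?Z)"
          proof -
            have "length (y @ map \<eta> ws) = length (?Y @ ?Z) \<Longrightarrow> length y = length ?Y" by simp
            then show ?thesis using False in_idx_append[of y ?Y]
              by (metis in_idx list_all2_lengthD)
          qed
          then show ?thesis using False r(1) unfolding L_iff by auto
        qed
      qed
      then show ?thesis using r(2)[OF z] by simp
    qed
    then show "g \<in> ?rhs" using gL by blast
  next
    fix g assume g: "g \<in> ?rhs"
    define env where "env = override (\<lambda>_. undefined :: 'i) (vs @ ws)"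
    define r :: "'i oper" where "r = (\<lambda>u j. if j \<in> idx (?Y @ ?Z) then g u (map (env j) \<Gamma>) else 0)"
    have "r \<in> L (?Y @ ?Z) []" using g unfolding r_def L_iff by auto
    moreover have "(\<lambda>u y. r u (y @ z)) \<in> cmpt R ?Y []" if z: "z \<in> idx ?Z" for z
    proof -
      have "(\<lambda>u y. r u (y @ z)) = (\<lambda>u y. if y \<in> idx ?Y then g u (map (env (y @ z)) \<Gamma>) else 0)"
      proof (intro ext)
        fix u y
        have "y @ z \<in> idx (?Y @ ?Z) \<longleftrightarrow> y \<in> idx ?Y"
        proof (cases "length y = length ?Y")
          case True
          then show ?thesis using z by (simp add: in_idx_append)
        next
          case False
          have "length z = length ?Z" using z by (simp add: in_idx list_all2_lengthD)
          then show ?thesis using False by (metis add_right_cancel in_idx length_append list_all2_lengthD)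
        qed
        then show "r u (y @ z) = (if y \<in> idx ?Y then g u (map (env (y @ z)) \<Gamma>) else 0)"
          by (simp add: r_def)
      qed
      also have "\<dots> \<in> cmpt R ?Y []"
      proof (cases "idx ?Y = {}")
        case True
        then have "(\<lambda>u y. if y \<in> idx ?Y then g u (map (env (y @ z)) \<Gamma>) else 0) = 0"
          by (simp add: zero_fun_def)
        then show ?thesis using U(1) by (simp only: oper.subspace_0)
      next
        case False
        then obtain y0 where y0: "y0 \<in> idx ?Y" by blast
        (* Any assignment that agrees with z on ws will do, since vs is overridden anyway. *)
        define \<eta> where "\<eta> = env (y0 @ z)"
        have "\<forall>v\<in>set \<Gamma>. \<eta> v \<in> basis (\<alpha> v)"
        proof
          fix v assume "v \<in> set \<Gamma>"
          then have "v \<in> set (vs @ ws)" using ws_set by auto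
          moreover have "y0 @ z \<in> idx (map \<alpha> (vs @ ws))"
            using y0 z in_idx_map[OF y0] by (simp add: in_idx_append)
          ultimately show "\<eta> v \<in> basis (\<alpha> v)"
            unfolding \<eta>_def env_def by (intro override_valid) auto
        qed
        then have "(\<lambda>u y. if y \<in> idx ?Y then g u (map (override \<eta> vs y) \<Gamma>) else 0) \<in> cmpt R ?Y []"
          using g by blast
        moreover have "map (override \<eta> vs y) \<Gamma> = map (env (y @ z)) \<Gamma>" if y: "y \<in> idx ?Y" for y
        proof (intro map_cong refl)
          fix v assume "v \<in> set \<Gamma>"
          have l: "length y = length vs" "length y0 = length vs" using y y0 in_idx_map by blast+
          have ov: "override \<eta>1 vs y v = override \<eta>2 vs y v" if "v \<notin> set vs \<longrightarrow> \<eta>1 v = \<eta>2 v" for \<eta>1 \<eta>2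
          proof (cases "v \<in> set vs")
            case True
            then have "map (override \<eta>1 vs y) vs = map (override \<eta>2 vs y) vs"
              using map_override[OF vs(1) l(1)] by metis
            then show ?thesis using True by simp
          qed (use that in \<open>simp add: override_notin\<close>)
          show "override \<eta> vs y v = env (y @ z) v"
            unfolding env_def override_append[OF l(1)] \<eta>_def
            by (rule ov) (simp add: override_append[OF l(2)] override_notin)
        qed
        ultimately show ?thesis by (simp cong: if_cong)
      qed
      finally show ?thesis .
    qed
    ultimately have rT: "r \<in> cmpt ?T (?Y @ ?Z) []" unfolding T by blast
    have "g = op_mult (?Y @ ?Z) r (op_permute (js @ ks) ?X)"
    proof (intro ext)
      fix u k
      show "g u k = op_mult (?Y @ ?Z) r (op_permute (js @ ks) ?X) u k"
      proof (cases "k \<in> idx ?X")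
        case True
        define \<kappa> where "\<kappa> = override (\<lambda>_. undefined) \<Gamma> k"
        have k: "k = map \<kappa> \<Gamma>"
          unfolding \<kappa>_def using map_override \<Gamma>(1) in_idx_map[OF True] by metis
        have "map (env (map \<kappa> (vs @ ws))) \<Gamma> = map \<kappa> \<Gamma>"
          unfolding env_def override_map using ws_set by (intro map_cong) auto
        then have "r u (map \<kappa> (vs @ ws)) = g u (map \<kappa> \<Gamma>)"
          using valid[of \<kappa>] True unfolding r_def k by (simp only: if_True)
        then show ?thesis
          unfolding mult using True unfolding k perm by (simp only: if_True)
      qed (use g in \<open>auto simp: mult L_iff\<close>)
    qed
    then show "g \<in> (\<lambda>r. op_mult (?Y @ ?Z) r (op_permute (js @ ks) ?X)) ` cmpt ?T (?Y @ ?Z) []"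
      using rT by blast
  qed
qed

lemma subspace_pairing:
  "oper.subspace {g \<in> L X []. \<forall>f\<in>U. pairing X f g = 0}"
proof -
  have "pairing X f 0 = 0" "pairing X f (g + h) = pairing X f g + pairing X f h"
    "pairing X f (scale_op c g) = c * pairing X f g" for f g h c
    by (simp_all add: pairing_def scale_op_def plus_fun_def sum.distrib algebra_simps sum_distrib_left zero_fun_def)
  then show ?thesis
    using subspace_L[of X "[]"] by (simp add: oper.subspace_def)
qed

lemma cmpt_top_times:
  assumes "R \<in> brels Xs []" "Y \<in> Q" "X \<in> listset Xs"
  shows "cmpt (rel_times (rel_top [Q] []) R) (Y # X) [] =
    oper.span {op_tensor 1 0 t r |t r. t \<in> L [Y] [] \<and> r \<in> cmpt R X []}"
proof -
  have "Y # X \<in> listset (Q # Xs)" "[Y] \<in> listset [Q]"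
    using assms unfolding in_listset by simp_all
  then show ?thesis
    using assms unfolding rel_times_def rel_top_def brels_def Let_def by simp
qed

text \<open>
  The functionals whose tensor products with all functionals on the atoms of \<open>v\<close> satisfy
  \<open>\<phi>\<close> already form a relation \<open>R0\<close>, which is therefore the largest one in the supremum.
  That the interpretation of \<open>\<phi>\<close> consists of subspaces makes \<open>R0\<close> a relation.
\<close>

lemma cmpt_interp_Forall:
  fixes \<phi> :: "'i fm"
  assumes sub: "\<And>X. oper.subspace (cmpt (interp \<phi> (v # \<Gamma>)) X [])"
    and X: "X \<in> listset (map vsort \<Gamma>)"
  shows "cmpt (interp (Forall v \<phi>) \<Gamma>) X [] =
    {r \<in> L X []. \<forall>Y\<in>vsort v. \<forall>t\<in>L [Y] []. op_tensor 1 0 t r \<in> cmpt (interp \<phi> (v # \<Gamma>)) (Y # X) []}"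
proof -
  let ?Xs = "map vsort \<Gamma>"
  define W where "W X = {r \<in> L X []. \<forall>Y\<in>vsort v. \<forall>t\<in>L [Y] [].
      op_tensor 1 0 t r \<in> cmpt (interp \<phi> (v # \<Gamma>)) (Y # X) []}" for X
  define \<R> where "\<R> = {R \<in> brels ?Xs []. rel_le (rel_times (rel_top [vsort v] []) R) (interp \<phi> (v # \<Gamma>))}"
  have subW: "oper.subspace (W X)" for X
  proof -
    let ?s = "\<lambda>t r. op_tensor 1 0 t r"
    have 1: "?s t (f + g) = ?s t f + ?s t g" for t f g :: "'i oper"
      by (simp add: op_tensor_def plus_fun_def algebra_simps)
    have 2: "?s t (scale_op c f) = scale_op c (?s t f)" for c and t f :: "'i oper"
      by (simp add: op_tensor_def scale_op_def algebra_simps)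
    have 3: "?s t (0::'i oper) = 0" for t
      by (simp add: op_tensor_def zero_fun_def)
    show ?thesis
      using sub subspace_L[of X "[]"] unfolding W_def oper.subspace_def mem_Collect_eq
      by (simp only: 1 2 3) blast
  qed
  have eq: "cmpt (interp (Forall v \<phi>) \<Gamma>) X [] = oper.span (\<Union>R\<in>\<R>. cmpt R X [])"
    using X by (simp add: rel_sup_def \<R>_def)
  have "oper.span (\<Union>R\<in>\<R>. cmpt R X []) = W X"
  proof (intro equalityI)
    have "cmpt R X [] \<subseteq> W X" if R: "R \<in> \<R>" for R
    proof
      fix r assume r: "r \<in> cmpt R X []"
      have "R \<in> brels ?Xs []" using R by (simp add: \<R>_def)
      then have "op_tensor 1 0 t r \<in> cmpt (rel_times (rel_top [vsort v] []) R) (Y # X) []"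
        if "Y \<in> vsort v" "t \<in> L [Y] []" for Y t
        using that r X by (subst cmpt_top_times) (auto intro!: oper.span_base)
      moreover have "cmpt (rel_times (rel_top [vsort v] []) R) Z [] \<subseteq> cmpt (interp \<phi> (v # \<Gamma>)) Z []" for Z
        using R by (simp add: \<R>_def rel_le_def)
      moreover have "r \<in> L X []"
        using r cmpt_brel_subset_L[of R ?Xs "[]"] R by (auto simp: \<R>_def)
      ultimately show "r \<in> W X" unfolding W_def by blast
    qed
    then show "oper.span (\<Union>R\<in>\<R>. cmpt R X []) \<subseteq> W X"
      by (intro oper.span_minimal subW) auto
    define R0 where "R0 = mk_brel ?Xs [] (\<lambda>X _. W X)"
    have R0: "R0 \<in> brels ?Xs []"
      using subW by (auto simp: R0_def brels_def cmpt_mk_brel_outside W_def)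
    have "rel_le (rel_times (rel_top [vsort v] []) R0) (interp \<phi> (v # \<Gamma>))"
      unfolding rel_le_def
    proof (intro conjI allI)
      show "src (rel_times (rel_top [vsort v] []) R0) = src (interp \<phi> (v # \<Gamma>))"
        "tgt (rel_times (rel_top [vsort v] []) R0) = tgt (interp \<phi> (v # \<Gamma>))"
        by (simp_all add: rel_times_def rel_top_def Let_def R0_def)
      fix Z Z'
      show "cmpt (rel_times (rel_top [vsort v] []) R0) Z Z' \<subseteq> cmpt (interp \<phi> (v # \<Gamma>)) Z Z'"
      proof (cases "Z \<in> listset (vsort v # ?Xs) \<and> Z' = []")
        case True
        then obtain Y X where Z: "Z = Y # X" "Y \<in> vsort v" "X \<in> listset ?Xs"
          unfolding in_listset by (auto simp: list_all2_Cons2)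
        have "cmpt (rel_times (rel_top [vsort v] []) R0) Z Z' =
            oper.span {op_tensor 1 0 t r |t r. t \<in> L [Y] [] \<and> r \<in> W X}"
          using True Z cmpt_top_times[OF R0 Z(2,3)] by (simp add: R0_def)
        also have "\<dots> \<subseteq> cmpt (interp \<phi> (v # \<Gamma>)) Z Z'"
          using True Z by (intro oper.span_minimal) (auto simp: W_def sub)
        finally show ?thesis .
      next
        case False
        have "rel_times (rel_top [vsort v] []) R0 = mk_brel (vsort v # ?Xs) []
            (cmpt (rel_times (rel_top [vsort v] []) R0))"
          by (simp add: rel_times_def rel_top_def Let_def R0_def mk_brel_def fun_eq_iff)
        then have "cmpt (rel_times (rel_top [vsort v] []) R0) Z Z' = {0}"
          using False cmpt_mk_brel_outside[of Z "vsort v # ?Xs" Z' "[]"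
              "cmpt (rel_times (rel_top [vsort v] []) R0)"] by (simp only: Nil_in_listset) simp
        moreover have "0 \<in> cmpt (interp \<phi> (v # \<Gamma>)) Z Z'"
        proof (cases "Z' = []")
          case True
          then show ?thesis using sub by (simp add: oper.subspace_0)
        next
          case False
          then show ?thesis
            by (cases \<phi>) (simp_all add: Let_def rel_neg_def rel_meet_def rel_sup_def mk_brel_def)
        qed
        ultimately show ?thesis by simp
      qed
    qed
    then have "R0 \<in> \<R>" using R0 by (simp add: \<R>_def)
    then have "cmpt R0 X [] \<subseteq> (\<Union>R\<in>\<R>. cmpt R X [])" by (rule UN_upper)
    also have "\<dots> \<subseteq> oper.span (\<Union>R\<in>\<R>. cmpt R X [])" by (rule oper.span_superset)
    finally show "W X \<subseteq> oper.span (\<Union>R\<in>\<R>. cmpt R X [])"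
      using X by (simp add: R0_def)
  qed
  then show ?thesis using eq by (simp add: W_def)
qed

section \<open>Fixing the values of the classical variables\<close>

text \<open>
  The interpretation is a total function on formulas.  These conditions exclude mismatched arities,
  repeated arguments, rebound variables and infinite-dimensional atoms, for which its value is
  arbitrary.
\<close>

primrec wf_fm :: "'i fm \<Rightarrow> 'i var list \<Rightarrow> bool" where
  "wf_fm (Rel R vs) \<Gamma> \<longleftrightarrow> R \<in> brels (map vsort vs) [] \<and> distinct vs \<and> set vs \<subseteq> set \<Gamma>"
| "wf_fm (Neg \<phi>) \<Gamma> \<longleftrightarrow> wf_fm \<phi> \<Gamma>"
| "wf_fm (Conj \<phi> \<psi>) \<Gamma> \<longleftrightarrow> wf_fm \<phi> \<Gamma> \<and> wf_fm \<psi> \<Gamma>"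
| "wf_fm (Forall v \<phi>) \<Gamma> \<longleftrightarrow> v \<notin> set \<Gamma> \<and> (\<forall>A\<in>vsort v. finite (basis A)) \<and> wf_fm \<phi> (v # \<Gamma>)"

definition ok_ctx :: "'i var list \<Rightarrow> bool" where
  "ok_ctx \<Gamma> \<longleftrightarrow> distinct \<Gamma> \<and> (\<forall>v\<in>set \<Gamma>. \<forall>A\<in>vsort v. finite (basis A))"

lemma listset_mapE:
  assumes "distinct \<Gamma>" "X \<in> listset (map f \<Gamma>)"
  obtains \<alpha> where "X = map \<alpha> \<Gamma>" "\<And>v. v \<in> set \<Gamma> \<Longrightarrow> \<alpha> v \<in> f v"
proof -
  have "length X = length \<Gamma>" using assms(2) by (simp add: in_listset list_all2_lengthD)
  then have X: "X = map (override (\<lambda>_. undefined) \<Gamma> X) \<Gamma>"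
    using map_override[OF assms(1)] by metis
  with assms(2) show thesis using that map_in_listset by metis
qed

lemma subspace_reindex:
  fixes k :: "'n \<Rightarrow> 'i list \<Rightarrow> 'i list"
  assumes "oper.subspace U"
  shows "oper.subspace {g \<in> L X []. \<forall>\<eta>. P \<eta> \<longrightarrow> (\<lambda>u y. if y \<in> Y then g u (k \<eta> y) else 0) \<in> U}"
proof -
  let ?s = "\<lambda>\<eta> g u y. if y \<in> Y then g u (k \<eta> y) else 0"
  have 1: "?s \<eta> (f + g) = ?s \<eta> f + ?s \<eta> g" for f g :: "'i oper" and \<eta>
    by (simp add: plus_fun_def fun_eq_iff)
  have 2: "?s \<eta> (scale_op c f) = scale_op c (?s \<eta> f)" for c and f :: "'i oper" and \<eta>
    by (simp add: scale_op_def fun_eq_iff)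
  have 3: "?s \<eta> (0::'i oper) = 0" for \<eta>
    by (simp add: zero_fun_def fun_eq_iff)
  show ?thesis
    using assms subspace_L[of X "[]"] unfolding oper.subspace_def mem_Collect_eq
    by (simp only: 1 2 3) blast
qed

lemma interp_outside:
  "\<not> (X \<in> listset (map vsort \<Gamma>) \<and> Y = []) \<Longrightarrow> cmpt (interp \<phi> \<Gamma>) X Y = {0}"
  by (cases \<phi>) (auto simp: Let_def rel_neg_def rel_meet_def rel_sup_def mk_brel_def)

lemma interp_in_brelsI:
  assumes "\<And>X. X \<in> listset (map vsort \<Gamma>) \<Longrightarrow>
    oper.subspace (cmpt (interp \<phi> \<Gamma>) X []) \<and> cmpt (interp \<phi> \<Gamma>) X [] \<subseteq> L X []"
  shows "interp \<phi> \<Gamma> \<in> brels (map vsort \<Gamma>) []"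
proof -
  have "if X \<in> listset (map vsort \<Gamma>) \<and> Y \<in> listset []
      then oper.subspace (cmpt (interp \<phi> \<Gamma>) X Y) \<and> cmpt (interp \<phi> \<Gamma>) X Y \<subseteq> L X Y
      else cmpt (interp \<phi> \<Gamma>) X Y = {0}" for X Y
  proof (cases "X \<in> listset (map vsort \<Gamma>) \<and> Y = []")
    case True
    then show ?thesis using assms[of X] by simp
  next
    case False
    then have no: "\<not> (X \<in> listset (map vsort \<Gamma>) \<and> Y \<in> listset [])" by simp
    show ?thesis unfolding if_not_P[OF no] by (rule interp_outside[OF False])
  qed
  then show ?thesis by (simp add: brels_def)
qed

lemma interp_in_brels:
  assumes "ok_ctx \<Gamma>" "wf_fm \<phi> \<Gamma>"
  shows "interp \<phi> \<Gamma> \<in> brels (map vsort \<Gamma>) []"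
  using assms
proof (induction \<phi> arbitrary: \<Gamma>)
  case (Rel R vs)
  have "oper.subspace (cmpt (interp (Rel R vs) \<Gamma>) X []) \<and> cmpt (interp (Rel R vs) \<Gamma>) X [] \<subseteq> L X []"
    if X: "X \<in> listset (map vsort \<Gamma>)" for X
  proof -
    obtain \<alpha> where \<alpha>: "X = map \<alpha> \<Gamma>" "\<And>v. v \<in> set \<Gamma> \<Longrightarrow> \<alpha> v \<in> vsort v"
      using listset_mapE Rel(1) X unfolding ok_ctx_def by metis
    have eq: "cmpt (interp (Rel R vs) \<Gamma>) X [] =
      {g \<in> L X []. \<forall>\<eta>. (\<forall>v\<in>set \<Gamma>. \<eta> v \<in> basis (\<alpha> v)) \<longrightarrow>
        (\<lambda>u y. if y \<in> idx (map \<alpha> vs) then g u (map (override \<eta> vs y) \<Gamma>) else 0) \<in> cmpt R (map \<alpha> vs) []}"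
      unfolding \<alpha>(1) by (rule cmpt_interp_Rel) (use Rel \<alpha> in \<open>auto simp: ok_ctx_def\<close>)
    have "oper.subspace (cmpt R (map \<alpha> vs) [])" using Rel subspace_cmpt_brel by auto
    then show ?thesis unfolding eq by (intro conjI subspace_reindex) auto
  qed
  then show ?case by (rule interp_in_brelsI)
next
  case (Neg \<phi>)
  have "oper.subspace (cmpt (interp (Neg \<phi>) \<Gamma>) X []) \<and> cmpt (interp (Neg \<phi>) \<Gamma>) X [] \<subseteq> L X []"
    if X: "X \<in> listset (map vsort \<Gamma>)" for X
    unfolding cmpt_interp_Neg[OF X] using subspace_pairing by auto
  then show ?case by (rule interp_in_brelsI)
next
  case (Conj \<phi> \<psi>)
  have "oper.subspace (cmpt (interp (Conj \<phi> \<psi>) \<Gamma>) X []) \<and> cmpt (interp (Conj \<phi> \<psi>) \<Gamma>) X [] \<subseteq> L X []"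
    if X: "X \<in> listset (map vsort \<Gamma>)" for X
  proof -
    have 1: "interp \<phi> \<Gamma> \<in> brels (map vsort \<Gamma>) []" "interp \<psi> \<Gamma> \<in> brels (map vsort \<Gamma>) []"
      using Conj by auto
    show ?thesis unfolding cmpt_interp_Conj[OF X]
      by (intro conjI oper.subspace_inter le_infI1 subspace_cmpt_brel[OF 1(1)]
          subspace_cmpt_brel[OF 1(2)] cmpt_brel_subset_L[OF 1(1)])
  qed
  then show ?case by (rule interp_in_brelsI)
next
  case (Forall v \<phi>)
  have "ok_ctx (v # \<Gamma>)" using Forall.prems by (auto simp: ok_ctx_def)
  then have 1: "interp \<phi> (v # \<Gamma>) \<in> brels (map vsort (v # \<Gamma>)) []"
    by (rule Forall.IH) (use Forall.prems in simp)
  have "oper.subspace (cmpt (interp (Forall v \<phi>) \<Gamma>) X []) \<and> cmpt (interp (Forall v \<phi>) \<Gamma>) X [] \<subseteq> L X []"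
    if X: "X \<in> listset (map vsort \<Gamma>)" for X
  proof
    show "oper.subspace (cmpt (interp (Forall v \<phi>) \<Gamma>) X [])"
      unfolding interp.simps rel_sup_def cmpt_mk_brel[OF X Nil_in_listset[THEN iffD2, OF refl]]
      by (rule oper.subspace_span)
    show "cmpt (interp (Forall v \<phi>) \<Gamma>) X [] \<subseteq> L X []"
      unfolding cmpt_interp_Forall[OF subspace_cmpt_brel[OF 1] X] by (rule Collect_restrict)
  qed
  then show ?case by (rule interp_in_brelsI)
qed

definition one_dim :: "'i atom \<Rightarrow> bool" where
  "one_dim A \<longleftrightarrow> (\<exists>l. basis A = {l})"

definition lab :: "'i atom \<Rightarrow> 'i" where
  "lab A = the_elem (basis A)"

lemma basis_one_dim:
  assumes "one_dim A" shows "basis A = {lab A}"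
proof -
  obtain l where l: "basis A = {l}" using assms unfolding one_dim_def by (rule exE)
  then show ?thesis unfolding lab_def l by simp
qed

text \<open>
  The tensor product of the basis functional with label list \<open>c\<close> and \<open>m\<close>.
\<close>

definition pad :: "'i list \<Rightarrow> 'i oper \<Rightarrow> 'i oper" where
  "pad c m = (\<lambda>u j. if take (length c) j = c then m u (drop (length c) j) else 0)"

text \<open>
  A context \<open>Cs @ hs\<close> with classical variables \<open>Cs\<close>, i.e. with one-dimensional atoms, and an
  assignment \<open>\<alpha>\<close> of atoms to its variables.  The variables \<open>hs\<close> are unrestricted; in the
  formulas at hand they are quantified outermost and so stand last.
\<close>

definition good_ctx :: "'i var list \<Rightarrow> 'i var list \<Rightarrow> ('i var \<Rightarrow> 'i atom) \<Rightarrow> bool" where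
  "good_ctx hs Cs \<alpha> \<longleftrightarrow> ok_ctx (Cs @ hs) \<and> (\<forall>v\<in>set (Cs @ hs). \<alpha> v \<in> vsort v) \<and>
     (\<forall>v\<in>set Cs. \<forall>A\<in>vsort v. one_dim A)"

text \<open>
  The interpretation of \<open>\<phi>\<close> at the atoms \<open>\<alpha>\<close>, seen as a space of functionals on
  the atoms of \<open>hs\<close> alone.  No information is lost, since tensoring with the one-dimensional atoms
  of \<open>Cs\<close> changes nothing.
\<close>

definition val :: "'i var list \<Rightarrow> 'i fm \<Rightarrow> 'i var list \<Rightarrow> ('i var \<Rightarrow> 'i atom) \<Rightarrow> 'i oper set" where
  "val hs \<phi> Cs \<alpha> = {m \<in> L (map \<alpha> hs) [].
     pad (map (\<lambda>v. lab (\<alpha> v)) Cs) m \<in> cmpt (interp \<phi> (Cs @ hs)) (map \<alpha> (Cs @ hs)) []}"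

definition perp :: "'i atom list \<Rightarrow> 'i oper set \<Rightarrow> 'i oper set" where
  "perp X U = {m \<in> L X []. \<forall>f\<in>U. pairing X f m = 0}"

lemma val_subset_L: "val hs \<phi> Cs \<alpha> \<subseteq> L (map \<alpha> hs) []"
  by (auto simp: val_def)

lemma good_ctxD:
  assumes "good_ctx hs Cs \<alpha>"
  shows "ok_ctx (Cs @ hs)" "map \<alpha> (Cs @ hs) \<in> listset (map vsort (Cs @ hs))"
    "distinct (Cs @ hs)" "\<And>v. v \<in> set Cs \<Longrightarrow> one_dim (\<alpha> v)"
    "\<And>v. v \<in> set (Cs @ hs) \<Longrightarrow> \<alpha> v \<in> vsort v"
    "\<And>v. v \<in> set (Cs @ hs) \<Longrightarrow> finite (basis (\<alpha> v))"
proof -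
  show "map \<alpha> (Cs @ hs) \<in> listset (map vsort (Cs @ hs))"
    unfolding map_in_listset using assms by (simp add: good_ctx_def)
qed (use assms in \<open>auto simp: good_ctx_def ok_ctx_def\<close>)

lemma idx_one_dim:
  assumes "\<And>v. v \<in> set Cs \<Longrightarrow> one_dim (\<alpha> v)"
  shows "idx (map \<alpha> Cs) = {map (\<lambda>v. lab (\<alpha> v)) Cs}"
  using assms
proof (induction Cs)
  case (Cons v Cs)
  have "idx (\<alpha> v # map \<alpha> Cs) = (\<lambda>(l, j). l # j) ` (basis (\<alpha> v) \<times> idx (map \<alpha> Cs))"
    by (auto simp: idx_def set_Cons_def)
  then show ?case using Cons basis_one_dim[of "\<alpha> v"] by simp
qed simp

lemma good_idx:
  assumes "good_ctx hs Cs \<alpha>"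
  shows "k \<in> idx (map \<alpha> (Cs @ hs)) \<longleftrightarrow>
    (\<exists>j\<in>idx (map \<alpha> hs). k = map (\<lambda>v. lab (\<alpha> v)) Cs @ j)"
proof -
  have "idx (map \<alpha> Cs) = {map (\<lambda>v. lab (\<alpha> v)) Cs}"
    using good_ctxD(4)[OF assms] by (rule idx_one_dim)
  then show ?thesis
    unfolding map_append
    by (auto elim!: in_idx_appendE simp: in_idx_append)
qed

lemma pad_append [simp]: "pad c m u (c @ j) = m u j"
  by (simp add: pad_def)

lemma pad_in_L:
  assumes "good_ctx hs Cs \<alpha>" "m \<in> L (map \<alpha> hs) []"
  shows "pad (map (\<lambda>v. lab (\<alpha> v)) Cs) m \<in> L (map \<alpha> (Cs @ hs)) []"
proof -
  let ?c = "map (\<lambda>v. lab (\<alpha> v)) Cs"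
  have "i = [] \<and> j \<in> idx (map \<alpha> (Cs @ hs))" if "pad ?c m i j \<noteq> 0" for i j
  proof -
    have j: "take (length ?c) j = ?c" "m i (drop (length ?c) j) \<noteq> 0"
      using that by (auto simp: pad_def split: if_splits)
    then have "i = []" "drop (length ?c) j \<in> idx (map \<alpha> hs)" using assms(2) unfolding L_iff by auto
    moreover have "j = ?c @ drop (length ?c) j" using j(1) by (metis append_take_drop_id)
    ultimately show ?thesis unfolding good_idx[OF assms(1)] by blast
  qed
  then show ?thesis unfolding L_iff by blast
qed

lemma L_pad:
  assumes "good_ctx hs Cs \<alpha>" "g \<in> L (map \<alpha> (Cs @ hs)) []"
  obtains m where "m \<in> L (map \<alpha> hs) []" "g = pad (map (\<lambda>v. lab (\<alpha> v)) Cs) m"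
proof
  let ?c = "map (\<lambda>v. lab (\<alpha> v)) Cs"
  define m where "m = (\<lambda>u j. g u (?c @ j))"
  have "j \<in> idx (map \<alpha> hs)" if "?c @ j \<in> idx (map \<alpha> (Cs @ hs))" for j
    using that unfolding good_idx[OF assms(1)] by auto
  then show 1: "m \<in> L (map \<alpha> hs) []"
    using assms(2) unfolding m_def L_iff by auto
  show "g = pad ?c m"
  proof (rule functional_eqI[OF assms(2) pad_in_L[OF assms(1) 1]])
    fix j assume "j \<in> idx (map \<alpha> (Cs @ hs))"
    then show "g [] j = pad ?c m [] j"
      unfolding good_idx[OF assms(1)] by (auto simp: m_def)
  qed
qed

lemma pairing_pad:
  assumes "good_ctx hs Cs \<alpha>"
  shows "pairing (map \<alpha> (Cs @ hs)) (pad (map (\<lambda>v. lab (\<alpha> v)) Cs) f) (pad (map (\<lambda>v. lab (\<alpha> v)) Cs) g) =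
    pairing (map \<alpha> hs) f g"
proof -
  let ?c = "map (\<lambda>v. lab (\<alpha> v)) Cs"
  have "idx (map \<alpha> (Cs @ hs)) = (\<lambda>j. ?c @ j) ` idx (map \<alpha> hs)"
    using good_idx[OF assms] by blast
  then show ?thesis unfolding pairing_def
    by (simp add: sum.reindex inj_on_def del: map_append)
qed

lemma val_Neg:
  assumes g: "good_ctx hs Cs \<alpha>" and wf: "wf_fm \<phi> (Cs @ hs)"
  shows "val hs (Neg \<phi>) Cs \<alpha> = perp (map \<alpha> hs) (val hs \<phi> Cs \<alpha>)"
proof -
  let ?c = "map (\<lambda>v. lab (\<alpha> v)) Cs" and ?X = "map \<alpha> (Cs @ hs)"
  have sub: "cmpt (interp \<phi> (Cs @ hs)) ?X [] \<subseteq> L ?X []"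
    using cmpt_brel_subset_L interp_in_brels[OF good_ctxD(1)[OF g] wf] by blast
  have "(\<forall>f\<in>cmpt (interp \<phi> (Cs @ hs)) ?X []. pairing ?X f (pad ?c m) = 0) \<longleftrightarrow>
      (\<forall>f\<in>val hs \<phi> Cs \<alpha>. pairing (map \<alpha> hs) f m = 0)" for m
  proof (intro iffI ballI)
    fix f assume *: "\<forall>f\<in>cmpt (interp \<phi> (Cs @ hs)) ?X []. pairing ?X f (pad ?c m) = 0" and "f \<in> val hs \<phi> Cs \<alpha>"
    then have "pad ?c f \<in> cmpt (interp \<phi> (Cs @ hs)) ?X []" unfolding val_def by blast
    then show "pairing (map \<alpha> hs) f m = 0" using * pairing_pad[OF g, of f m] by metis
  next
    fix f assume *: "\<forall>f\<in>val hs \<phi> Cs \<alpha>. pairing (map \<alpha> hs) f m = 0" and f: "f \<in> cmpt (interp \<phi> (Cs @ hs)) ?X []"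
    then obtain f' where f': "f' \<in> L (map \<alpha> hs) []" "f = pad ?c f'"
      using L_pad[OF g, of f] sub by blast
    then have "f' \<in> val hs \<phi> Cs \<alpha>" using f unfolding val_def by blast
    then show "pairing ?X f (pad ?c m) = 0" using * pairing_pad[OF g, of f' m] f' by metis
  qed
  then show ?thesis
    unfolding val_def[of hs "Neg \<phi>"] perp_def cmpt_interp_Neg[OF good_ctxD(2)[OF g]]
    using pad_in_L[OF g] by blast
qed

lemma val_Conj:
  assumes "good_ctx hs Cs \<alpha>"
  shows "val hs (Conj \<phi> \<psi>) Cs \<alpha> = val hs \<phi> Cs \<alpha> \<inter> val hs \<psi> Cs \<alpha>"
  unfolding val_def cmpt_interp_Conj[OF good_ctxD(2)[OF assms]] by blast

lemma good_ctx_Cons: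
  assumes "good_ctx hs Cs \<alpha>" "v \<notin> set (Cs @ hs)" "\<And>A. A \<in> vsort v \<Longrightarrow> one_dim A" "A \<in> vsort v"
  shows "good_ctx hs (v # Cs) (\<alpha>(v := A))"
  using assms unfolding good_ctx_def ok_ctx_def one_dim_def by auto force

lemma val_subspace:
  assumes "good_ctx hs Cs \<alpha>" "wf_fm \<phi> (Cs @ hs)"
  shows "oper.subspace (val hs \<phi> Cs \<alpha>)"
proof -
  let ?c = "map (\<lambda>v. lab (\<alpha> v)) Cs" and ?X = "map \<alpha> (Cs @ hs)"
  have sub: "oper.subspace (cmpt (interp \<phi> (Cs @ hs)) ?X [])"
    using subspace_cmpt_brel interp_in_brels[OF good_ctxD(1)] assms by blast
  have 1: "pad ?c (f + g) = pad ?c f + pad ?c g" for f g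
    by (simp add: pad_def plus_fun_def fun_eq_iff)
  have 2: "pad ?c (scale_op k f) = scale_op k (pad ?c f)" for k f
    by (simp add: pad_def scale_op_def fun_eq_iff)
  have 3: "pad ?c 0 = 0"
    by (simp add: pad_def zero_fun_def fun_eq_iff)
  show ?thesis
    using sub subspace_L[of "map \<alpha> hs" "[]"] unfolding val_def oper.subspace_def mem_Collect_eq
    by (simp only: 1 2 3) blast
qed

text \<open>
  The functionals on a one-dimensional atom are multiples of a single one, and tensoring with that one
  is what \<open>val\<close> undoes.  So a classical universal quantifier is an intersection over values.
\<close>

lemma val_Forall:
  assumes g: "good_ctx hs Cs \<alpha>" and v: "v \<notin> set (Cs @ hs)" "\<And>A. A \<in> vsort v \<Longrightarrow> one_dim A"
    and wf: "wf_fm \<phi> (v # Cs @ hs)"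
  shows "val hs (Forall v \<phi>) Cs \<alpha> =
    {m \<in> L (map \<alpha> hs) []. \<forall>A\<in>vsort v. m \<in> val hs \<phi> (v # Cs) (\<alpha>(v := A))}"
proof -
  let ?c = "map (\<lambda>v. lab (\<alpha> v)) Cs" and ?X = "map \<alpha> (Cs @ hs)"
  have "ok_ctx (v # Cs @ hs)"
    using good_ctxD(1)[OF g] v unfolding ok_ctx_def by (auto simp: one_dim_def) force
  then have sub: "oper.subspace (cmpt (interp \<phi> (v # Cs @ hs)) X [])" for X
    using interp_in_brels wf subspace_cmpt_brel by blast
  have upd: "map (\<alpha>(v := A)) hs = map \<alpha> hs" "map (\<alpha>(v := A)) (Cs @ hs) = ?X"
    "map (\<lambda>w. lab ((\<alpha>(v := A)) w)) Cs = ?c" for A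
    using v(1) by auto
  have "(\<forall>A\<in>vsort v. \<forall>t\<in>L [A] []. op_tensor 1 0 t (pad ?c m) \<in> cmpt (interp \<phi> (v # Cs @ hs)) (A # ?X) []) \<longleftrightarrow>
      (\<forall>A\<in>vsort v. m \<in> val hs \<phi> (v # Cs) (\<alpha>(v := A)))" if m: "m \<in> L (map \<alpha> hs) []" for m
  proof (rule ball_cong[OF refl])
    fix A assume A: "A \<in> vsort v"
    have b: "basis A = {lab A}" using v(2)[OF A] by (rule basis_one_dim)
    have tens: "op_tensor 1 0 t (pad ?c m) = scale_op (t [] [lab A]) (pad (lab A # ?c) m)" if t: "t \<in> L [A] []" for t
    proof (intro ext)
      fix u j
      show "op_tensor 1 0 t (pad ?c m) u j = scale_op (t [] [lab A]) (pad (lab A # ?c) m) u j"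
      proof (cases j)
        case Nil
        then have "t (take 0 u) (take 1 j) = 0" using t unfolding L_iff by (auto simp: in_idx)
        then show ?thesis using Nil by (simp add: op_tensor_def scale_op_def pad_def)
      next
        case (Cons l k)
        have "t [] [l] = 0" if "l \<noteq> lab A"
          using t that b unfolding L_iff by (auto simp: in_idx)
        then show ?thesis using Cons by (auto simp: op_tensor_def scale_op_def pad_def)
      qed
    qed
    define t1 :: "'a oper" where "t1 = (\<lambda>u j. if u = [] \<and> j = [lab A] then 1 else 0)"
    have t1: "t1 \<in> L [A] []" "t1 [] [lab A] = 1"
      using b by (auto simp: t1_def L_iff in_idx split: if_splits)
    have "(\<forall>t\<in>L [A] []. op_tensor 1 0 t (pad ?c m) \<in> cmpt (interp \<phi> (v # Cs @ hs)) (A # ?X) []) \<longleftrightarrow>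
      pad (lab A # ?c) m \<in> cmpt (interp \<phi> (v # Cs @ hs)) (A # ?X) []"
    proof
      assume "\<forall>t\<in>L [A] []. op_tensor 1 0 t (pad ?c m) \<in> cmpt (interp \<phi> (v # Cs @ hs)) (A # ?X) []"
      then have "scale_op (t1 [] [lab A]) (pad (lab A # ?c) m) \<in> cmpt (interp \<phi> (v # Cs @ hs)) (A # ?X) []"
        using tens[OF t1(1)] t1(1) by metis
      then show "pad (lab A # ?c) m \<in> cmpt (interp \<phi> (v # Cs @ hs)) (A # ?X) []"
        unfolding t1(2) by simp
    next
      assume "pad (lab A # ?c) m \<in> cmpt (interp \<phi> (v # Cs @ hs)) (A # ?X) []"
      then show "\<forall>t\<in>L [A] []. op_tensor 1 0 t (pad ?c m) \<in> cmpt (interp \<phi> (v # Cs @ hs)) (A # ?X) []"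
        using tens sub by (auto intro!: oper.subspace_scale)
    qed
    also have "\<dots> \<longleftrightarrow> m \<in> val hs \<phi> (v # Cs) (\<alpha>(v := A))"
    proof -
      have "m \<in> val hs \<phi> (v # Cs) (\<alpha>(v := A)) \<longleftrightarrow> m \<in> L (map (\<alpha>(v := A)) hs) [] \<and>
         pad (lab A # map (\<lambda>w. lab ((\<alpha>(v := A)) w)) Cs) m \<in>
         cmpt (interp \<phi> (v # Cs @ hs)) (A # map (\<alpha>(v := A)) (Cs @ hs)) []"
        by (simp add: val_def)
      then show ?thesis unfolding upd using m by simp
    qed
    finally show "(\<forall>t\<in>L [A] []. op_tensor 1 0 t (pad ?c m) \<in> cmpt (interp \<phi> (v # Cs @ hs)) (A # ?X) []) \<longleftrightarrow>
      m \<in> val hs \<phi> (v # Cs) (\<alpha>(v := A))" .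
  qed
  moreover have "pad ?c m \<in> L ?X []" if "m \<in> L (map \<alpha> hs) []" for m
    using pad_in_L[OF g that] .
  ultimately show ?thesis
    unfolding val_def[of hs "Forall v \<phi>"] cmpt_interp_Forall[OF sub good_ctxD(2)[OF g]] by blast
qed

text \<open>
  The labels of classical variables are determined by their atoms, so fixing them in the slices of an
  atomic formula has no effect and only the variables \<open>hs\<close> remain.
\<close>

lemma val_Rel:
  assumes g: "good_ctx hs Cs \<alpha>" and wf: "wf_fm (Rel R vs) (Cs @ hs)"
  shows "val hs (Rel R vs) Cs \<alpha> = {m \<in> L (map \<alpha> hs) []. \<forall>\<eta>. (\<forall>v\<in>set (Cs @ hs). \<eta> v \<in> basis (\<alpha> v)) \<longrightarrow>
      (\<lambda>u y. if y \<in> idx (map \<alpha> vs) then m u (map (override \<eta> vs y) hs) else 0) \<in> cmpt R (map \<alpha> vs) []}"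
proof -
  let ?c = "map (\<lambda>v. lab (\<alpha> v)) Cs" and ?X = "map \<alpha> (Cs @ hs)"
  have eq: "cmpt (interp (Rel R vs) (Cs @ hs)) ?X [] =
    {g \<in> L ?X []. \<forall>\<eta>. (\<forall>v\<in>set (Cs @ hs). \<eta> v \<in> basis (\<alpha> v)) \<longrightarrow>
      (\<lambda>u y. if y \<in> idx (map \<alpha> vs) then g u (map (override \<eta> vs y) (Cs @ hs)) else 0) \<in> cmpt R (map \<alpha> vs) []}"
    by (rule cmpt_interp_Rel) (use good_ctxD[OF g] wf in auto)
  have 1: "(\<lambda>u y. if y \<in> idx (map \<alpha> vs) then pad ?c m u (map (override \<eta> vs y) (Cs @ hs)) else 0) =
      (\<lambda>u y. if y \<in> idx (map \<alpha> vs) then m u (map (override \<eta> vs y) hs) else 0)"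
    if "\<forall>v\<in>set (Cs @ hs). \<eta> v \<in> basis (\<alpha> v)" for \<eta> m
  proof (intro ext if_cong refl)
    fix u y assume y: "y \<in> idx (map \<alpha> vs)"
    have "override \<eta> vs y v = lab (\<alpha> v)" if v: "v \<in> set Cs" for v
    proof -
      have "override \<eta> vs y v \<in> basis (\<alpha> v)"
        using y \<open>\<forall>v\<in>set (Cs @ hs). \<eta> v \<in> basis (\<alpha> v)\<close> v by (intro override_valid) auto
      then show ?thesis using basis_one_dim good_ctxD(4)[OF g v] by auto
    qed
    then have "map (override \<eta> vs y) Cs = ?c" by simp
    then show "pad ?c m u (map (override \<eta> vs y) (Cs @ hs)) = m u (map (override \<eta> vs y) hs)"
      by (simp only: map_append pad_append)
  qed
  show ?thesis
    unfolding val_def eq using 1 pad_in_L[OF g] by auto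
qed

text \<open>
  An atomic formula in classical variables does not constrain the functional on \<open>hs\<close>: it is
  satisfied by all of them or only by 0.
\<close>

lemma val_Rel_classical:
  assumes g: "good_ctx hs Cs \<alpha>" and wf: "wf_fm (Rel R vs) (Cs @ hs)" and vs: "set vs \<subseteq> set Cs"
    and R: "cmpt R (map \<alpha> vs) [] = (if P then L (map \<alpha> vs) [] else {0})"
  shows "val hs (Rel R vs) Cs \<alpha> = (if P then L (map \<alpha> hs) [] else {0})"
proof -
  have dis: "set vs \<inter> set hs = {}" using vs good_ctxD(3)[OF g] by auto
  have ov: "map (override \<eta> vs y) hs = map \<eta> hs" for \<eta> y
    using dis by (intro map_cong refl override_notin) auto
  have one: "idx (map \<alpha> vs) = {map (\<lambda>v. lab (\<alpha> v)) vs}"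
    using good_ctxD(4)[OF g] vs by (intro idx_one_dim) auto
  show ?thesis
  proof (cases P)
    case True
    have "(\<lambda>u y. if y \<in> idx (map \<alpha> vs) then m u (map \<eta> hs) else 0) \<in> L (map \<alpha> vs) []"
      if "m \<in> L (map \<alpha> hs) []" for m \<eta>
      using that unfolding L_iff by auto
    then show ?thesis unfolding val_Rel[OF g wf] R ov using True by auto
  next
    case False
    have "m = 0" if m: "m \<in> L (map \<alpha> hs) []"
      and z: "\<forall>\<eta>. (\<forall>v\<in>set (Cs @ hs). \<eta> v \<in> basis (\<alpha> v)) \<longrightarrow>
          (\<lambda>u y. if y \<in> idx (map \<alpha> vs) then m u (map \<eta> hs) else 0) = 0" for m
    proof (rule functional_eqI[OF m oper.subspace_0[OF subspace_L]])
      fix j assume j: "j \<in> idx (map \<alpha> hs)"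
      define \<eta> where "\<eta> = override (\<lambda>v. lab (\<alpha> v)) hs j"
      have "\<eta> v \<in> basis (\<alpha> v)" if "v \<in> set (Cs @ hs)" for v
        unfolding \<eta>_def using that good_ctxD(4)[OF g, of v] basis_one_dim[of "\<alpha> v"]
        by (intro override_valid[OF j]) auto
      then have eq: "(\<lambda>u y. if y \<in> idx (map \<alpha> vs) then m u (map \<eta> hs) else 0) = 0" using z by blast
      have "m [] (map \<eta> hs) = 0"
        using fun_cong[OF fun_cong[OF eq, of "[]"], of "map (\<lambda>v. lab (\<alpha> v)) vs"] one by simp
      moreover have "map \<eta> hs = j"
        unfolding \<eta>_def using good_ctxD(3)[OF g] in_idx_map[OF j] by (intro map_override) auto
      ultimately show "m [] j = (0 :: 'a oper) [] j" by simp
    qed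
    then have "val hs (Rel R vs) Cs \<alpha> \<subseteq> {0}" unfolding val_Rel[OF g wf] R ov using False by auto
    moreover have "0 \<in> val hs (Rel R vs) Cs \<alpha>"
      using val_subspace[OF g wf] by (rule oper.subspace_0)
    ultimately show ?thesis using False by auto
  qed
qed

section \<open>Orthogonal complements and the defined connectives\<close>

lemma perp_subset_L: "perp X U \<subseteq> L X []"
  by (simp add: perp_def)

lemma pairing_commute: "pairing X g f = cnj (pairing X f g)"
  by (simp add: pairing_def mult.commute)

lemma zero_in_perp: "0 \<in> perp X U"
  using oper.subspace_0[OF subspace_L[of X "[]"]] by (simp add: perp_def pairing_def)

lemma perp_antimono: "U \<subseteq> W \<Longrightarrow> perp X W \<subseteq> perp X U"
  by (auto simp: perp_def)

lemma subset_perp_perp: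
  assumes "U \<subseteq> L X []" shows "U \<subseteq> perp X (perp X U)"
proof
  fix m assume m: "m \<in> U"
  have "pairing X f m = 0" if "f \<in> perp X U" for f
    using that m pairing_commute[of X f m] by (simp add: perp_def)
  then show "m \<in> perp X (perp X U)" using m assms by (auto simp: perp_def)
qed

lemma perp_perp_perp:
  assumes "U \<subseteq> L X []" shows "perp X (perp X (perp X U)) = perp X U"
  using perp_antimono[OF subset_perp_perp[OF assms]] subset_perp_perp[OF perp_subset_L] by (rule equalityI)

lemma perp_UN: "perp X (\<Union>i\<in>I. U i) = {m \<in> L X []. \<forall>i\<in>I. m \<in> perp X (U i)}"
  by (auto simp: perp_def)

lemma pairing_self:
  assumes "finite (idx X)" "f \<in> L X []" "pairing X f f = 0"
  shows "f = 0"
proof (rule functional_eqI[OF assms(2) oper.subspace_0[OF subspace_L]])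
  fix j assume j: "j \<in> idx X"
  have "complex_of_real (\<Sum>j\<in>idx X. (cmod (f [] j))\<^sup>2) = 0"
    using assms(3) unfolding pairing_def of_real_sum
    by (simp add: complex_norm_square mult.commute del: of_real_power)
  then have "(\<Sum>j\<in>idx X. (cmod (f [] j))\<^sup>2) = 0" using of_real_eq_0_iff by blast
  then have "(cmod (f [] j))\<^sup>2 = 0"
    using assms(1) j by (subst (asm) sum_nonneg_eq_0_iff) auto
  then show "f [] j = (0 :: 'a oper) [] j" by simp
qed

lemma perp_zero: "perp X {0} = L X []"
  by (auto simp: perp_def pairing_def)

lemma inter_perp:
  assumes "finite (idx X)" "U \<subseteq> L X []" "U \<subseteq> W"
  shows "U \<inter> perp X W \<subseteq> {0}"
  using pairing_self[OF assms(1)] assms(2,3) by (auto simp: perp_def)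

lemma perp_L:
  assumes "finite (idx X)" shows "perp X (L X []) = {0}"
  using inter_perp[OF assms order_refl order_refl] zero_in_perp[of X "L X []"] perp_subset_L[of X "L X []"] by blast

lemma val_Imp:
  assumes "good_ctx hs Cs \<alpha>" "wf_fm \<phi> (Cs @ hs)" "wf_fm \<psi> (Cs @ hs)"
  shows "val hs (Imp \<phi> \<psi>) Cs \<alpha> = (let X = map \<alpha> hs; U = val hs \<phi> Cs \<alpha> in
    perp X (perp X (perp X U) \<inter> perp X (U \<inter> val hs \<psi> Cs \<alpha>)))"
  using assms by (simp add: Imp_def Or_def val_Neg val_Conj Let_def)

lemma finite_idx_good: "good_ctx hs Cs \<alpha> \<Longrightarrow> finite (idx (map \<alpha> hs))"
  using good_ctxD(6) by (intro finite_idx) auto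

text \<open>
  If the left side is \<open>\<top>\<close>, then \<open>\<phi> \<rightarrow> \<psi>\<close> is the closure of \<open>\<psi>\<close>, and
  \<open>\<psi> \<rightarrow> \<phi>\<close> is \<open>\<top>\<close> because a closed space meets its complement in 0.
\<close>

lemma val_Iff_top:
  assumes g: "good_ctx hs Cs \<alpha>" and wf: "wf_fm \<phi> (Cs @ hs)" "wf_fm \<psi> (Cs @ hs)"
    and top: "val hs \<phi> Cs \<alpha> = L (map \<alpha> hs) []"
  shows "val hs (Iff \<phi> \<psi>) Cs \<alpha> = perp (map \<alpha> hs) (perp (map \<alpha> hs) (val hs \<psi> Cs \<alpha>))"
proof -
  let ?X = "map \<alpha> hs" and ?V = "val hs \<psi> Cs \<alpha>"
  have fin: "finite (idx ?X)" using finite_idx_good[OF g] .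
  have V: "?V \<subseteq> L ?X []" by (rule val_subset_L)
  have 1: "L ?X [] \<inter> ?V = ?V" "?V \<inter> L ?X [] = ?V" "L ?X [] \<inter> perp ?X ?V = perp ?X ?V"
    using V perp_subset_L by blast+
  have "perp ?X (perp ?X ?V) \<inter> perp ?X ?V \<subseteq> {0}"
    using inter_perp[OF fin perp_subset_L[of ?X ?V] order_refl] by blast
  then have 2: "perp ?X (perp ?X ?V) \<inter> perp ?X ?V = {0}"
    using zero_in_perp by blast
  show ?thesis
    using perp_subset_L[of ?X "perp ?X ?V"] wf g
    by (simp add: Iff_def val_Conj val_Imp top Let_def perp_L[OF fin] perp_zero 1 2 Int_absorb2)
qed

text \<open>
  If the left side is \<open>\<bottom>\<close>, then \<open>\<phi> \<rightarrow> \<psi>\<close> is \<open>\<top>\<close>, and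
  \<open>\<psi> \<rightarrow> \<phi>\<close> reduces to the negation of \<open>\<psi>\<close>.
\<close>

lemma val_Iff_bot:
  assumes g: "good_ctx hs Cs \<alpha>" and wf: "wf_fm \<phi> (Cs @ hs)" "wf_fm \<psi> (Cs @ hs)"
    and bot: "val hs \<phi> Cs \<alpha> = {0}"
  shows "val hs (Iff \<phi> \<psi>) Cs \<alpha> = perp (map \<alpha> hs) (val hs \<psi> Cs \<alpha>)"
proof -
  let ?X = "map \<alpha> hs" and ?V = "val hs \<psi> Cs \<alpha>"
  have fin: "finite (idx ?X)" using finite_idx_good[OF g] .
  have V: "?V \<subseteq> L ?X []" by (rule val_subset_L)
  have z: "0 \<in> ?V" using val_subspace[OF g wf(2)] by (rule oper.subspace_0)
  have 1: "{0} \<inter> ?V = {0}" "?V \<inter> {0} = {0}" "{0} \<inter> L ?X [] = {0}"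
    using z oper.subspace_0[OF subspace_L[of ?X "[]"]] by auto
  have 2: "perp ?X (perp ?X ?V) \<inter> L ?X [] = perp ?X (perp ?X ?V)" "L ?X [] \<inter> perp ?X ?V = perp ?X ?V"
    using perp_subset_L by blast+
  show ?thesis
    using wf g
    by (simp add: Iff_def val_Conj val_Imp bot Let_def perp_L[OF fin] perp_zero 1 2 perp_perp_perp[OF V])
qed

section \<open>Quantification over pairs of equal variables\<close>

lemma basis_dual_atom [simp]: "basis (dual_atom A) = basis A"
  by (cases A) simp_all

lemma dual_dual_atom [simp]: "dual_atom (dual_atom A) = A"
  by (cases A) simp_all

lemma dual_atom_inject [simp]: "dual_atom A = dual_atom B \<longleftrightarrow> A = B"
  by (metis dual_dual_atom)

lemma dual_dual [simp]: "dual (dual Q) = Q"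
  by (simp add: dual_def image_image)

lemma dual_atom_in_dual [simp]: "dual_atom A \<in> dual Q \<longleftrightarrow> A \<in> Q"
  by (auto simp: dual_def)

lemma in_dual: "A \<in> dual Q \<longleftrightarrow> dual_atom A \<in> Q"
  by (metis dual_atom_in_dual dual_dual_atom)

lemma one_dim_dual_atom [simp]: "one_dim (dual_atom A) \<longleftrightarrow> one_dim A"
  by (simp add: one_dim_def)

lemma lab_dual_atom [simp]: "lab (dual_atom A) = lab A"
  by (simp add: lab_def)

lemma evaluation_in_L: "evaluation A \<in> L [A, dual_atom A] []"
  by (auto simp: L_iff evaluation_def in_idx split: if_splits)

lemma cmpt_rel_eq:
  assumes "A \<in> Q" "A' \<in> dual Q"
  shows "cmpt (rel_eq Q) [A, A'] [] = (if A' = dual_atom A then oper.span {evaluation A} else {0})"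
proof -
  have "[A, A'] \<in> listset [Q, dual Q]" unfolding in_listset using assms by simp
  then show ?thesis by (simp add: rel_eq_def del: listset.simps)
qed

lemma mk_brel_in_brels:
  assumes "\<And>X Y. X \<in> listset Xs \<Longrightarrow> Y \<in> listset Ys \<Longrightarrow> oper.subspace (f X Y)"
    and "\<And>X Y. X \<in> listset Xs \<Longrightarrow> Y \<in> listset Ys \<Longrightarrow> f X Y \<subseteq> L X Y"
  shows "mk_brel Xs Ys f \<in> brels Xs Ys"
  unfolding brels_def mem_Collect_eq
proof (intro conjI allI)
  fix X Y
  show "if X \<in> listset Xs \<and> Y \<in> listset Ys
      then oper.subspace (cmpt (mk_brel Xs Ys f) X Y) \<and> cmpt (mk_brel Xs Ys f) X Y \<subseteq> L X Y
      else cmpt (mk_brel Xs Ys f) X Y = {0}"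
  proof (cases "X \<in> listset Xs \<and> Y \<in> listset Ys")
    case True
    then show ?thesis using assms[of X Y] by simp
  next
    case False
    then show ?thesis unfolding if_not_P[OF False] by (rule cmpt_mk_brel_outside)
  qed
qed simp_all

lemma span_evaluation_subset_L: "oper.span {evaluation A} \<subseteq> L [A, dual_atom A] []"
  using evaluation_in_L by (intro oper.span_minimal subspace_L) simp

lemma rel_eq_in_brels: "rel_eq Q \<in> brels [Q, dual Q] []"
  unfolding rel_eq_def
proof (rule mk_brel_in_brels)
  fix X Y :: "'a atom list" assume "X \<in> listset [Q, dual Q]" "Y \<in> listset []"
  then obtain A A' where X: "X = [A, A']" "Y = []"
    unfolding in_listset by (auto simp: list_all2_Cons2)
  show "oper.subspace (if X ! 1 = dual_atom (X ! 0) then oper.span {evaluation (X ! 0)} else {0})"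
    by (simp add: oper.subspace_single_0)
  show "(if X ! 1 = dual_atom (X ! 0) then oper.span {evaluation (X ! 0)} else {0}) \<subseteq> L X Y"
    using span_evaluation_subset_L[of A] oper.subspace_0[OF subspace_L[of X "[]"]] by (simp add: X)
qed

lemma L_one_dim_span:
  assumes X: "idx X = {c}" and f: "f \<in> L X []" "f [] c \<noteq> 0"
  shows "oper.span {f} = L X []"
proof (intro equalityI oper.span_minimal subspace_L)
  show "{f} \<subseteq> L X []" using f by simp
  show "L X [] \<subseteq> oper.span {f}"
  proof
    fix g assume g: "g \<in> L X []"
    have "g = scale_op (g [] c / f [] c) f"
    proof (rule functional_eqI[OF g oper.subspace_scale[OF subspace_L f(1)]])
      fix j assume "j \<in> idx X"
      then show "g [] j = scale_op (g [] c / f [] c) f [] j" using X f(2) by (simp add: scale_op_def)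
    qed
    then show "g \<in> oper.span {f}" by (metis oper.span_base oper.span_scale singletonI)
  qed
qed

lemma idx_pair:
  assumes "one_dim A" "one_dim B" shows "idx [A, B] = {[lab A, lab B]}"
  using basis_one_dim[OF assms(1)] basis_one_dim[OF assms(2)]
  by (auto simp: in_idx list_all2_Cons2)

text \<open>
  On a one-dimensional atom, evaluation spans all functionals, so equality of classical variables is
  either \<open>\<top>\<close> or \<open>\<bottom>\<close>.
\<close>

lemma cmpt_rel_eq_one_dim:
  assumes "A \<in> Q" "A' \<in> dual Q" "one_dim A"
  shows "cmpt (rel_eq Q) [A, A'] [] = (if A' = dual_atom A then L [A, A'] [] else {0})"
proof -
  have "oper.span {evaluation A} = L [A, dual_atom A] []"
  proof (rule L_one_dim_span)
    show "idx [A, dual_atom A] = {[lab A, lab A]}" using idx_pair[of A "dual_atom A"] assms(3) by simp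
    show "evaluation A [] [lab A, lab A] \<noteq> 0" using basis_one_dim[OF assms(3)] by (simp add: evaluation_def)
  qed (rule evaluation_in_L)
  then show ?thesis unfolding cmpt_rel_eq[OF assms(1,2)] by auto
qed

text \<open>
  The guard \<open>E(v, v')\<close> is \<open>\<top>\<close> at equal values and \<open>\<bottom>\<close> at different ones.  The
  implication is therefore \<open>\<top>\<close> at different values, and at equal values it is the double complement of
  \<open>\<phi>\<close>, which is all that remains of the Sasaki arrow.
\<close>

lemma val_ForallEq:
  assumes g: "good_ctx hs Cs \<alpha>"
    and v: "v \<notin> set (Cs @ hs)" "v' \<notin> set (Cs @ hs)" "v \<noteq> v'" "vsort v' = dual (vsort v)"
      "\<And>A. A \<in> vsort v \<Longrightarrow> one_dim A"
    and wf: "wf_fm \<phi> (v # v' # Cs @ hs)"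
  shows "val hs (ForallEq v v' \<phi>) Cs \<alpha> = {m \<in> L (map \<alpha> hs) []. \<forall>A\<in>vsort v.
    m \<in> perp (map \<alpha> hs) (perp (map \<alpha> hs) (val hs \<phi> (v # v' # Cs) (\<alpha>(v' := dual_atom A, v := A))))}"
proof -
  let ?E = "Rel (rel_eq (vsort v)) [v, v']" and ?X = "map \<alpha> hs"
  have v'1: "one_dim A'" if "A' \<in> vsort v'" for A'
    using that v(4) v(5)[of "dual_atom A'"] by (simp add: in_dual)
  have fin: "finite (basis A)" if "A \<in> vsort v \<or> A \<in> vsort v'" for A
    using that v(5) v'1 basis_one_dim by (metis finite.emptyI finite_insert)
  have wfE: "wf_fm ?E (v # v' # Cs @ hs)"
    using v(3,4) rel_eq_in_brels by simp
  have wfI: "wf_fm (Imp ?E \<phi>) (v # v' # Cs @ hs)"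
    using wf wfE by (simp add: Imp_def Or_def)
  have wfF: "wf_fm (Forall v (Imp ?E \<phi>)) (v' # Cs @ hs)"
    using wfI v fin by simp
  have g1: "good_ctx hs (v' # Cs) (\<alpha>(v' := A'))" if "A' \<in> vsort v'" for A'
    by (rule good_ctx_Cons[OF g v(2)]) (use v'1 that in auto)
  have g2: "good_ctx hs (v # v' # Cs) (\<alpha>(v' := A', v := A))" if "A' \<in> vsort v'" "A \<in> vsort v" for A A'
    by (rule good_ctx_Cons[OF g1[OF that(1)]]) (use v that in auto)
  have X: "map (\<alpha>(v' := A')) hs = ?X" "map (\<alpha>(v' := A', v := A)) hs = ?X" for A A'
    using v by auto
  have E: "val hs ?E (v # v' # Cs) (\<alpha>(v' := A', v := A)) = (if A' = dual_atom A then L ?X [] else {0})"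
    if "A' \<in> vsort v'" "A \<in> vsort v" for A A'
  proof -
    have "cmpt (rel_eq (vsort v)) (map (\<alpha>(v' := A', v := A)) [v, v']) [] =
      (if A' = dual_atom A then L (map (\<alpha>(v' := A', v := A)) [v, v']) [] else {0})"
      using cmpt_rel_eq_one_dim[of A "vsort v" A'] that v by simp
    from val_Rel_classical[OF g2[OF that] _ _ this] show ?thesis
      using wfE unfolding X by simp
  qed
  have I: "val hs (Imp ?E \<phi>) (v # v' # Cs) (\<alpha>(v' := A', v := A)) =
     (if A' = dual_atom A then perp ?X (perp ?X (val hs \<phi> (v # v' # Cs) (\<alpha>(v' := A', v := A)))) else L ?X [])"
    if A: "A' \<in> vsort v'" "A \<in> vsort v" for A A'
  proof -
    let ?V = "val hs \<phi> (v # v' # Cs) (\<alpha>(v' := A', v := A))"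
    have finX: "finite (idx ?X)" using finite_idx_good[OF g] .
    have V: "?V \<subseteq> L ?X []" using val_subset_L[of hs \<phi> "v # v' # Cs" "\<alpha>(v' := A', v := A)"] unfolding X .
    have z: "0 \<in> ?V"
      using val_subspace[OF g2[OF A]] wf by (simp add: oper.subspace_0)
    have 1: "L ?X [] \<inter> ?V = ?V" "L ?X [] \<inter> perp ?X ?V = perp ?X ?V" "{0} \<inter> ?V = {0}"
      "{0} \<inter> L ?X [] = {0}"
      using V perp_subset_L z oper.subspace_0[OF subspace_L[of ?X "[]"]] by blast+
    have "val hs (Imp ?E \<phi>) (v # v' # Cs) (\<alpha>(v' := A', v := A)) =
      (let U = (if A' = dual_atom A then L ?X [] else {0}) in
        perp ?X (perp ?X (perp ?X U) \<inter> perp ?X (U \<inter> ?V)))"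
      using val_Imp[OF g2[OF A], of ?E \<phi>] wfE wf unfolding X E[OF A] by (simp add: Let_def)
    note imp = this
    show ?thesis
    proof (cases "A' = dual_atom A")
      case True
      show ?thesis using imp unfolding if_P[OF True] Let_def
        by (simp only: 1 perp_L[OF finX] perp_zero)
    next
      case False
      show ?thesis using imp unfolding if_not_P[OF False] Let_def
        by (simp only: 1 perp_L[OF finX] perp_zero)
    qed
  qed
  have "val hs (Forall v (Imp ?E \<phi>)) (v' # Cs) (\<alpha>(v' := A')) =
      {m \<in> L ?X []. \<forall>A\<in>vsort v. m \<in> val hs (Imp ?E \<phi>) (v # v' # Cs) (\<alpha>(v' := A', v := A))}"
    if "A' \<in> vsort v'" for A'
    using val_Forall[OF g1[OF that], of v "Imp ?E \<phi>"] v wfI unfolding X by simp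
  then have "val hs (ForallEq v v' \<phi>) Cs \<alpha> = {m \<in> L ?X []. \<forall>A'\<in>vsort v'. \<forall>A\<in>vsort v.
      m \<in> val hs (Imp ?E \<phi>) (v # v' # Cs) (\<alpha>(v' := A', v := A))}"
    using val_Forall[OF g v(2), of "Forall v (Imp ?E \<phi>)"] v'1 wfF unfolding ForallEq_def by auto
  also have "\<dots> = {m \<in> L ?X []. \<forall>A\<in>vsort v.
    m \<in> perp ?X (perp ?X (val hs \<phi> (v # v' # Cs) (\<alpha>(v' := dual_atom A, v := A))))}"
  proof (intro Collect_cong conj_cong refl)
    fix m assume m: "m \<in> L ?X []"
    have "dual_atom A \<in> vsort v'" if "A \<in> vsort v" for A using that v(4) by simp
    then show "(\<forall>A'\<in>vsort v'. \<forall>A\<in>vsort v. m \<in> val hs (Imp ?E \<phi>) (v # v' # Cs) (\<alpha>(v' := A', v := A))) \<longleftrightarrow>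
      (\<forall>A\<in>vsort v. m \<in> perp ?X (perp ?X (val hs \<phi> (v # v' # Cs) (\<alpha>(v' := dual_atom A, v := A)))))"
      using I m by (auto split: if_splits)
  qed
  finally show ?thesis .
qed

lemma val_ExistsEq:
  assumes g: "good_ctx hs Cs \<alpha>"
    and v: "v \<notin> set (Cs @ hs)" "v' \<notin> set (Cs @ hs)" "v \<noteq> v'" "vsort v' = dual (vsort v)"
      "\<And>A. A \<in> vsort v \<Longrightarrow> one_dim A"
    and wf: "wf_fm \<phi> (v # v' # Cs @ hs)"
  shows "val hs (ExistsEq v v' \<phi>) Cs \<alpha> = perp (map \<alpha> hs) (perp (map \<alpha> hs)
    (\<Union>A\<in>vsort v. val hs \<phi> (v # v' # Cs) (\<alpha>(v' := dual_atom A, v := A))))"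
proof -
  let ?X = "map \<alpha> hs"
  have v'1: "one_dim A'" if "A' \<in> vsort v'" for A'
    using that v(4) v(5)[of "dual_atom A'"] by (simp add: in_dual)
  have fin: "finite (basis A)" if "A \<in> vsort v \<or> A \<in> vsort v'" for A
    using that v(5) v'1 basis_one_dim by (metis finite.emptyI finite_insert)
  have wfF: "wf_fm (ForallEq v v' (Neg \<phi>)) (Cs @ hs)"
    using wf v fin rel_eq_in_brels by (auto simp: ForallEq_def Imp_def Or_def)
  have X: "map (\<alpha>(v' := A', v := A)) hs = ?X" for A A'
    using v by auto
  have g2: "good_ctx hs (v # v' # Cs) (\<alpha>(v' := A', v := A))" if "A' \<in> vsort v'" "A \<in> vsort v" for A A'
    by (rule good_ctx_Cons[OF good_ctx_Cons[OF g v(2)]]) (use v v'1 that in auto)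
  have "val hs (Neg \<phi>) (v # v' # Cs) (\<alpha>(v' := dual_atom A, v := A)) =
      perp ?X (val hs \<phi> (v # v' # Cs) (\<alpha>(v' := dual_atom A, v := A)))" if "A \<in> vsort v" for A
    using val_Neg[OF g2[of "dual_atom A" A], of \<phi>] that v(4) wf unfolding X by simp
  moreover have "perp ?X (perp ?X (perp ?X (val hs \<phi> (v # v' # Cs) (\<alpha>(v' := dual_atom A, v := A))))) =
      perp ?X (val hs \<phi> (v # v' # Cs) (\<alpha>(v' := dual_atom A, v := A)))" for A
    using perp_perp_perp[OF val_subset_L[of hs \<phi> "v # v' # Cs" "\<alpha>(v' := dual_atom A, v := A)"]] unfolding X .
  ultimately have "val hs (ForallEq v v' (Neg \<phi>)) Cs \<alpha> =
    perp ?X (\<Union>A\<in>vsort v. val hs \<phi> (v # v' # Cs) (\<alpha>(v' := dual_atom A, v := A)))"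
    using val_ForallEq[OF g v, of "Neg \<phi>"] wf by (simp add: perp_UN)
  then show ?thesis unfolding ExistsEq_def using val_Neg[OF g wfF] by simp
qed

lemma val_Exists:
  assumes g: "good_ctx hs Cs \<alpha>" and v: "v \<notin> set (Cs @ hs)" "\<And>A. A \<in> vsort v \<Longrightarrow> one_dim A"
    and wf: "wf_fm \<phi> (v # Cs @ hs)"
  shows "val hs (Exists v \<phi>) Cs \<alpha> = perp (map \<alpha> hs) (perp (map \<alpha> hs)
    (\<Union>A\<in>vsort v. val hs \<phi> (v # Cs) (\<alpha>(v := A))))"
proof -
  let ?X = "map \<alpha> hs"
  have wfF: "wf_fm (Forall v (Neg \<phi>)) (Cs @ hs)"
    using wf v by (auto simp: one_dim_def) force
  have X: "map (\<alpha>(v := A)) hs = ?X" for A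
    using v by auto
  have "val hs (Neg \<phi>) (v # Cs) (\<alpha>(v := A)) = perp ?X (val hs \<phi> (v # Cs) (\<alpha>(v := A)))"
    if "A \<in> vsort v" for A
    using val_Neg[OF good_ctx_Cons[OF g v that], of \<phi>] wf unfolding X by simp
  then have "val hs (Forall v (Neg \<phi>)) Cs \<alpha> = perp ?X (\<Union>A\<in>vsort v. val hs \<phi> (v # Cs) (\<alpha>(v := A)))"
    using val_Forall[OF g v, of "Neg \<phi>"] wf by (simp add: perp_UN)
  then show ?thesis unfolding Exists_def using val_Neg[OF g wfF] by simp
qed

section \<open>Sentences that quantify over a single nonclassical atom\<close>

lemma val_no_classical:
  assumes "good_ctx hs [] \<alpha>" "wf_fm \<phi> hs"
  shows "val hs \<phi> [] \<alpha> = cmpt (interp \<phi> hs) (map \<alpha> hs) []"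
proof -
  have "pad [] m = m" for m :: "'a oper" by (simp add: pad_def)
  moreover have "cmpt (interp \<phi> hs) (map \<alpha> hs) [] \<subseteq> L (map \<alpha> hs) []"
    using interp_in_brels[of hs \<phi>] good_ctxD(1)[OF assms(1)] assms(2) cmpt_brel_subset_L by fastforce
  ultimately show ?thesis by (auto simp: val_def)
qed

lemma holds_iff:
  assumes "wf_fm \<phi> []"
  shows "holds \<phi> \<longleftrightarrow> cmpt (interp \<phi> []) [] [] = L [] []"
proof -
  have "interp \<phi> [] = rel_top [] [] \<longleftrightarrow> cmpt (interp \<phi> []) = cmpt (rel_top [] [])"
    by (auto simp: rel_top_def intro!: brel.expand)
  also have "\<dots> \<longleftrightarrow> cmpt (interp \<phi> []) [] [] = L [] []"
  proof
    assume "cmpt (interp \<phi> []) [] [] = L [] []"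
    then have "cmpt (interp \<phi> []) X Y = cmpt (rel_top [] []) X Y" for X Y
      using interp_outside[of X "[]" Y \<phi>] by (cases "X = [] \<and> Y = []") (auto simp: rel_top_def mk_brel_def)
    then show "cmpt (interp \<phi> []) = cmpt (rel_top [] [])" by blast
  qed (simp add: rel_top_def)
  finally show ?thesis by (simp add: holds_def)
qed

definition unit_fun :: "'i list \<Rightarrow> 'i oper" where
  "unit_fun k = (\<lambda>u j. if u = [] \<and> j = k then 1 else 0)"

lemma unit_fun_in_L: "k \<in> idx X \<Longrightarrow> unit_fun k \<in> L X []"
  by (auto simp: L_iff unit_fun_def split: if_splits)

text \<open>
  A sentence has only scalars as functionals, and tensoring with a scalar is scaling.
\<close>

lemma holds_Forall:
  assumes wf: "wf_fm (Forall v \<phi>) []" and v: "vsort v = {H}" and \<alpha>: "\<alpha> v = H"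
  shows "holds (Forall v \<phi>) \<longleftrightarrow> L [H] [] \<subseteq> val [v] \<phi> [] \<alpha>"
proof -
  have ok: "ok_ctx [v]" using wf v by (simp add: ok_ctx_def)
  have g: "good_ctx [v] [] \<alpha>" using ok v \<alpha> by (simp add: good_ctx_def)
  have wf': "wf_fm \<phi> [v]" using wf by simp
  let ?C = "cmpt (interp \<phi> [v]) [H] []"
  have sub: "oper.subspace (cmpt (interp \<phi> [v]) X [])" for X
    using interp_in_brels[OF ok wf'] by (rule subspace_cmpt_brel)
  have tens: "op_tensor 1 0 t r = scale_op (r [] []) t" if t: "t \<in> L [H] []" and r: "r \<in> L [] []" for t r
  proof (intro ext)
    have t0: "u = [] \<and> length j = 1" if "t u j \<noteq> 0" for u j
      using t[unfolded L_iff, rule_format, OF that] by (auto simp: in_idx dest: list_all2_lengthD)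
    fix u j
    show "op_tensor 1 0 t r u j = scale_op (r [] []) t u j"
    proof (cases "u = [] \<and> length j = 1")
      case True
      then show ?thesis by (simp add: op_tensor_def scale_op_def)
    next
      case False
      then have "t u j = 0" using t0 by blast
      moreover have "t (take 0 u) (take 1 j) * r (drop 0 u) (drop 1 j) = 0"
      proof (cases "u = [] \<and> drop 1 j = []")
        case True
        then have "j = []" using False by (cases j) auto
        then show ?thesis using t0[of "take 0 u" "take 1 j"] by auto
      next
        case False
        then have "r (drop 0 u) (drop 1 j) = 0"
        proof (rule contrapos_np)
          assume "r (drop 0 u) (drop 1 j) \<noteq> 0"
          from r[unfolded L_iff, rule_format, OF this] show "u = [] \<and> drop 1 j = []"
            by (simp only: drop_0 idx_Nil singleton_iff)
        qed
        then show ?thesis by simp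
      qed
      ultimately show ?thesis by (simp add: op_tensor_def scale_op_def)
    qed
  qed
  have one: "unit_fun [] \<in> L [] []" "unit_fun [] [] [] = 1"
    by (simp_all add: unit_fun_in_L) (simp add: unit_fun_def)
  have "holds (Forall v \<phi>) \<longleftrightarrow> (\<forall>r\<in>L [] []. \<forall>t\<in>L [H] []. op_tensor 1 0 t r \<in> ?C)"
    unfolding holds_iff[OF wf] using cmpt_interp_Forall[OF sub, of "[]"] v by auto
  also have "\<dots> \<longleftrightarrow> L [H] [] \<subseteq> ?C"
  proof
    assume *: "\<forall>r\<in>L [] []. \<forall>t\<in>L [H] []. op_tensor 1 0 t r \<in> ?C"
    show "L [H] [] \<subseteq> ?C"
    proof
      fix t assume t: "t \<in> L [H] []"
      then show "t \<in> ?C" using * one tens[OF t one(1)] by (metis oper.scale_one)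
    qed
  next
    assume "L [H] [] \<subseteq> ?C"
    then show "\<forall>r\<in>L [] []. \<forall>t\<in>L [H] []. op_tensor 1 0 t r \<in> ?C"
      using tens oper.subspace_scale[OF sub] by auto
  qed
  finally show ?thesis using val_no_classical[OF g wf'] \<alpha> by simp
qed

text \<open>
  The two universal quantifiers ask for all product functionals, hence for all functionals, to lie in
  the implication, that is, for the space \<open>K\<close> of the proof to vanish.  Here \<open>K\<close> is the part of
  \<open>\<complex>\<epsilon>\<close> (\<open>\<epsilon>\<close> being evaluation) orthogonal to \<open>\<complex>\<epsilon> \<and> \<phi>\<close>, and
  since \<open>\<complex>\<epsilon>\<close> is one-dimensional, \<open>K\<close> vanishes exactly if \<open>\<phi>\<close> contains
  \<open>\<epsilon>\<close>.
\<close>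

lemma holds_ForallEq:
  assumes wf: "wf_fm \<phi> [v, v']" and v: "vsort v = {H}" "vsort v' = dual {H}" "v \<noteq> v'"
    and \<alpha>: "\<alpha> v = H" "\<alpha> v' = dual_atom H" and H: "finite (basis H)" "basis H \<noteq> {}"
  shows "holds (ForallEq v v' \<phi>) \<longleftrightarrow> evaluation H \<in> val [v, v'] \<phi> [] \<alpha>"
proof -
  let ?E = "Rel (rel_eq (vsort v)) [v, v']" and ?hs = "[v, v']" and ?X = "[H, dual_atom H]"
  have dH: "dual {H} = {dual_atom H}" by (simp add: dual_def)
  have wfE: "wf_fm ?E ?hs" using v rel_eq_in_brels by simp
  have wfI: "wf_fm (Imp ?E \<phi>) ?hs" using wf wfE by (simp add: Imp_def Or_def)
  have wfF: "wf_fm (Forall v (Imp ?E \<phi>)) [v']" using wfI v H by simp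
  have wfF2: "wf_fm (Forall v' (Forall v (Imp ?E \<phi>))) []" using wfF v(2) H dH by simp
  have ok: "ok_ctx ?hs" "ok_ctx [v']" using v H dH by (simp_all add: ok_ctx_def)
  have g: "good_ctx ?hs [] \<alpha>" "good_ctx [v'] [] \<alpha>" using ok v \<alpha> dH by (simp_all add: good_ctx_def)
  have X: "map \<alpha> ?hs = ?X" using \<alpha> by simp
  have finX: "finite (idx ?X)" using H by (intro finite_idx) auto
  have E: "val ?hs ?E [] \<alpha> = oper.span {evaluation H}"
  proof -
    have "(\<lambda>u y. if y \<in> idx ?X then m u (map (override \<eta> ?hs y) ?hs) else 0) = m"
      if "m \<in> L ?X []" for m \<eta>
    proof (intro ext)
      fix u y
      show "(if y \<in> idx ?X then m u (map (override \<eta> ?hs y) ?hs) else 0) = m u y"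
      proof (cases "y \<in> idx ?X")
        case True
        then have "length y = length ?hs" by (simp add: in_idx list_all2_lengthD)
        then have "map (override \<eta> ?hs y) ?hs = y" using v(3) by (intro map_override) auto
        then show ?thesis using True by simp
      qed (use that in \<open>auto simp: L_iff\<close>)
    qed
    moreover obtain l where "l \<in> basis H" using H by blast
    then have "\<exists>\<eta>. \<forall>v\<in>set ([] @ ?hs). \<eta> v \<in> basis (\<alpha> v)"
      using \<alpha> by (intro exI[of _ "\<lambda>_. l"]) auto
    moreover have "cmpt (rel_eq {H}) ?X [] = oper.span {evaluation H}"
      using cmpt_rel_eq[of H "{H}" "dual_atom H"] dH by simp
    moreover have "oper.span {evaluation H} \<subseteq> L ?X []"
      using evaluation_in_L by (intro oper.span_minimal subspace_L) auto
    ultimately show ?thesis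
      using val_Rel[OF g(1), of "rel_eq (vsort v)" ?hs] wfE unfolding X v by auto
  qed
  let ?V = "val ?hs \<phi> [] \<alpha>" and ?U = "oper.span {evaluation H}"
  define K where "K = perp ?X (perp ?X ?U) \<inter> perp ?X (?U \<inter> ?V)"
  have UL: "?U \<subseteq> L ?X []" using evaluation_in_L by (intro oper.span_minimal subspace_L) auto
  have I: "cmpt (interp (Imp ?E \<phi>) ?hs) ?X [] = perp ?X K"
    using val_no_classical[OF g(1) wfI] val_Imp[OF g(1), of ?E \<phi>] wfE wf
    unfolding X E K_def by (simp add: Let_def)
  have KL: "K \<subseteq> L ?X []" using perp_subset_L by (auto simp: K_def)
  have "holds (ForallEq v v' \<phi>) \<longleftrightarrow> L [dual_atom H] [] \<subseteq> val [v'] (Forall v (Imp ?E \<phi>)) [] \<alpha>"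
    unfolding ForallEq_def using holds_Forall[OF wfF2, of "dual_atom H" \<alpha>] v \<alpha> dH by simp
  also have "val [v'] (Forall v (Imp ?E \<phi>)) [] \<alpha> = {r \<in> L [dual_atom H] []. \<forall>t\<in>L [H] [].
      op_tensor 1 0 t r \<in> perp ?X K}"
  proof -
    have sub: "oper.subspace (cmpt (interp (Imp ?E \<phi>) [v, v']) X [])" for X
      using interp_in_brels[OF ok(1) wfI] by (rule subspace_cmpt_brel)
    have L1: "[dual_atom H] \<in> listset (map vsort [v'])" using v dH unfolding in_listset by simp
    show ?thesis
      using val_no_classical[OF g(2) wfF] cmpt_interp_Forall[OF sub L1] \<alpha> v(1) unfolding I[symmetric] by simp
  qed
  also have "L [dual_atom H] [] \<subseteq> \<dots> \<longleftrightarrow> K \<subseteq> {0}"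
  proof
    assume *: "L [dual_atom H] [] \<subseteq> {r \<in> L [dual_atom H] []. \<forall>t\<in>L [H] []. op_tensor 1 0 t r \<in> perp ?X K}"
    show "K \<subseteq> {0}"
    proof
      fix k assume k: "k \<in> K"
      have "k = 0"
      proof (rule functional_eqI[OF _ oper.subspace_0[OF subspace_L]])
        show "k \<in> L ?X []" using k KL by blast
        fix j assume j: "j \<in> idx ?X"
        then obtain e f where ef: "j = [e, f]" "e \<in> basis H" "f \<in> basis H"
          by (auto simp: in_idx list_all2_Cons2)
        have "unit_fun [f] \<in> L [dual_atom H] []" "unit_fun [e] \<in> L [H] []"
          using ef by (auto intro!: unit_fun_in_L simp: in_idx)
        then have "op_tensor 1 0 (unit_fun [e]) (unit_fun [f]) \<in> perp ?X K" using * by blast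
        then have "pairing ?X k (op_tensor 1 0 (unit_fun [e]) (unit_fun [f])) = 0"
          using k by (simp add: perp_def)
        moreover have "op_tensor 1 0 (unit_fun [e]) (unit_fun [f]) [] i = (if i = j then 1 else 0)" if "i \<in> idx ?X" for i
          using that ef by (auto simp: op_tensor_def unit_fun_def in_idx list_all2_Cons2)
        ultimately have "(\<Sum>i\<in>idx ?X. if i = j then cnj (k [] i) else 0) = 0"
          unfolding pairing_def by (simp add: if_distrib[of "(*) _"] cong: if_cong sum.cong)
        then show "k [] j = (0 :: 'a oper) [] j" using finX j by simp
      qed
      then show "k \<in> {0}" by simp
    qed
  next
    assume "K \<subseteq> {0}"
    then have P: "perp ?X K = L ?X []"
      using perp_zero[of ?X] perp_antimono[of K "{0}" ?X] perp_subset_L[of ?X K] by auto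
    have "op_tensor 1 0 t r \<in> L ?X []" if t: "t \<in> L [H] []" and r: "r \<in> L [dual_atom H] []" for t r
    proof -
      have "i = [] \<and> j \<in> idx ?X" if nz: "op_tensor 1 0 t r i j \<noteq> 0" for i j
      proof -
        have "i = []" "take 1 j \<in> idx [H]" "drop 1 j \<in> idx [dual_atom H]"
          using nz t r unfolding op_tensor_def L_iff by auto
        then show ?thesis using in_idx_append_iff[of j "[H]" "[dual_atom H]"] by simp
      qed
      then show ?thesis unfolding L_iff by blast
    qed
    then show "L [dual_atom H] [] \<subseteq> {r \<in> L [dual_atom H] []. \<forall>t\<in>L [H] []. op_tensor 1 0 t r \<in> perp ?X K}"
      unfolding P by blast
  qed
  also have "K \<subseteq> {0} \<longleftrightarrow> evaluation H \<in> ?V"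
  proof
    assume K: "K \<subseteq> {0}"
    show "evaluation H \<in> ?V"
    proof (rule ccontr)
      assume no: "evaluation H \<notin> ?V"
      have subV: "oper.subspace ?V" using val_subspace[OF g(1), of \<phi>] wf by simp
      have "?U \<inter> ?V \<subseteq> {0}"
      proof
        fix m assume m: "m \<in> ?U \<inter> ?V"
        then obtain c where c: "m = scale_op c (evaluation H)" by (auto simp: oper.span_singleton)
        have "c = 0"
        proof (rule ccontr)
          assume "c \<noteq> 0"
          then have "scale_op (1 / c) m = evaluation H" unfolding c by simp
          then show False using no m oper.subspace_scale[OF subV] by (metis IntD2)
        qed
        then show "m \<in> {0}" using c by simp
      qed
      then have "perp ?X (?U \<inter> ?V) = L ?X []"
        using perp_zero[of ?X] perp_antimono[of "?U \<inter> ?V" "{0}" ?X] perp_subset_L[of ?X "?U \<inter> ?V"] by auto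
      moreover have "evaluation H \<in> perp ?X (perp ?X ?U)"
        using subset_perp_perp[OF UL] by (auto intro: oper.span_base)
      ultimately have "evaluation H \<in> K" using evaluation_in_L by (auto simp: K_def)
      then have "evaluation H = 0" using K by blast
      moreover obtain e where "e \<in> basis H" using H by blast
      then have "evaluation H [] [e, e] = 1" by (simp add: evaluation_def)
      ultimately show False by simp
    qed
  next
    assume "evaluation H \<in> ?V"
    then have "?U \<subseteq> ?V" using val_subspace[OF g(1), of \<phi>] wf by (intro oper.span_minimal) auto
    then have "K = perp ?X ?U \<inter> perp ?X (perp ?X ?U)" by (auto simp: K_def Int_absorb2)
    then show "K \<subseteq> {0}" using inter_perp[OF finX perp_subset_L[of ?X ?U] order_refl] by simp
  qed
  finally show ?thesis .
qed

section \<open>Composites, hats and conjugates of relations\<close>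

lemma op_mult_in_L:
  assumes "s \<in> L Y Z" "r \<in> L X Y" shows "op_mult Y s r \<in> L X Z"
  unfolding L_def mem_Collect_eq
proof (intro allI impI)
  fix i k assume "op_mult Y s r i k \<noteq> 0"
  then obtain j where "s i j * r j k \<noteq> 0"
    unfolding op_mult_def by (rule sum.not_neutral_contains_not_neutral)
  then show "i \<in> idx Z \<and> k \<in> idx X" using assms unfolding L_def by auto
qed

lemma op_tensor_in_L:
  assumes "r \<in> L X Y" "s \<in> L X' Y'"
  shows "op_tensor (length X) (length Y) r s \<in> L (X @ X') (Y @ Y')"
  using assms unfolding L_def op_tensor_def by (auto simp: in_idx_append_iff)

lemma op_one_in_L: "op_one X \<in> L X X"
  by (auto simp: L_def op_one_def split: if_splits)

lemma rel_comp_in_brels: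
  assumes R: "R \<in> brels Xs Ys" and S: "S \<in> brels Ys Zs"
  shows "rel_comp S R \<in> brels Xs Zs"
  unfolding rel_comp_def brelsD(1)[OF R] brelsD(2)[OF S]
proof (intro mk_brel_in_brels oper.subspace_span oper.span_minimal subspace_L)
  have "op_mult Y s r \<in> L X Z" if "s \<in> cmpt S Y Z" "r \<in> cmpt R X Y" for X Y Z s r
    using subsetD[OF cmpt_brel_subset_L[OF S] that(1)] subsetD[OF cmpt_brel_subset_L[OF R] that(2)]
    by (rule op_mult_in_L)
  then show "{op_mult Y s r |Y s r. Y \<in> listset (tgt R) \<and> s \<in> cmpt S Y Z \<and> r \<in> cmpt R X Y} \<subseteq> L X Z"
    for X Z by blast
qed

lemma append_in_listsetE:
  assumes "X \<in> listset (Xs @ Ys)"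
  obtains X1 X2 where "X = X1 @ X2" "X1 \<in> listset Xs" "X2 \<in> listset Ys" "length X1 = length Xs"
  using assms unfolding in_listset by (auto simp: list_all2_append2 list_all2_lengthD)

lemma length_listset: "X \<in> listset Xs \<Longrightarrow> length X = length Xs"
  by (simp add: in_listset list_all2_lengthD)

lemma rel_times_in_brels:
  assumes R: "R \<in> brels Xs Ys" and S: "S \<in> brels Xs' Ys'"
  shows "rel_times R S \<in> brels (Xs @ Xs') (Ys @ Ys')"
  unfolding rel_times_def Let_def brelsD(1,2)[OF R] brelsD(1,2)[OF S]
proof (intro mk_brel_in_brels oper.subspace_span oper.span_minimal subspace_L)
  fix X Y assume "X \<in> listset (Xs @ Xs')" "Y \<in> listset (Ys @ Ys')"
  then obtain X1 X2 Y1 Y2 where XY: "X = X1 @ X2" "length X1 = length Xs" "Y = Y1 @ Y2" "length Y1 = length Ys"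
    by (elim append_in_listsetE) blast
  have "op_tensor (length X1) (length Y1) r s \<in> L (X1 @ X2) (Y1 @ Y2)"
    if "r \<in> cmpt R X1 Y1" "s \<in> cmpt S X2 Y2" for r s
    using that cmpt_brel_subset_L[OF R] cmpt_brel_subset_L[OF S] by (intro op_tensor_in_L) blast+
  then show "{op_tensor (length Xs) (length Ys) r s |r s.
      r \<in> cmpt R (take (length Xs) X) (take (length Ys) Y) \<and>
      s \<in> cmpt S (drop (length Xs) X) (drop (length Ys) Y)} \<subseteq> L X Y"
    using XY by auto
qed

lemma rel_id_in_brels: "rel_id Xs \<in> brels Xs Xs"
  unfolding rel_id_def
proof (rule mk_brel_in_brels)
  fix X Y :: "'a atom list"
  show "oper.subspace (if X = Y then oper.span {op_one X} else {0})"
    by (simp add: oper.subspace_single_0)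
  have "oper.span {op_one X} \<subseteq> L X X"
    using op_one_in_L by (intro oper.span_minimal subspace_L) simp
  then show "(if X = Y then oper.span {op_one X} else {0}) \<subseteq> L X Y"
    using oper.subspace_0[OF subspace_L[of X Y]] by (cases "X = Y") simp_all
qed

lemma op_mult_add_right: "op_mult Y s (r + r') = op_mult Y s r + op_mult Y s r'"
  and op_mult_scale_left: "op_mult Y (scale_op c s) r = scale_op c (op_mult Y s r)"
  and op_mult_scale_right: "op_mult Y s (scale_op c r) = scale_op c (op_mult Y s r)"
  and op_mult_zero_left: "op_mult Y 0 r = 0"
  and op_mult_zero_right: "op_mult Y s 0 = 0"
  by (simp_all add: op_mult_def scale_op_def plus_fun_def zero_fun_def fun_eq_iff
      algebra_simps sum.distrib sum_distrib_left)

lemma op_tensor_scale_right: "op_tensor m n r (scale_op c s) = scale_op c (op_tensor m n r s)"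
  and op_tensor_zero_right: "op_tensor m n r 0 = 0"
  by (simp_all add: op_tensor_def scale_op_def zero_fun_def fun_eq_iff algebra_simps)

text \<open>
  The functional on \<open>X \<otimes> Y*\<close> obtained from an operator from \<open>X\<close> to \<open>Y\<close>, where
  \<open>n\<close> is the number of factors of \<open>X\<close>: the target index of the matrix becomes the last
  source index.
\<close>

definition bend :: "nat \<Rightarrow> 'i oper \<Rightarrow> 'i oper" where
  "bend n r = (\<lambda>u k. if u = [] then r (drop n k) (take n k) else 0)"

text \<open>
  The form of the assumption on scaling admits conjugate-linear maps, such as taking adjoints.
\<close>

lemma subspace_image:
  assumes U: "oper.subspace U" and add: "\<And>f g. h (f + g) = h f + h g"
    and scale: "\<And>c. \<exists>d. \<forall>f. h (scale_op d f) = scale_op c (h f)"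
  shows "oper.subspace (h ` U)"
  unfolding oper.subspace_def
proof (intro conjI ballI allI)
  have scaled: "scale_op c (h f) \<in> h ` U" if f: "f \<in> U" for c f
  proof -
    obtain d where "\<forall>f. h (scale_op d f) = scale_op c (h f)" using scale by blast
    then have "scale_op c (h f) = h (scale_op d f)" by simp
    then show ?thesis using oper.subspace_scale[OF U f] by (rule image_eqI)
  qed
  show "0 \<in> h ` U" using scaled[OF oper.subspace_0[OF U], of 0] by simp
  fix x assume "x \<in> h ` U"
  then obtain f where f: "x = h f" "f \<in> U" by (rule imageE)
  show "scale_op c x \<in> h ` U" for c unfolding f(1) by (rule scaled[OF f(2)])
  fix y assume "y \<in> h ` U"
  then obtain g where g: "y = h g" "g \<in> U" by (rule imageE)
  show "x + y \<in> h ` U"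
    unfolding f(1) g(1) add[symmetric] using oper.subspace_add[OF U f(2) g(2)] by (rule imageI)
qed

lemma subspace_bend: "oper.subspace U \<Longrightarrow> oper.subspace (bend n ` U)"
  by (rule subspace_image) (auto simp: bend_def plus_fun_def scale_op_def fun_eq_iff)

text \<open>
  The snake that defines the hat of a relation: evaluating the output of \<open>r\<close> against the new
  variable moves the target index of \<open>r\<close> to the source.
\<close>

lemma evaluation_mult:
  assumes r: "r \<in> L X [Y]" and fin: "finite (basis Y)"
  shows "op_mult [Y, dual_atom Y] (evaluation Y)
    (op_tensor (length X) 1 r (op_one [dual_atom Y])) = bend (length X) r"
proof (intro ext)
  fix u k
  let ?n = "length X"
  have finI: "finite (idx [Y, dual_atom Y])" using fin by (intro finite_idx) auto
  have eq: "op_mult [Y, dual_atom Y] (evaluation Y) (op_tensor ?n 1 r (op_one [dual_atom Y])) u k =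
    (\<Sum>j\<in>idx [Y, dual_atom Y]. evaluation Y u j * (r (take 1 j) (take ?n k) * op_one [dual_atom Y] (drop 1 j) (drop ?n k)))"
    by (simp add: op_mult_def op_tensor_def)
  show "op_mult [Y, dual_atom Y] (evaluation Y) (op_tensor ?n 1 r (op_one [dual_atom Y])) u k = bend ?n r u k"
  proof (cases "u = [] \<and> drop ?n k \<in> idx [Y]")
    case True
    then obtain e where e: "drop ?n k = [e]" "e \<in> basis Y" by (auto simp: in_idx list_all2_Cons2)
    have "(\<Sum>j\<in>idx [Y, dual_atom Y]. evaluation Y u j * (r (take 1 j) (take ?n k) * op_one [dual_atom Y] (drop 1 j) (drop ?n k))) =
       (\<Sum>j\<in>idx [Y, dual_atom Y]. if j = [e, e] then r [e] (take ?n k) else 0)"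
      by (rule sum.cong) (use True e in \<open>auto simp: evaluation_def op_one_def in_idx list_all2_Cons2\<close>)
    also have "\<dots> = r [e] (take ?n k)" using finI e by (simp add: in_idx)
    finally show ?thesis unfolding eq using True e by (simp add: bend_def)
  next
    case False
    have "evaluation Y u j * (r (take 1 j) (take ?n k) * op_one [dual_atom Y] (drop 1 j) (drop ?n k)) = 0" for j
    proof (cases "u = []")
      case True
      then have "drop ?n k \<notin> idx [dual_atom Y]" using False by (simp add: in_idx list_all2_Cons2)
      then have "op_one [dual_atom Y] (drop 1 j) (drop ?n k) = 0" by (auto simp: op_one_def)
      then show ?thesis by simp
    qed (simp add: evaluation_def)
    moreover have "bend ?n r u k = 0"
      using False r unfolding bend_def L_def by auto
    ultimately show ?thesis unfolding eq by (simp only: sum.neutral_const)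
  qed
qed

lemma rel_hat_in_brels:
  assumes "B \<in> brels Xs [Q]"
  shows "rel_hat B \<in> brels (Xs @ [dual Q]) []"
  using rel_comp_in_brels[OF rel_times_in_brels[OF assms rel_id_in_brels[of "[dual Q]"]]] rel_eq_in_brels[of Q]
  by (simp add: rel_hat_def brelsD(2)[OF assms])

text \<open>
  In the composite \<open>E \<circ> (B \<times> I)\<close>, the identity fixes the second intermediate atom at
  \<open>Y*\<close> and equality then fixes the first at \<open>Y\<close>.  So a single pair of intermediate atoms
  contributes, and it contributes the bent operators.
\<close>

lemma cmpt_rel_hat:
  assumes B: "B \<in> brels Xs [Q]" and X: "X \<in> listset Xs" and Y: "Y \<in> Q" "finite (basis Y)"
  shows "cmpt (rel_hat B) (X @ [dual_atom Y]) [] = bend (length X) ` cmpt B X [Y]"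
proof -
  let ?n = "length X" and ?T = "rel_times B (rel_id [dual Q])" and ?dY = "dual_atom Y"
  have n: "length Xs = ?n" using length_listset[OF X] by simp
  have T: "?T \<in> brels (Xs @ [dual Q]) ([Q] @ [dual Q])"
    using rel_times_in_brels[OF B rel_id_in_brels] .
  have XY: "X @ [?dY] \<in> listset (Xs @ [dual Q])"
    using X Y n unfolding in_listset by (simp add: list_all2_append)
  have id: "cmpt (rel_id [dual Q]) [?dY] [Y2] = (if Y2 = ?dY then oper.span {op_one [?dY]} else {0})"
    if "Y2 \<in> dual Q" for Y2
  proof -
    have "[?dY] \<in> listset [dual Q]" "[Y2] \<in> listset [dual Q]"
      using that Y unfolding in_listset by simp_all
    then show ?thesis by (simp add: rel_id_def del: listset.simps)
  qed
  have cT: "cmpt ?T (X @ [?dY]) [Y1, Y2] =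
      oper.span {op_tensor ?n 1 r s |r s. r \<in> cmpt B X [Y1] \<and> s \<in> cmpt (rel_id [dual Q]) [?dY] [Y2]}"
    if "Y1 \<in> Q" "Y2 \<in> dual Q" for Y1 Y2
  proof -
    have "[Y1, Y2] \<in> listset ([Q] @ [dual Q])" using that unfolding in_listset by simp
    then show ?thesis
      unfolding rel_times_def Let_def brelsD(1,2)[OF B] brelsD(1,2)[OF rel_id_in_brels]
      by (subst cmpt_mk_brel[OF XY]) (simp_all add: n)
  qed
  have cH: "cmpt (rel_hat B) (X @ [?dY]) [] = oper.span {op_mult Z s r |Z s r.
      Z \<in> listset [Q, dual Q] \<and> s \<in> cmpt (rel_eq Q) Z [] \<and> r \<in> cmpt ?T (X @ [?dY]) Z}"
    unfolding rel_hat_def Let_def brelsD(2)[OF B] list.sel rel_comp_def brelsD(1,2)[OF T] brelsD(2)[OF rel_eq_in_brels]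
    by (subst cmpt_mk_brel[OF XY]) simp_all
  have W: "oper.subspace (bend ?n ` cmpt B X [Y])"
    using subspace_cmpt_brel[OF B] by (rule subspace_bend)
  show ?thesis unfolding cH
  proof (intro equalityI oper.span_minimal W)
    show "{op_mult Z s r |Z s r. Z \<in> listset [Q, dual Q] \<and> s \<in> cmpt (rel_eq Q) Z [] \<and>
        r \<in> cmpt ?T (X @ [?dY]) Z} \<subseteq> bend ?n ` cmpt B X [Y]"
    proof clarify
      fix Z s t assume Z: "Z \<in> listset [Q, dual Q]" and s: "s \<in> cmpt (rel_eq Q) Z []"
        and t: "t \<in> cmpt ?T (X @ [?dY]) Z"
      obtain Y1 Y2 where Z12: "Z = [Y1, Y2]" "Y1 \<in> Q" "Y2 \<in> dual Q"
        using Z unfolding in_listset by (auto simp: list_all2_Cons2)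
      have sub: "oper.subspace {t. op_mult Z s t \<in> bend ?n ` cmpt B X [Y]}"
        using W unfolding oper.subspace_def mem_Collect_eq
        by (simp only: op_mult_add_right op_mult_scale_right op_mult_zero_right) blast
      have gen: "op_mult Z s (op_tensor ?n 1 r s') \<in> bend ?n ` cmpt B X [Y]"
        if r: "r \<in> cmpt B X [Y1]" and s': "s' \<in> cmpt (rel_id [dual Q]) [?dY] [Y2]" for r s'
      proof (cases "Y2 = dual_atom Y1 \<and> Y2 = ?dY")
        case True
        then have Y1: "Y1 = Y" by auto
        obtain c where c: "s = scale_op c (evaluation Y)"
          using s cmpt_rel_eq[OF Z12(2,3)] True Y1 unfolding Z12(1) by (auto simp: oper.span_singleton)
        have "s' \<in> range (\<lambda>k. scale_op k (op_one [?dY]))"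
          using s' id[OF Z12(3)] Y1 True by (simp add: oper.span_singleton)
        then obtain c' where c': "s' = scale_op c' (op_one [?dY])" by blast
        have rL: "r \<in> L X [Y]" using r Y1 cmpt_brel_subset_L[OF B] by blast
        have "op_mult Z s (op_tensor ?n 1 r s') = scale_op (c * c') (bend ?n r)"
          unfolding c c' op_tensor_scale_right op_mult_scale_right op_mult_scale_left Z12(1)
          using evaluation_mult[OF rL Y(2)] True Y1 by (simp add: mult.commute)
        then show ?thesis using oper.subspace_scale[OF W] r Y1 by auto
      next
        case False
        then have "s = 0 \<or> s' = 0"
          using s cmpt_rel_eq[OF Z12(2,3)] s' id[OF Z12(3)] unfolding Z12(1) by (auto split: if_splits)
        then have "op_mult Z s (op_tensor ?n 1 r s') = 0"
          by (auto simp: op_tensor_zero_right op_mult_zero_right op_mult_zero_left)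
        then show ?thesis using oper.subspace_0[OF W] by simp
      qed
      have "oper.span {op_tensor ?n 1 r s |r s. r \<in> cmpt B X [Y1] \<and> s \<in> cmpt (rel_id [dual Q]) [?dY] [Y2]}
         \<subseteq> {t. op_mult Z s t \<in> bend ?n ` cmpt B X [Y]}"
        by (rule oper.span_minimal[OF _ sub]) (use gen in auto)
      then show "op_mult Z s t \<in> bend ?n ` cmpt B X [Y]"
        using t cT[OF Z12(2,3)] Z12(1) by blast
    qed
    show "bend ?n ` cmpt B X [Y] \<subseteq> oper.span {op_mult Z s r |Z s r. Z \<in> listset [Q, dual Q] \<and>
        s \<in> cmpt (rel_eq Q) Z [] \<and> r \<in> cmpt ?T (X @ [?dY]) Z}"
    proof clarify
      fix r assume r: "r \<in> cmpt B X [Y]"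
      have dY: "?dY \<in> dual Q" using Y by simp
      have rL: "r \<in> L X [Y]" using r cmpt_brel_subset_L[OF B] by blast
      have "op_tensor ?n 1 r (op_one [?dY]) \<in> cmpt ?T (X @ [?dY]) [Y, ?dY]"
        unfolding cT[OF Y(1) dY] id[OF dY] using r by (auto intro!: oper.span_base)
      moreover have "evaluation Y \<in> cmpt (rel_eq Q) [Y, ?dY] []"
        unfolding cmpt_rel_eq[OF Y(1) dY] by (simp add: oper.span_base)
      moreover have "[Y, ?dY] \<in> listset [Q, dual Q]" using Y unfolding in_listset by simp
      ultimately have "op_mult [Y, ?dY] (evaluation Y) (op_tensor ?n 1 r (op_one [?dY])) \<in>
          {op_mult Z s r |Z s r. Z \<in> listset [Q, dual Q] \<and>
        s \<in> cmpt (rel_eq Q) Z [] \<and> r \<in> cmpt ?T (X @ [?dY]) Z}" by blast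
      then show "bend ?n r \<in> oper.span {op_mult Z s r |Z s r. Z \<in> listset [Q, dual Q] \<and>
        s \<in> cmpt (rel_eq Q) Z [] \<and> r \<in> cmpt ?T (X @ [?dY]) Z}"
        unfolding evaluation_mult[OF rL Y(2)] by (rule oper.span_base)
    qed
  qed
qed

lemma dual_in_listset: "map dual_atom X \<in> listset Xs \<longleftrightarrow> X \<in> listset (map dual Xs)"
  by (simp add: in_listset list.rel_map in_dual)

lemma idx_dual [simp]: "idx (map dual_atom X) = idx X"
  by (simp add: idx_def comp_def)

lemma op_conj_eq: "op_conj r = (\<lambda>i j. cnj (r i j))"
  by (simp add: op_conj_def op_transpose_def op_adj_def)

lemma subspace_op_conj:
  assumes "oper.subspace U" shows "oper.subspace (op_conj ` U)"
proof (rule subspace_image[OF assms])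
  show "\<exists>d. \<forall>f::'a oper. op_conj (scale_op d f) = scale_op c (op_conj f)" for c
    by (rule exI[of _ "cnj c"]) (simp add: op_conj_eq scale_op_def)
qed (simp add: op_conj_eq plus_fun_def)

lemma subspace_op_adj:
  assumes "oper.subspace U" shows "oper.subspace (op_adj ` U)"
proof (rule subspace_image[OF assms])
  show "\<exists>d. \<forall>f::'a oper. op_adj (scale_op d f) = scale_op c (op_adj f)" for c
    by (rule exI[of _ "cnj c"]) (simp add: op_adj_def scale_op_def)
qed (simp add: op_adj_def plus_fun_def)

lemma op_adj_in_L: "r \<in> L X Y \<Longrightarrow> op_adj r \<in> L Y X"
  by (auto simp: L_def op_adj_def)

lemma op_conj_in_L: "r \<in> L X Y \<Longrightarrow> op_conj r \<in> L X Y"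
  by (simp add: L_def op_conj_eq)

lemma L_dual: "L (map dual_atom X) (map dual_atom Y) = L X Y"
  by (simp add: L_def)

lemma rel_conjugate_in_brels:
  assumes "R \<in> brels Xs Ys"
  shows "rel_conjugate R \<in> brels (map dual Xs) (map dual Ys)"
  unfolding rel_conjugate_def brelsD(1,2)[OF assms]
proof (rule mk_brel_in_brels)
  fix X Y :: "'a atom list"
  show "oper.subspace (op_conj ` cmpt R (map dual_atom X) (map dual_atom Y))"
    by (rule subspace_op_conj[OF subspace_cmpt_brel[OF assms]])
  show "op_conj ` cmpt R (map dual_atom X) (map dual_atom Y) \<subseteq> L X Y"
    using cmpt_brel_subset_L[OF assms, of "map dual_atom X" "map dual_atom Y"] op_conj_in_L
    unfolding L_dual by blast
qed

lemma cmpt_rel_conjugate: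
  assumes "R \<in> brels Xs Ys" "X \<in> listset Xs" "Y \<in> listset Ys"
  shows "cmpt (rel_conjugate R) (map dual_atom X) (map dual_atom Y) = op_conj ` cmpt R X Y"
proof -
  have "map dual_atom X \<in> listset (map dual Xs)" "map dual_atom Y \<in> listset (map dual Ys)"
    unfolding dual_in_listset[symmetric] using assms by (simp_all add: comp_def)
  then show ?thesis
    unfolding rel_conjugate_def brelsD(1,2)[OF assms(1)] by (simp add: comp_def)
qed

section \<open>Operators and their matrices\<close>

lemma cinner_zero_right: "cinner x (0::'h::complex_inner) = 0"
  using cinner_scaleC_right[of x 0 0] by simp

lemma cinner_sum_right: "cinner x (\<Sum>i\<in>I. f i) = (\<Sum>i\<in>I. cinner x (f i :: 'h::complex_inner))"
  by (induction I rule: infinite_finite_induct) (simp_all add: cinner_zero_right cinner_add_right)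

context
  fixes E :: "'h::complex_inner set"
  assumes onb: "orthonormal_basis E"
begin

lemma onb_finite: "finite E" and onb_inner: "e \<in> E \<Longrightarrow> f \<in> E \<Longrightarrow> cinner e f = (if e = f then 1 else 0)"
  using onb by (auto simp: orthonormal_basis_def)

lemma onb_expand: "(\<Sum>e\<in>E. scaleC (cinner e x) e) = x"
proof -
  have "x \<in> hilb.span E" using onb by (simp add: orthonormal_basis_def)
  then obtain u where u: "x = (\<Sum>f\<in>E. scaleC (u f) f)"
    unfolding hilb.span_finite[OF onb_finite] by auto
  have "cinner e x = u e" if "e \<in> E" for e
    unfolding u cinner_sum_right cinner_scaleC_right
    using that onb_finite by (simp add: onb_inner if_distrib[of "(*) _"] cong: if_cong sum.cong)
  then show ?thesis using u by simp
qed

lemma cinner_expand: "cinner x y = (\<Sum>e\<in>E. cinner x e * cinner e y)"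
  by (subst onb_expand[of y, symmetric]) (simp add: cinner_sum_right cinner_scaleC_right mult.commute)

lemma linear_expand:
  assumes "Vector_Spaces.linear scaleC scaleC (p :: 'h \<Rightarrow> 'h)"
  shows "p x = (\<Sum>f\<in>E. scaleC (cinner f x) (p f))"
proof -
  interpret p: Vector_Spaces.linear scaleC scaleC p by (rule assms)
  show ?thesis by (subst onb_expand[of x, symmetric]) (simp add: p.sum p.scale)
qed

lemma cinner_apply_expand:
  assumes "Vector_Spaces.linear scaleC scaleC (p :: 'h \<Rightarrow> 'h)"
  shows "cinner e (p x) = (\<Sum>f\<in>E. cinner e (p f) * cinner f x)"
  by (subst linear_expand[OF assms]) (simp add: cinner_sum_right cinner_scaleC_right mult.commute)

lemma vector_eqI:
  assumes "\<And>e. e \<in> E \<Longrightarrow> cinner e x = cinner e y" shows "x = y"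
proof -
  have "x = (\<Sum>e\<in>E. scaleC (cinner e x) e)" by (simp add: onb_expand)
  also have "\<dots> = (\<Sum>e\<in>E. scaleC (cinner e y) e)" by (intro sum.cong refl) (simp add: assms)
  also have "\<dots> = y" by (rule onb_expand)
  finally show ?thesis .
qed

lemma linear_eqI:
  assumes "Vector_Spaces.linear scaleC scaleC (p :: 'h \<Rightarrow> 'h)" "Vector_Spaces.linear scaleC scaleC q"
    and "\<And>e f. e \<in> E \<Longrightarrow> f \<in> E \<Longrightarrow> cinner e (p f) = cinner e (q f)"
  shows "p = q"
proof
  fix x
  show "p x = q x"
  proof (rule vector_eqI)
    fix e assume "e \<in> E"
    then have "(\<Sum>f\<in>E. cinner e (p f) * cinner f x) = (\<Sum>f\<in>E. cinner e (q f) * cinner f x)"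
      by (intro sum.cong refl) (simp only: assms(3))
    then show "cinner e (p x) = cinner e (q x)"
      unfolding cinner_apply_expand[OF assms(1), of e x] cinner_apply_expand[OF assms(2), of e x] .
  qed
qed

lemma projection_mat:
  assumes "p \<in> projections" "e \<in> E" "f \<in> E"
  shows "(\<Sum>g\<in>E. cinner e (p g) * cinner g (p f)) = cinner e (p f)"
    and "cinner f (p e) = cnj (cinner e (p f))"
proof -
  have p: "Vector_Spaces.linear scaleC scaleC p" "p (p f) = p f" "cinner (p x) y = cinner x (p y)" for x y
    using assms(1) by (auto simp: projections_def fun_eq_iff)
  show "(\<Sum>g\<in>E. cinner e (p g) * cinner g (p f)) = cinner e (p f)"
    using cinner_apply_expand[OF p(1), of e "p f"] p(2) by simp
  show "cinner f (p e) = cnj (cinner e (p f))"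
    using p(3)[of f e] cinner_commute[of "p f" e] by simp
qed

text \<open>
  The operator with matrix \<open>M\<close> in the basis \<open>E\<close>.
\<close>

definition op_mat :: "('h \<Rightarrow> 'h \<Rightarrow> complex) \<Rightarrow> 'h \<Rightarrow> 'h" where
  "op_mat M x = (\<Sum>e\<in>E. scaleC (\<Sum>f\<in>E. M e f * cinner f x) e)"

lemma linear_op_mat: "Vector_Spaces.linear scaleC scaleC (op_mat M)"
proof
  fix x y c
  show "op_mat M (x + y) = op_mat M x + op_mat M y"
    by (simp add: op_mat_def cinner_add_right algebra_simps sum.distrib scaleC_add_left)
  show "op_mat M (scaleC c x) = scaleC c (op_mat M x)"
    by (simp add: op_mat_def hilb.scale_sum_right scaleC_scaleC cinner_scaleC_right sum_distrib_left algebra_simps)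
qed

lemma cinner_op_mat:
  assumes "e \<in> E" shows "cinner e (op_mat M x) = (\<Sum>f\<in>E. M e f * cinner f x)"
proof -
  have "cinner e (op_mat M x) = (\<Sum>e'\<in>E. if e' = e then \<Sum>f\<in>E. M e f * cinner f x else 0)"
    unfolding op_mat_def cinner_sum_right cinner_scaleC_right
    by (rule sum.cong) (use assms in \<open>auto simp: onb_inner\<close>)
  then show ?thesis using assms onb_finite by simp
qed

lemma mat_op_mat:
  assumes "e \<in> E" "f \<in> E" shows "cinner e (op_mat M f) = M e f"
  unfolding cinner_op_mat[OF assms(1)]
  using assms onb_finite by (simp add: onb_inner if_distrib[of "(*) _"] cong: if_cong sum.cong)

lemma op_mat_projection:
  assumes idem: "\<And>e f. e \<in> E \<Longrightarrow> f \<in> E \<Longrightarrow> (\<Sum>g\<in>E. M e g * M g f) = M e f"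
    and herm: "\<And>e f. e \<in> E \<Longrightarrow> f \<in> E \<Longrightarrow> M f e = cnj (M e f)"
  shows "op_mat M \<in> projections"
  unfolding projections_def mem_Collect_eq
proof (intro conjI allI linear_op_mat)
  have "op_mat M (op_mat M x) = op_mat M x" for x
  proof (rule vector_eqI)
    fix e assume e: "e \<in> E"
    have "cinner e (op_mat M (op_mat M x)) = (\<Sum>g\<in>E. \<Sum>f\<in>E. M e g * (M g f * cinner f x))"
      by (simp add: cinner_op_mat e sum_distrib_left)
    also have "\<dots> = (\<Sum>f\<in>E. (\<Sum>g\<in>E. M e g * M g f) * cinner f x)"
      by (subst sum.swap) (simp add: sum_distrib_right mult.assoc)
    also have "\<dots> = cinner e (op_mat M x)"
      by (simp add: cinner_op_mat e idem)
    finally show "cinner e (op_mat M (op_mat M x)) = cinner e (op_mat M x)" .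
  qed
  then show "op_mat M \<circ> op_mat M = op_mat M" by (simp add: fun_eq_iff)
  fix x y
  have "cinner (op_mat M x) y = cnj (\<Sum>e\<in>E. \<Sum>f\<in>E. cinner y e * (M e f * cinner f x))"
    by (subst cinner_commute, subst cinner_expand) (simp add: cinner_op_mat sum_distrib_left)
  also have "\<dots> = (\<Sum>e\<in>E. \<Sum>f\<in>E. cinner e y * (M f e * cinner x f))"
    unfolding cnj_sum
  proof (intro sum.cong refl)
    fix e f assume "e \<in> E" "f \<in> E"
    then show "cnj (cinner y e * (M e f * cinner f x)) = cinner e y * (M f e * cinner x f)"
      using herm[of e f] cinner_commute[of e y] cinner_commute[of x f] by simp
  qed
  also have "\<dots> = (\<Sum>f\<in>E. cinner x f * (\<Sum>e\<in>E. M f e * cinner e y))"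
    by (subst sum.swap) (simp add: sum_distrib_left algebra_simps)
  also have "\<dots> = cinner x (op_mat M y)"
    by (subst (2) cinner_expand) (simp add: cinner_op_mat)
  finally show "cinner (op_mat M x) y = cinner x (op_mat M y)" .
qed

end

section \<open>Relations from a Hilbert space and a classical set to a classical set\<close>

lemma brel_eqI:
  assumes "R \<in> brels Xs Ys" "S \<in> brels Xs Ys"
    and "\<And>X Y. X \<in> listset Xs \<Longrightarrow> Y \<in> listset Ys \<Longrightarrow> cmpt R X Y = cmpt S X Y"
  shows "R = S"
proof (rule brel.expand, intro conjI ext)
  show "src R = src S" "tgt R = tgt S"
    using brelsD(1,2)[OF assms(1)] brelsD(1,2)[OF assms(2)] by simp_all
  show "cmpt R X Y = cmpt S X Y" for X Y
    using brelsD(5)[OF assms(1)] brelsD(5)[OF assms(2)] assms(3)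
    by (cases "X \<in> listset Xs \<and> Y \<in> listset Ys") auto
qed

lemma basis_point [simp]: "basis (point a) = {Inr a}"
  by (simp add: point_def)

lemma one_dim_point [simp]: "one_dim (point a)"
  by (simp add: one_dim_def)

lemma lab_point [simp]: "lab (point a) = Inr a"
  by (simp add: lab_def)

lemma point_inject [simp]: "point a = point b \<longleftrightarrow> a = b"
  by (simp add: point_def)

lemma point_in_classical [simp]: "point a \<in> classical A \<longleftrightarrow> a \<in> A"
  by (auto simp: classical_def)

lemma basis_hspace [simp]: "basis (hspace E) = Inl ` E"
  by (simp add: hspace_def)

lemma idx_point: "idx [point b] = {[Inr b]}"
  by (auto simp: in_idx list_all2_Cons2)

lemma idx_hspace_point: "idx [hspace E, point a] = (\<lambda>e. [Inl e, Inr a]) ` E"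
  by (auto simp: in_idx list_all2_Cons2)

lemma sum_idx_hspace_point: "(\<Sum>j\<in>idx [hspace E, point a]. g j) = (\<Sum>e\<in>E. g [Inl e, Inr a])"
  unfolding idx_hspace_point by (simp add: sum.reindex inj_on_def)

text \<open>
  The operator from \<open>H \<otimes> \<complex>\<^sub>a\<close> to \<open>\<complex>\<^sub>b\<close> that is given by the row
  vector \<open>w\<close>.
\<close>

definition unrow :: "'h set \<Rightarrow> 'v \<Rightarrow> 'v \<Rightarrow> ('h \<Rightarrow> complex) \<Rightarrow> ('h, 'v) label oper" where
  "unrow E a b w = (\<lambda>i j. \<Sum>e\<in>E. if i = [Inr b] \<and> j = [Inl e, Inr a] then w e else 0)"

lemma L_row_eqI:
  assumes "r \<in> L [hspace E, point a] [point b]" "s \<in> L [hspace E, point a] [point b]"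
    and "\<And>e. e \<in> E \<Longrightarrow> r [Inr b] [Inl e, Inr a] = s [Inr b] [Inl e, Inr a]"
  shows "r = s"
proof (intro ext)
  fix i j
  show "r i j = s i j"
  proof (cases "i \<in> idx [point b] \<and> j \<in> idx [hspace E, point a]")
    case True
    then show ?thesis unfolding idx_point idx_hspace_point using assms(3) by auto
  next
    case False
    have "r i j = 0"
      using False assms(1)[unfolded L_def mem_Collect_eq, rule_format, of i j] by argo
    moreover have "s i j = 0"
      using False assms(2)[unfolded L_def mem_Collect_eq, rule_format, of i j] by argo
    ultimately show ?thesis by simp
  qed
qed

lemma unrow_in_L:
  shows "unrow E a b w \<in> L [hspace E, point a] [point b]"
  unfolding L_def mem_Collect_eq idx_point idx_hspace_point
proof (intro allI impI)
  fix i j assume "unrow E a b w i j \<noteq> 0"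
  then obtain e where "e \<in> E" "(if i = [Inr b] \<and> j = [Inl e, Inr a] then w e else 0) \<noteq> 0"
    unfolding unrow_def by (rule sum.not_neutral_contains_not_neutral)
  then show "i \<in> {[Inr b]} \<and> j \<in> (\<lambda>e. [Inl e, Inr a]) ` E" by (auto split: if_splits)
qed

lemma unrow_apply:
  assumes "finite E" "e \<in> E" shows "unrow E a b w [Inr b] [Inl e, Inr a] = w e"
  using assms by (simp add: unrow_def)

text \<open>
  The space \<open>L(H \<otimes> \<complex>\<^sub>a, \<complex>\<^sub>b) \<cdot> (p \<otimes> 1)\<close> for the idempotent
  \<open>p\<close> with matrix \<open>M\<close>, described as the rows that \<open>M\<close> fixes.  The description by a
  fixed point equation makes slices and orthogonal complements computable.
\<close>

definition rows_fixed_by :: "'h set \<Rightarrow> ('h \<Rightarrow> 'h \<Rightarrow> complex) \<Rightarrow> 'v \<Rightarrow> 'v \<Rightarrow> ('h, 'v) label oper set" where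
  "rows_fixed_by E M a b = {r \<in> L [hspace E, point a] [point b].
     \<forall>f\<in>E. r [Inr b] [Inl f, Inr a] = (\<Sum>e\<in>E. r [Inr b] [Inl e, Inr a] * M e f)}"

lemma in_classical_pair:
  assumes "X \<in> listset [{hspace E}, classical A]"
  obtains a where "a \<in> A" "X = [hspace E, point a]"
  using assms unfolding in_listset by (auto simp: list_all2_Cons2 classical_def)

lemma in_classical_single:
  assumes "Y \<in> listset [classical B]"
  obtains b where "b \<in> B" "Y = [point b]"
  using assms unfolding in_listset by (auto simp: list_all2_Cons2 classical_def)

lemma pair_in_listset: "a \<in> A \<Longrightarrow> [hspace E, point a] \<in> listset [{hspace E}, classical A]"
  and single_in_listset: "b \<in> B \<Longrightarrow> [point b] \<in> listset [classical B]"
  unfolding in_listset by simp_all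

lemma family_to_rel_in_brels:
  "family_to_rel E A B p \<in> brels [{hspace E}, classical A] [classical B]"
  unfolding family_to_rel_def
proof (intro mk_brel_in_brels oper.subspace_span oper.span_minimal subspace_L)
  fix X Y
  have "op_mult X l (op_tensor 1 1 (op_of E (p (a, b))) (op_one [point a])) \<in> L X Y"
    if "X = [hspace E, point a]" "l \<in> L X Y" for a b l
  proof -
    have "op_of E (p (a, b)) \<in> L [hspace E] [hspace E]"
      unfolding L_def op_of_def by (auto simp: in_idx list_all2_Cons2 split: list.splits sum.splits if_splits)
    from op_tensor_in_L[OF this op_one_in_L[of "[point a]"]]
    show ?thesis using that by (intro op_mult_in_L) simp_all
  qed
  then show "{op_mult X l (op_tensor 1 1 (op_of E (p (a, b))) (op_one [point a])) |l a b.
      a \<in> A \<and> b \<in> B \<and> X = [hspace E, point a] \<and> Y = [point b] \<and> l \<in> L X Y} \<subseteq> L X Y"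
    by blast
qed

lemma cmpt_family_to_rel:
  fixes E :: "'h::complex_inner set" and p :: "'v \<times> 'v \<Rightarrow> 'h \<Rightarrow> 'h"
  assumes E: "orthonormal_basis E"
    and p: "p (a, b) \<in> projections" and ab: "a \<in> A" "b \<in> B"
  shows "cmpt (family_to_rel E A B p) [hspace E, point a] [point b] =
    rows_fixed_by E (\<lambda>e f. cinner e (p (a, b) f)) a b"
proof -
  let ?X = "[hspace E, point a]" and ?M = "\<lambda>e f. cinner e (p (a, b) f)"
  let ?G = "\<lambda>l. op_mult ?X l (op_tensor 1 1 (op_of E (p (a, b))) (op_one [point a]))"
  have fin: "finite E" using onb_finite[OF E] .
  have eq: "cmpt (family_to_rel E A B p) ?X [point b] = oper.span (?G ` L ?X [point b])"
  proof -
    have "cmpt (family_to_rel E A B p) ?X [point b] = oper.span {op_mult ?X l (op_tensor 1 1 (op_of E (p (a', b'))) (op_one [point a'])) |l a' b'.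
                         a' \<in> A \<and> b' \<in> B \<and> ?X = [hspace E, point a'] \<and> ([point b] :: ('h, 'v) label atom list) = [point b'] \<and> l \<in> L ?X [point b]}"
      unfolding family_to_rel_def
      by (subst cmpt_mk_brel[OF pair_in_listset[OF ab(1)] single_in_listset[OF ab(2)]]) (rule refl)
    also have "{op_mult ?X l (op_tensor 1 1 (op_of E (p (a', b'))) (op_one [point a'])) |l a' b'.
                         a' \<in> A \<and> b' \<in> B \<and> ?X = [hspace E, point a'] \<and> ([point b] :: ('h, 'v) label atom list) = [point b'] \<and> l \<in> L ?X [point b]}
       = ?G ` L ?X [point b]" using ab by auto
    finally show ?thesis .
  qed
  have opL: "op_tensor 1 1 (op_of E (p (a, b))) (op_one [point a]) \<in> L ?X ?X"
  proof -
    have "op_of E (p (a, b)) \<in> L [hspace E] [hspace E]"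
      unfolding L_def op_of_def by (auto simp: in_idx list_all2_Cons2 split: list.splits sum.splits if_splits)
    from op_tensor_in_L[OF this op_one_in_L[of "[point a]"]] show ?thesis by simp
  qed
  have app: "?G l [Inr b] [Inl f, Inr a] = (\<Sum>e\<in>E. l [Inr b] [Inl e, Inr a] * ?M e f)" if "f \<in> E" for l f
    unfolding op_mult_def sum_idx_hspace_point
    by (rule sum.cong) (use that in \<open>auto simp: op_tensor_def op_of_def op_one_def idx_point\<close>)
  have sub: "oper.subspace (rows_fixed_by E ?M a b)"
    using subspace_L[of ?X "[point b]"] unfolding oper.subspace_def rows_fixed_by_def
    by (simp add: scale_op_def algebra_simps sum.distrib sum_distrib_left)
  show ?thesis unfolding eq
  proof (intro equalityI oper.span_minimal sub)
    show "?G ` L ?X [point b] \<subseteq> rows_fixed_by E ?M a b"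
    proof clarify
      fix l :: "('h, 'v) label oper" assume l: "l \<in> L ?X [point b]"
      have "(\<Sum>e\<in>E. l [Inr b] [Inl e, Inr a] * ?M e f) =
        (\<Sum>g\<in>E. (\<Sum>e\<in>E. l [Inr b] [Inl e, Inr a] * ?M e g) * ?M g f)" if f: "f \<in> E" for f
      proof -
        have "(\<Sum>g\<in>E. (\<Sum>e\<in>E. l [Inr b] [Inl e, Inr a] * ?M e g) * ?M g f) =
          (\<Sum>e\<in>E. l [Inr b] [Inl e, Inr a] * (\<Sum>g\<in>E. ?M e g * ?M g f))"
          unfolding sum_distrib_right sum_distrib_left by (subst sum.swap) (simp add: mult.assoc)
        also have "\<dots> = (\<Sum>e\<in>E. l [Inr b] [Inl e, Inr a] * ?M e f)"
          by (intro sum.cong refl) (simp add: projection_mat(1)[OF E p _ f])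
        finally show ?thesis ..
      qed
      note idem = this
      have "?G l [Inr b] [Inl f, Inr a] = (\<Sum>e\<in>E. ?G l [Inr b] [Inl e, Inr a] * ?M e f)" if f: "f \<in> E" for f
      proof -
        have "(\<Sum>e\<in>E. ?G l [Inr b] [Inl e, Inr a] * ?M e f) =
          (\<Sum>g\<in>E. (\<Sum>e\<in>E. l [Inr b] [Inl e, Inr a] * ?M e g) * ?M g f)"
          by (intro sum.cong refl) (simp only: app)
        then show ?thesis using app[OF f] idem[OF f] by (simp only:)
      qed
      then show "?G l \<in> rows_fixed_by E ?M a b"
        using op_mult_in_L[OF l opL] unfolding rows_fixed_by_def by blast
    qed
    show "rows_fixed_by E ?M a b \<subseteq> oper.span (?G ` L ?X [point b])"
    proof
      fix r assume r: "r \<in> rows_fixed_by E ?M a b"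
      then have rL: "r \<in> L ?X [point b]" by (simp add: rows_fixed_by_def)
      have "r = ?G r"
        by (rule L_row_eqI[OF rL op_mult_in_L[OF rL opL]])
          (use r app in \<open>simp add: rows_fixed_by_def\<close>)
      then show "r \<in> oper.span (?G ` L ?X [point b])"
        using rL by (metis image_eqI oper.span_base)
    qed
  qed
qed

lemma rel_adj_in_brels:
  assumes "F \<in> brels Xs Ys" shows "rel_adj F \<in> brels Ys Xs"
  unfolding rel_adj_def brelsD(1,2)[OF assms]
proof (rule mk_brel_in_brels)
  fix X Y
  show "oper.subspace (op_adj ` cmpt F X Y)"
    by (rule subspace_op_adj[OF subspace_cmpt_brel[OF assms]])
  show "op_adj ` cmpt F X Y \<subseteq> L Y X"
    using cmpt_brel_subset_L[OF assms, of X Y] op_adj_in_L by blast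
qed

lemma rel_le_iff:
  assumes "R \<in> brels Xs Ys" "S \<in> brels Xs Ys"
  shows "rel_le R S \<longleftrightarrow> (\<forall>X\<in>listset Xs. \<forall>Y\<in>listset Ys. cmpt R X Y \<subseteq> cmpt S X Y)"
proof
  assume "\<forall>X\<in>listset Xs. \<forall>Y\<in>listset Ys. cmpt R X Y \<subseteq> cmpt S X Y"
  then have "cmpt R X Y \<subseteq> cmpt S X Y" for X Y
    using brelsD(5)[OF assms(1), of X Y] brelsD(5)[OF assms(2), of X Y]
    by (cases "X \<in> listset Xs \<and> Y \<in> listset Ys") auto
  then show "rel_le R S"
    unfolding rel_le_def using brelsD(1,2)[OF assms(1)] brelsD(1,2)[OF assms(2)] by simp
qed (simp add: rel_le_def)

lemma cmpt_rel_comp: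
  assumes "R \<in> brels Xs Ys" "S \<in> brels Ys Zs" "X \<in> listset Xs" "Z \<in> listset Zs"
  shows "cmpt (rel_comp S R) X Z =
    oper.span {op_mult Y s r |Y s r. Y \<in> listset Ys \<and> s \<in> cmpt S Y Z \<and> r \<in> cmpt R X Y}"
  unfolding rel_comp_def brelsD(1,2)[OF assms(1)] brelsD(2)[OF assms(2)]
  by (subst cmpt_mk_brel[OF assms(3,4)]) (rule refl)

lemma cmpt_rel_adj:
  assumes "F \<in> brels Xs Ys" "X \<in> listset Xs" "Y \<in> listset Ys"
  shows "cmpt (rel_adj F) Y X = op_adj ` cmpt F X Y"
  unfolding rel_adj_def brelsD(1,2)[OF assms(1)] by (subst cmpt_mk_brel[OF assms(3,2)]) (rule refl)

lemma cmpt_rel_id: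
  assumes "X \<in> listset Xs" "Y \<in> listset Xs"
  shows "cmpt (rel_id Xs) X Y = (if X = Y then oper.span {op_one X} else {0})"
  unfolding rel_id_def by (rule cmpt_mk_brel[OF assms])

text \<open>
  The inequalities between relations that define functions become conditions on generators: the
  components of a composite are spans, and those of an identity are lines or 0.
\<close>

lemma qfunctions_iff:
  assumes F: "F \<in> brels Xs Ys"
  shows "F \<in> qfunctions Xs Ys \<longleftrightarrow>
    (\<forall>X\<in>listset Xs. op_one X \<in> oper.span {op_mult Y (op_adj s) r |Y s r.
        Y \<in> listset Ys \<and> s \<in> cmpt F X Y \<and> r \<in> cmpt F X Y}) \<and>
    (\<forall>X\<in>listset Xs. \<forall>Y\<in>listset Ys. \<forall>Y'\<in>listset Ys. \<forall>s\<in>cmpt F X Y'. \<forall>r\<in>cmpt F X Y.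
        op_mult X s (op_adj r) \<in> cmpt (rel_id Ys) Y Y')"
    (is "_ \<longleftrightarrow> ?tot \<and> ?uni")
proof -
  note adj = rel_adj_in_brels[OF F]
  have tot: "rel_le (rel_id Xs) (rel_comp (rel_adj F) F) \<longleftrightarrow> ?tot"
  proof -
    let ?C = "rel_comp (rel_adj F) F"
    have C: "?C \<in> brels Xs Xs" by (rule rel_comp_in_brels[OF F adj])
    note sub = subspace_cmpt_brel[OF C]
    have span: "oper.span {op_one X} \<subseteq> cmpt ?C X Y \<longleftrightarrow> op_one X \<in> cmpt ?C X Y" for X Y
    proof
      assume "oper.span {op_one X} \<subseteq> cmpt ?C X Y"
      then show "op_one X \<in> cmpt ?C X Y" by (rule subsetD) (simp add: oper.span_base)
    qed (intro oper.span_minimal sub, simp)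
    have zero: "{0} \<subseteq> cmpt ?C X Y" for X Y using oper.subspace_0[OF sub] by simp
    have "rel_le (rel_id Xs) ?C \<longleftrightarrow> (\<forall>X\<in>listset Xs. op_one X \<in> cmpt ?C X X)"
      unfolding rel_le_iff[OF rel_id_in_brels C] using zero by (auto simp: cmpt_rel_id span)
    also have "\<dots> \<longleftrightarrow> ?tot"
    proof (rule ball_cong[OF refl])
      fix X assume X: "X \<in> listset Xs"
      have "{op_mult Y s r |Y s r. Y \<in> listset Ys \<and> s \<in> cmpt (rel_adj F) Y X \<and> r \<in> cmpt F X Y} =
          {op_mult Y (op_adj s) r |Y s r. Y \<in> listset Ys \<and> s \<in> cmpt F X Y \<and> r \<in> cmpt F X Y}"
        by (simp add: cmpt_rel_adj[OF F X] cong: conj_cong) blast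
      then show "op_one X \<in> cmpt ?C X X \<longleftrightarrow> op_one X \<in> oper.span {op_mult Y (op_adj s) r |Y s r.
          Y \<in> listset Ys \<and> s \<in> cmpt F X Y \<and> r \<in> cmpt F X Y}"
        unfolding cmpt_rel_comp[OF F adj X X] by simp
    qed
    finally show ?thesis .
  qed
  have uni: "rel_le (rel_comp F (rel_adj F)) (rel_id Ys) \<longleftrightarrow> ?uni"
  proof -
    let ?C = "rel_comp F (rel_adj F)"
    have C: "?C \<in> brels Ys Ys" by (rule rel_comp_in_brels[OF adj F])
    have "cmpt ?C Y Y' \<subseteq> cmpt (rel_id Ys) Y Y' \<longleftrightarrow> (\<forall>X\<in>listset Xs. \<forall>s\<in>cmpt F X Y'. \<forall>r\<in>cmpt F X Y.
        op_mult X s (op_adj r) \<in> cmpt (rel_id Ys) Y Y')" if Y: "Y \<in> listset Ys" "Y' \<in> listset Ys" for Y Y'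
    proof -
      let ?G = "{op_mult X s r |X s r. X \<in> listset Xs \<and> s \<in> cmpt F X Y' \<and> r \<in> cmpt (rel_adj F) Y X}"
      have G: "?G = {op_mult X s (op_adj r) |X s r. X \<in> listset Xs \<and> s \<in> cmpt F X Y' \<and> r \<in> cmpt F X Y}"
        by (simp add: cmpt_rel_adj[OF F _ Y(1)] cong: conj_cong) blast
      have "oper.span ?G \<subseteq> cmpt (rel_id Ys) Y Y' \<longleftrightarrow> ?G \<subseteq> cmpt (rel_id Ys) Y Y'"
        using oper.span_minimal[OF _ subspace_cmpt_brel[OF rel_id_in_brels]] oper.span_superset[of ?G]
        by (meson subset_trans)
      also have "\<dots> \<longleftrightarrow> (\<forall>X\<in>listset Xs. \<forall>s\<in>cmpt F X Y'. \<forall>r\<in>cmpt F X Y.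
          op_mult X s (op_adj r) \<in> cmpt (rel_id Ys) Y Y')"
        unfolding G by blast
      finally show ?thesis unfolding cmpt_rel_comp[OF adj F Y] .
    qed
    then show ?thesis unfolding rel_le_iff[OF C rel_id_in_brels] by blast
  qed
  show ?thesis unfolding qfunctions_def using F tot uni by simp
qed

lemma listset_hspace_classical:
  "listset [{hspace E}, classical A] = (\<lambda>a. [hspace E, point a]) ` A"
proof (intro equalityI subsetI)
  fix X :: "('a, 'b) label atom list"
  assume "X \<in> listset [{hspace E}, classical A]"
  then obtain a where "a \<in> A" "X = [hspace E, point a]" by (rule in_classical_pair)
  then show "X \<in> (\<lambda>a. [hspace E, point a]) ` A" by (intro image_eqI)
next
  fix X :: "('a, 'b) label atom list"
  assume "X \<in> (\<lambda>a. [hspace E, point a]) ` A"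
  then obtain a where a: "a \<in> A" and X: "X = [hspace E, point a]" by blast
  show "X \<in> listset [{hspace E}, classical A]" unfolding X using a by (rule pair_in_listset)
qed

lemma listset_classical:
  "listset [classical B] = (\<lambda>b. [point b] :: ('a, 'b) label atom list) ` B"
proof (intro equalityI subsetI)
  fix X :: "('a, 'b) label atom list"
  assume "X \<in> listset [classical B]"
  then obtain b where "b \<in> B" "X = [point b]" by (rule in_classical_single)
  then show "X \<in> (\<lambda>b. [point b]) ` B" by (intro image_eqI)
next
  fix X :: "('a, 'b) label atom list"
  assume "X \<in> (\<lambda>b. [point b]) ` B"
  then obtain b where b: "b \<in> B" and X: "X = [point b]" by blast
  show "X \<in> listset [classical B]" unfolding X using b by (rule single_in_listset)
qed

text \<open>
  Operators between points are scalars, so \<open>F \<circ> F\<^sup>\<dagger> \<le> I\<close> constrains only pairs of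
  different points \<open>b, b'\<close>, where it makes the rows orthogonal.
\<close>

lemma qfunctions_classical_iff:
  fixes E :: "'h set" and A B :: "'v set"
  assumes F: "F \<in> brels [{hspace E}, classical A] [classical B]"
  shows "F \<in> qfunctions [{hspace E}, classical A] [classical B] \<longleftrightarrow>
    (\<forall>a\<in>A. op_one [hspace E, point a] \<in> oper.span {op_mult [point b] (op_adj s) r |b s r.
        b \<in> B \<and> s \<in> cmpt F [hspace E, point a] [point b] \<and> r \<in> cmpt F [hspace E, point a] [point b]}) \<and>
    (\<forall>a\<in>A. \<forall>b\<in>B. \<forall>b'\<in>B. b \<noteq> b' \<longrightarrow>
      (\<forall>s\<in>cmpt F [hspace E, point a] [point b']. \<forall>r\<in>cmpt F [hspace E, point a] [point b].
        (\<Sum>e\<in>E. s [Inr b'] [Inl e, Inr a] * cnj (r [Inr b] [Inl e, Inr a])) = 0))"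
proof -
  let ?Ys = "[classical B :: ('h, 'v) label qset]"
  have tot: "{op_mult Y (op_adj s) r |Y s r. Y \<in> listset ?Ys \<and> s \<in> cmpt F X Y \<and> r \<in> cmpt F X Y} =
      {op_mult [point b] (op_adj s) r |b s r. b \<in> B \<and> s \<in> cmpt F X [point b] \<and> r \<in> cmpt F X [point b]}" for X
    unfolding listset_classical by blast
  have uni: "op_mult [hspace E, point a] s (op_adj r) \<in> cmpt (rel_id ?Ys) [point b] [point b'] \<longleftrightarrow>
      b \<noteq> b' \<longrightarrow> (\<Sum>e\<in>E. s [Inr b'] [Inl e, Inr a] * cnj (r [Inr b] [Inl e, Inr a])) = 0"
    if b: "b \<in> B" "b' \<in> B" and s: "s \<in> cmpt F [hspace E, point a] [point b']"
      and r: "r \<in> cmpt F [hspace E, point a] [point b]" for a b b' s r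
  proof -
    let ?t = "op_mult [hspace E, point a] s (op_adj r)"
    have tL: "?t \<in> L [point b] [point b']"
      using subsetD[OF cmpt_brel_subset_L[OF F] s] op_adj_in_L[OF subsetD[OF cmpt_brel_subset_L[OF F] r]]
      by (rule op_mult_in_L)
    have t: "?t [Inr b'] [Inr b] = (\<Sum>e\<in>E. s [Inr b'] [Inl e, Inr a] * cnj (r [Inr b] [Inl e, Inr a]))"
      unfolding op_mult_def sum_idx_hspace_point by (simp add: op_adj_def)
    have t0: "?t i j = 0" if "\<not> (i = [Inr b'] \<and> j = [Inr b])" for i j
      using tL[unfolded L_def mem_Collect_eq idx_point, rule_format, of i j] that by auto
    have id: "cmpt (rel_id ?Ys) [point b] [point b'] = (if b = b' then oper.span {op_one [point b]} else {0})"
      by (subst cmpt_rel_id) (use single_in_listset b in auto)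
    show ?thesis
    proof (cases "b = b'")
      case True
      have "?t i j = scale_op (?t [Inr b'] [Inr b]) (op_one [point b]) i j" for i j
        using t0[of i j] True by (auto simp: scale_op_def op_one_def idx_point)
      then have "?t = scale_op (?t [Inr b'] [Inr b]) (op_one [point b])" by blast
      then have "?t \<in> oper.span {op_one [point b]}" by (metis oper.span_base oper.span_scale singletonI)
      then show ?thesis unfolding id using True by simp
    next
      case False
      have "?t = 0 \<longleftrightarrow> ?t [Inr b'] [Inr b] = 0"
      proof
        assume z: "?t [Inr b'] [Inr b] = 0"
        have "?t i j = 0" for i j using z t0[of i j] by (cases "i = [Inr b'] \<and> j = [Inr b]") auto
        then show "?t = 0" by (simp add: fun_eq_iff)
      qed simp
      then show ?thesis unfolding id t using False by simp
    qed
  qed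
  show ?thesis
    unfolding qfunctions_iff[OF F] tot unfolding listset_hspace_classical listset_classical
    using uni by (simp only: ball_simps) blast
qed

section \<open>Functions are families of projections\<close>

lemma sum_fun_apply: "(\<Sum>i\<in>I. f i) x = (\<Sum>i\<in>I. f i x)"
  by (induction I rule: infinite_finite_induct) simp_all

lemma cinner_self_nonneg_zero: "Re (cinner x x) = 0 \<Longrightarrow> x = (0::'h::complex_inner)"
proof -
  assume "Re (cinner x x) = 0"
  moreover have "cinner x x = complex_of_real (Re (cinner x x))"
    using cinner_commute[of x x] by (metis Reals_cnj_iff of_real_Re)
  ultimately have "cinner x x = 0" by simp
  then show "x = 0" by (simp add: cinner_eq_zero_iff)
qed

text \<open>
  For \<open>y\<close> in the range of \<open>p b'\<close>, the squared norm of \<open>y\<close> is the sum of the squared norms of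
  the \<open>p c y\<close>.  The summand for \<open>c = b'\<close> already accounts for all of it, so the others vanish.
\<close>

lemma sum_projections_orthogonal:
  fixes p :: "'w \<Rightarrow> 'h::complex_inner \<Rightarrow> 'h"
  assumes fin: "finite B" and p: "\<And>b. b \<in> B \<Longrightarrow> p b \<in> projections" and one: "(\<Sum>b\<in>B. p b) = id"
    and b: "b \<in> B" "b' \<in> B" "b \<noteq> b'"
  shows "p b (p b' x) = 0"
proof -
  define y where "y = p b' x"
  have idem: "p c (p c z) = p c z" and sa: "cinner (p c z) w = cinner z (p c w)" if "c \<in> B" for c z w
    using p[OF that] by (auto simp: projections_def fun_eq_iff)
  have y: "p b' y = y" unfolding y_def by (rule idem[OF b(2)])
  have "y = (\<Sum>c\<in>B. p c y)" using fun_cong[OF one, of y] by (simp add: sum_fun_apply)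
  then have "cinner y y = (\<Sum>c\<in>B. cinner y (p c y))" using cinner_sum_right by metis
  also have "\<dots> = (\<Sum>c\<in>B. cinner (p c y) (p c y))"
    by (intro sum.cong refl) (metis idem sa)
  also have "\<dots> = cinner (p b' y) (p b' y) + (\<Sum>c\<in>B - {b'}. cinner (p c y) (p c y))"
    by (rule sum.remove[OF fin b(2)])
  finally have "(\<Sum>c\<in>B - {b'}. cinner (p c y) (p c y)) = 0" using y by simp
  then have "(\<Sum>c\<in>B - {b'}. Re (cinner (p c y) (p c y))) = 0" by (metis Re_sum zero_complex.simps(1))
  then have "Re (cinner (p b y) (p b y)) = 0"
    using fin b by (subst (asm) sum_nonneg_eq_0_iff) (auto simp: cinner_ge_zero)
  then show ?thesis using cinner_self_nonneg_zero by (simp add: y_def)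
qed

lemma linear_projection: "p \<in> projections \<Longrightarrow> Vector_Spaces.linear scaleC scaleC p"
  by (simp add: projections_def)

lemma linear_add_scaleC:
  fixes p :: "'h::complex_inner \<Rightarrow> 'h"
  assumes "Vector_Spaces.linear scaleC scaleC p"
  shows "p (x + y) = p x + p y" "p (scaleC c x) = scaleC c (p x)"
  using assms by (simp_all add: Vector_Spaces.linear_iff)

lemma sum_projections_iff:
  fixes p :: "'w \<Rightarrow> 'h::complex_inner \<Rightarrow> 'h"
  assumes onb: "orthonormal_basis E" and p: "\<And>b. b \<in> B \<Longrightarrow> p b \<in> projections"
  shows "(\<Sum>b\<in>B. p b) = id \<longleftrightarrow>
    (\<forall>e\<in>E. \<forall>f\<in>E. (\<Sum>b\<in>B. cinner e (p b f)) = (if e = f then 1 else 0))"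
proof -
  have lin: "Vector_Spaces.linear scaleC scaleC (\<Sum>b\<in>B. p b)"
  proof
    fix x y c
    show "(\<Sum>b\<in>B. p b) (x + y) = (\<Sum>b\<in>B. p b) x + (\<Sum>b\<in>B. p b) y"
      unfolding sum_fun_apply sum.distrib[symmetric]
      by (intro sum.cong refl) (rule linear_add_scaleC(1)[OF linear_projection[OF p]])
    show "(\<Sum>b\<in>B. p b) (scaleC c x) = scaleC c ((\<Sum>b\<in>B. p b) x)"
      unfolding sum_fun_apply hilb.scale_sum_right
      by (intro sum.cong refl) (rule linear_add_scaleC(2)[OF linear_projection[OF p]])
  qed
  have m: "cinner e ((\<Sum>b\<in>B. p b) f) = (\<Sum>b\<in>B. cinner e (p b f))" for e f
    by (simp add: sum_fun_apply cinner_sum_right)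
  show ?thesis
  proof
    assume "(\<Sum>b\<in>B. p b) = id"
    then have "cinner e f = (\<Sum>b\<in>B. cinner e (p b f))" for e f using m[of e f] by simp
    then show "\<forall>e\<in>E. \<forall>f\<in>E. (\<Sum>b\<in>B. cinner e (p b f)) = (if e = f then 1 else 0)"
      using onb_inner[OF onb] by metis
  next
    assume *: "\<forall>e\<in>E. \<forall>f\<in>E. (\<Sum>b\<in>B. cinner e (p b f)) = (if e = f then 1 else 0)"
    show "(\<Sum>b\<in>B. p b) = id"
    proof (rule linear_eqI[OF onb lin hilb.linear_id])
      fix e f assume "e \<in> E" "f \<in> E"
      then show "cinner e ((\<Sum>b\<in>B. p b) f) = cinner e (id f)"
        using * m onb_inner[OF onb] by simp
    qed
  qed
qed

lemma compose_zero_mat: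
  fixes p q :: "'h::complex_inner \<Rightarrow> 'h"
  assumes onb: "orthonormal_basis E" and p: "p \<in> projections" and q: "q \<in> projections"
  shows "p \<circ> q = (\<lambda>_. 0) \<longleftrightarrow> (\<forall>e\<in>E. \<forall>f\<in>E. (\<Sum>g\<in>E. cinner e (p g) * cinner g (q f)) = 0)"
proof
  assume z: "p \<circ> q = (\<lambda>_. 0)"
  then have "p (q f) = 0" for f by (simp add: fun_eq_iff)
  then show "\<forall>e\<in>E. \<forall>f\<in>E. (\<Sum>g\<in>E. cinner e (p g) * cinner g (q f)) = 0"
    by (simp flip: cinner_apply_expand[OF onb linear_projection[OF p]] add: cinner_zero_right)
next
  assume z: "\<forall>e\<in>E. \<forall>f\<in>E. (\<Sum>g\<in>E. cinner e (p g) * cinner g (q f)) = 0"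
  have lin: "Vector_Spaces.linear scaleC scaleC (p \<circ> q)"
    using Vector_Spaces.linear_compose[OF linear_projection[OF q] linear_projection[OF p]] .
  have lin0: "Vector_Spaces.linear scaleC scaleC (\<lambda>_::'h. 0::'h)"
    by unfold_locales simp_all
  show "p \<circ> q = (\<lambda>_. 0)"
  proof (rule linear_eqI[OF onb lin lin0])
    fix e f assume "e \<in> E" "f \<in> E"
    then show "cinner e ((p \<circ> q) f) = cinner e 0"
      using z cinner_apply_expand[OF onb linear_projection[OF p], of e "q f"] by (simp add: cinner_zero_right)
  qed
qed

lemma unrow_in_rows_fixed_by:
  assumes "finite E" "e \<in> E" "\<And>f. f \<in> E \<Longrightarrow> (\<Sum>g\<in>E. M e g * N g f) = M e f"
  shows "unrow E a b (M e) \<in> rows_fixed_by E N a b"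
  using assms unrow_in_L[of E a b "M e"] unfolding rows_fixed_by_def
  by (simp add: unrow_apply)

text \<open>
  If both matrices fix the same rows, then each fixes the rows of the other, so \<open>M N = M\<close> and
  \<open>N M = N\<close>.  Taking adjoints in the first equation gives \<open>M = N M\<close>.
\<close>

lemma rows_fixed_by_inject:
  assumes fin: "finite E"
    and M: "\<And>e f. e \<in> E \<Longrightarrow> f \<in> E \<Longrightarrow> (\<Sum>g\<in>E. M e g * M g f) = M e f" "\<And>e f. e \<in> E \<Longrightarrow> f \<in> E \<Longrightarrow> M f e = cnj (M e f)"
    and N: "\<And>e f. e \<in> E \<Longrightarrow> f \<in> E \<Longrightarrow> (\<Sum>g\<in>E. N e g * N g f) = N e f" "\<And>e f. e \<in> E \<Longrightarrow> f \<in> E \<Longrightarrow> N f e = cnj (N e f)"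
    and eq: "rows_fixed_by E M a b = rows_fixed_by E N a b"
    and ef: "e \<in> E" "f \<in> E"
  shows "M e f = N e f"
proof -
  have 1: "(\<Sum>g\<in>E. M e g * N g f) = M e f" if "e \<in> E" "f \<in> E" for e f
  proof -
    have "unrow E a b (M e) \<in> rows_fixed_by E N a b"
      unfolding eq[symmetric] by (rule unrow_in_rows_fixed_by[OF fin that(1)]) (rule M(1)[OF that(1)])
    then show ?thesis using that fin by (simp add: rows_fixed_by_def unrow_apply)
  qed
  have 2: "(\<Sum>g\<in>E. N e g * M g f) = N e f" if "e \<in> E" "f \<in> E" for e f
  proof -
    have "unrow E a b (N e) \<in> rows_fixed_by E M a b"
      unfolding eq by (rule unrow_in_rows_fixed_by[OF fin that(1)]) (rule N(1)[OF that(1)])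
    then show ?thesis using that fin by (simp add: rows_fixed_by_def unrow_apply)
  qed
  have "M e f = cnj (\<Sum>g\<in>E. M f g * N g e)"
    unfolding 1[OF ef(2,1)] by (rule M(2)[OF ef(2,1)])
  also have "\<dots> = (\<Sum>g\<in>E. N e g * M g f)"
    unfolding cnj_sum
  proof (intro sum.cong refl)
    fix g assume "g \<in> E"
    then show "cnj (M f g * N g e) = N e g * M g f"
      using M(2)[OF ef(2), of g] N(2)[of g, OF _ ef(1)] by (simp add: mult.commute)
  qed
  also have "\<dots> = N e f" by (rule 2[OF ef])
  finally show ?thesis .
qed

text \<open>
  The rows of \<open>p (a, b)\<close>, each paired with itself, give
  \<open>p (a, b)\<^sup>\<dagger> p (a, b) = p (a, b)\<close> as an element of \<open>W\<^sup>\<dagger> \<cdot> W\<close>, and summing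
  over \<open>b\<close> gives the identity.
\<close>

lemma family_to_rel_qfunction:
  fixes E :: "'h::complex_inner set" and p :: "'v \<times> 'v \<Rightarrow> 'h \<Rightarrow> 'h"
  assumes onb: "orthonormal_basis E" and fin: "finite B"
    and p: "p \<in> A \<times> B \<rightarrow>\<^sub>E projections" and one: "sums_to_one A B p"
  shows "family_to_rel E A B p \<in> qfunctions [{hspace E}, classical A] [classical B]"
proof -
  note finE = onb_finite[OF onb]
  have pr: "p (a, b) \<in> projections" if "a \<in> A" "b \<in> B" for a b using p that by auto
  let ?M = "\<lambda>a b e f. cinner e (p (a, b) f)"
  let ?F = "family_to_rel E A B p"
  have c: "cmpt ?F [hspace E, point a] [point b] = rows_fixed_by E (?M a b) a b" if "a \<in> A" "b \<in> B" for a b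
    using cmpt_family_to_rel[of E p a b A B] onb pr[OF that] that by blast
  have tot: "op_one [hspace E, point a] \<in> oper.span {op_mult [point b] (op_adj s) r |b s r.
        b \<in> B \<and> s \<in> cmpt ?F [hspace E, point a] [point b] \<and> r \<in> cmpt ?F [hspace E, point a] [point b]}"
    (is "_ \<in> oper.span ?S") if a: "a \<in> A" for a
  proof -
    (* For a projection q, the sum of these over the rows g of q is the adjoint of q times q, hence q. *)
    define t where "t b g = op_mult [point b] (op_adj (unrow E a b (?M a b g))) (unrow E a b (?M a b g))" for b g
    have tS: "t b g \<in> ?S" if "b \<in> B" "g \<in> E" for b g
    proof -
      have "unrow E a b (?M a b g) \<in> rows_fixed_by E (?M a b) a b"
        by (rule unrow_in_rows_fixed_by[OF finE that(2)])
          (rule projection_mat(1)[OF onb pr[OF a that(1)] that(2)])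
      then show ?thesis unfolding t_def using that c[OF a that(1)] by blast
    qed
    have tapp: "t b g [Inl e, Inr a] [Inl f, Inr a] = cnj (?M a b g e) * ?M a b g f" if "e \<in> E" "f \<in> E" for b g e f
      unfolding t_def op_mult_def idx_point op_adj_def using that finE by (simp add: unrow_apply)
    have tL: "t b g \<in> L [hspace E, point a] [hspace E, point a]" for b g
      unfolding t_def
    proof (rule op_mult_in_L[OF _ unrow_in_L])
      show "op_adj (unrow E a b (?M a b g)) \<in> L [point b] [hspace E, point a]"
        using unrow_in_L[of E a b "?M a b g"] by (auto simp: L_def op_adj_def)
    qed
    have app: "(\<Sum>b\<in>B. \<Sum>g\<in>E. t b g) i j = (\<Sum>b\<in>B. \<Sum>g\<in>E. t b g i j)" for i j
      by (simp add: sum_fun_apply)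
    have "op_one [hspace E, point a] = (\<Sum>b\<in>B. \<Sum>g\<in>E. t b g)"
    proof (intro ext)
      fix i j
      show "op_one [hspace E, point a] i j = (\<Sum>b\<in>B. \<Sum>g\<in>E. t b g) i j"
      proof (cases "i \<in> idx [hspace E, point a] \<and> j \<in> idx [hspace E, point a]")
        case True
        then obtain e f where ef: "e \<in> E" "f \<in> E" "i = [Inl e, Inr a]" "j = [Inl f, Inr a]"
          unfolding idx_hspace_point by auto
        have "(\<Sum>b\<in>B. \<Sum>g\<in>E. t b g) i j = (\<Sum>b\<in>B. \<Sum>g\<in>E. cnj (?M a b g e) * ?M a b g f)"
          unfolding app ef(3,4) using ef by (simp add: tapp)
        also have "\<dots> = (\<Sum>b\<in>B. ?M a b e f)"
        proof (intro sum.cong refl)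
          fix b assume b: "b \<in> B"
          have "(\<Sum>g\<in>E. cnj (?M a b g e) * ?M a b g f) = (\<Sum>g\<in>E. ?M a b e g * ?M a b g f)"
            by (intro sum.cong refl) (simp add: projection_mat(2)[OF onb pr[OF a b] _ ef(1)])
          then show "(\<Sum>g\<in>E. cnj (?M a b g e) * ?M a b g f) = ?M a b e f"
            using projection_mat(1)[OF onb pr[OF a b] ef(1,2)] by simp
        qed
        also have "\<dots> = (if e = f then 1 else 0)"
          using one a ef sum_projections_iff[OF onb pr[OF a], of B "\<lambda>b. b"] unfolding sums_to_one_def by auto
        also have "\<dots> = op_one [hspace E, point a] i j"
          using True unfolding op_one_def ef by simp
        finally show ?thesis ..
      next
        case False
        have "t b g i j = 0" for b g
          using False tL[of b g, unfolded L_def mem_Collect_eq, rule_format, of i j] by argo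
        then have "(\<Sum>b\<in>B. \<Sum>g\<in>E. t b g) i j = 0" unfolding app by simp
        moreover have "op_one [hspace E, point a] i j = 0" using False by (auto simp: op_one_def)
        ultimately show ?thesis by simp
      qed
    qed
    moreover have "(\<Sum>b\<in>B. \<Sum>g\<in>E. t b g) \<in> oper.span ?S"
      by (intro oper.span_sum oper.span_base tS)
    ultimately show ?thesis by simp
  qed
  have uni: "(\<Sum>e\<in>E. s [Inr b'] [Inl e, Inr a] * cnj (r [Inr b] [Inl e, Inr a])) = 0"
    if a: "a \<in> A" and b: "b \<in> B" "b' \<in> B" "b \<noteq> b'"
      and s: "s \<in> cmpt ?F [hspace E, point a] [point b']" and r: "r \<in> cmpt ?F [hspace E, point a] [point b]"
    for a b b' s r
  proof -
    let ?s = "\<lambda>e. s [Inr b'] [Inl e, Inr a]" and ?r = "\<lambda>e. r [Inr b] [Inl e, Inr a]"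
    have s': "?s e = (\<Sum>g\<in>E. ?s g * ?M a b' g e)" if "e \<in> E" for e
      using s c[OF a b(2)] that by (simp add: rows_fixed_by_def)
    have r': "?r e = (\<Sum>h\<in>E. ?r h * ?M a b h e)" if "e \<in> E" for e
      using r c[OF a b(1)] that by (simp add: rows_fixed_by_def)
    have "p (a, b') \<circ> p (a, b) = (\<lambda>_. 0)"
    proof
      have one_a: "(\<Sum>c\<in>B. p (a, c)) = id" using one a by (simp add: sums_to_one_def)
      show "(p (a, b') \<circ> p (a, b)) x = 0" for x
        unfolding o_apply
        by (rule sum_projections_orthogonal[of B "\<lambda>c. p (a, c)" b' b, OF fin pr[OF a] one_a b(2,1)])
          (use b in auto)
    qed
    then have orth: "(\<Sum>e\<in>E. ?M a b' g e * ?M a b e h) = 0" if "g \<in> E" "h \<in> E" for g h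
      using compose_zero_mat[OF onb pr[OF a b(2)] pr[OF a b(1)]] that by blast
    have "(\<Sum>e\<in>E. ?s e * cnj (?r e)) = (\<Sum>e\<in>E. \<Sum>g\<in>E. \<Sum>h\<in>E. ?s g * cnj (?r h) * (?M a b' g e * ?M a b e h))"
    proof (intro sum.cong refl)
      fix e assume e: "e \<in> E"
      have "?s e * cnj (?r e) = (\<Sum>g\<in>E. ?s g * ?M a b' g e) * cnj (\<Sum>h\<in>E. ?r h * ?M a b h e)"
        using s'[OF e] r'[OF e] by simp
      also have "\<dots> = (\<Sum>g\<in>E. \<Sum>h\<in>E. (?s g * ?M a b' g e) * cnj (?r h * ?M a b h e))"
        by (simp add: sum_product)
      also have "\<dots> = (\<Sum>g\<in>E. \<Sum>h\<in>E. ?s g * cnj (?r h) * (?M a b' g e * ?M a b e h))"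
      proof (intro sum.cong refl)
        fix g h assume "h \<in> E"
        then show "(?s g * ?M a b' g e) * cnj (?r h * ?M a b h e) = ?s g * cnj (?r h) * (?M a b' g e * ?M a b e h)"
          using projection_mat(2)[OF onb pr[OF a b(1)], of h e] e by simp
      qed
      finally show "?s e * cnj (?r e) = (\<Sum>g\<in>E. \<Sum>h\<in>E. ?s g * cnj (?r h) * (?M a b' g e * ?M a b e h))" .
    qed
    also have "\<dots> = (\<Sum>g\<in>E. \<Sum>e\<in>E. \<Sum>h\<in>E. ?s g * cnj (?r h) * (?M a b' g e * ?M a b e h))"
      by (rule sum.swap)
    also have "\<dots> = (\<Sum>g\<in>E. \<Sum>h\<in>E. \<Sum>e\<in>E. ?s g * cnj (?r h) * (?M a b' g e * ?M a b e h))"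
      by (rule sum.cong[OF refl sum.swap])
    also have "\<dots> = (\<Sum>g\<in>E. \<Sum>h\<in>E. ?s g * cnj (?r h) * (\<Sum>e\<in>E. ?M a b' g e * ?M a b e h))"
      by (simp add: sum_distrib_left)
    also have "\<dots> = 0" using orth by simp
    finally show ?thesis .
  qed
  show ?thesis
    unfolding qfunctions_classical_iff[OF family_to_rel_in_brels] using tot uni by blast
qed

text \<open>
  The summands \<open>T b\<close> of the identity are themselves the projections.  Only two properties of the
  elements of \<open>W\<^sup>\<dagger> \<cdot> W\<close> are used, and they are collected in the predicate \<open>Q\<close> of the
  proof: they map every row into \<open>W\<close>, and they annihilate the rows of the other spaces.  Both are
  linear, so they pass from generators to spans.
\<close>

lemma qfunction_projections:
  fixes E :: "'h::complex_inner set" and A B :: "'v set"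
  assumes onb: "orthonormal_basis E" and fin: "finite B"
    and F: "F \<in> qfunctions [{hspace E}, classical A] [classical B]" and a: "a \<in> A"
  obtains T where
    "\<And>b e f. b \<in> B \<Longrightarrow> e \<in> E \<Longrightarrow> f \<in> E \<Longrightarrow> (\<Sum>g\<in>E. T b e g * T b g f) = T b e f"
    "\<And>b e f. b \<in> B \<Longrightarrow> e \<in> E \<Longrightarrow> f \<in> E \<Longrightarrow> T b f e = cnj (T b e f)"
    "\<And>e f. e \<in> E \<Longrightarrow> f \<in> E \<Longrightarrow> (\<Sum>b\<in>B. T b e f) = (if e = f then 1 else (0::complex))"
    "\<And>b. b \<in> B \<Longrightarrow> cmpt F [hspace E, point a] [point b] = rows_fixed_by E (T b) a b"
proof -
  note finE = onb_finite[OF onb]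
  have FB: "F \<in> brels [{hspace E}, classical A] [classical B]" using F by (simp add: qfunctions_def)
  define S where "S b = cmpt F [hspace E, point a] [point b]" for b
  define row where "row b r e = r [Inr b] [Inl e, Inr a]" for b :: 'v and r :: "('h, 'v) label oper" and e
  have subS: "oper.subspace (S b)" for b unfolding S_def by (rule subspace_cmpt_brel[OF FB])
  have SL: "S b \<subseteq> L [hspace E, point a] [point b]" for b unfolding S_def by (rule cmpt_brel_subset_L[OF FB])
  have row_add: "row b (r + s) e = row b r e + row b s e" and row_scale: "row b (scale_op c r) e = c * row b r e"
    and row_zero: "row b 0 e = 0" for b r s e c
    by (simp_all add: row_def scale_op_def)
  have uni: "(\<Sum>e\<in>E. row b' s e * cnj (row b r e)) = 0"
    if "b \<in> B" "b' \<in> B" "b \<noteq> b'" "s \<in> S b'" "r \<in> S b" for b b' s r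
    using qfunctions_classical_iff[OF FB] F a that unfolding S_def row_def by blast
  have tot: "op_one [hspace E, point a] \<in> oper.span {op_mult [point b] (op_adj s) r |b s r.
        b \<in> B \<and> s \<in> S b \<and> r \<in> S b}"
    using qfunctions_classical_iff[OF FB] F a unfolding S_def by blast
  define Q where "Q b M \<longleftrightarrow> (\<forall>w. \<exists>r\<in>S b. \<forall>f\<in>E. row b r f = (\<Sum>e\<in>E. w e * M e f)) \<and>
    (\<forall>b'\<in>B. b' \<noteq> b \<longrightarrow> (\<forall>r\<in>S b'. \<forall>f\<in>E. (\<Sum>e\<in>E. row b' r e * M e f) = 0))"
    for b :: 'v and M :: "'h \<Rightarrow> 'h \<Rightarrow> complex"
  have Q0: "Q b (\<lambda>_ _. 0)" for b
    unfolding Q_def using oper.subspace_0[OF subS[of b]] row_zero by (auto intro!: bexI[of _ 0])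
  have Qadd: "Q b (\<lambda>e f. M e f + N e f)" if MN: "Q b M" "Q b N" for b M N
    unfolding Q_def
  proof (intro conjI allI ballI impI)
    fix w
    obtain r where r: "r \<in> S b" "\<forall>f\<in>E. row b r f = (\<Sum>e\<in>E. w e * M e f)"
      using MN(1) unfolding Q_def by meson
    obtain s where s: "s \<in> S b" "\<forall>f\<in>E. row b s f = (\<Sum>e\<in>E. w e * N e f)"
      using MN(2) unfolding Q_def by meson
    from r s show "\<exists>r\<in>S b. \<forall>f\<in>E. row b r f = (\<Sum>e\<in>E. w e * (M e f + N e f))"
      using oper.subspace_add[OF subS[of b]]
      by (intro bexI[of _ "r + s"]) (simp_all add: row_add distrib_left sum.distrib)
  qed (use that in \<open>simp add: Q_def distrib_left sum.distrib\<close>)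
  have Qscale: "Q b (\<lambda>e f. c * M e f)" if QM: "Q b M" for b c M
    unfolding Q_def
  proof (intro conjI allI ballI impI)
    fix w
    obtain r where "r \<in> S b" "\<forall>f\<in>E. row b r f = (\<Sum>e\<in>E. w e * M e f)"
      using QM unfolding Q_def by meson
    then show "\<exists>r\<in>S b. \<forall>f\<in>E. row b r f = (\<Sum>e\<in>E. w e * (c * M e f))"
      using oper.subspace_scale[OF subS[of b]]
      by (intro bexI[of _ "scale_op c r"]) (simp_all add: row_scale sum_distrib_left mult.left_commute)
  next
    fix b' r f assume "b' \<in> B" "b' \<noteq> b" "r \<in> S b'" "f \<in> E"
    then have "(\<Sum>e\<in>E. row b' r e * M e f) = 0" using that unfolding Q_def by blast
    then have "c * (\<Sum>e\<in>E. row b' r e * M e f) = 0" by simp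
    then show "(\<Sum>e\<in>E. row b' r e * (c * M e f)) = 0"
      by (simp add: sum_distrib_left mult.left_commute)
  qed
  have Qgen: "Q b (\<lambda>e f. cnj (row b s e) * row b r f)" if "b \<in> B" "s \<in> S b" "r \<in> S b" for b s r
    unfolding Q_def
  proof (intro conjI allI ballI impI)
    fix w :: "'h \<Rightarrow> complex"
    show "\<exists>r'\<in>S b. \<forall>f\<in>E. row b r' f = (\<Sum>e\<in>E. w e * (cnj (row b s e) * row b r f))"
      using oper.subspace_scale[OF subS[of b] that(3)]
      by (intro bexI[of _ "scale_op (\<Sum>e\<in>E. w e * cnj (row b s e)) r"])
        (simp_all add: row_scale sum_distrib_right mult.assoc)
  next
    fix b' r' f assume b': "b' \<in> B" "b' \<noteq> b" "r' \<in> S b'" and "f \<in> E"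
    have "(\<Sum>e\<in>E. row b' r' e * (cnj (row b s e) * row b r f)) = (\<Sum>e\<in>E. row b' r' e * cnj (row b s e)) * row b r f"
      by (simp add: sum_distrib_right mult.assoc)
    also have "\<dots> = 0" using uni[of b b' r' s] that b' by simp
    finally show "(\<Sum>e\<in>E. row b' r' e * (cnj (row b s e) * row b r f)) = 0" .
  qed
  (* The operators on the tensor product of H and the point a that decompose as required. *)
  define D where "D = {t. \<exists>T. (\<forall>b\<in>B. Q b (T b)) \<and>
    (\<forall>e\<in>E. \<forall>f\<in>E. t [Inl e, Inr a] [Inl f, Inr a] = (\<Sum>b\<in>B. T b e f))}"
  have subD: "oper.subspace D"
    unfolding oper.subspace_def
  proof (intro conjI ballI allI)
    show "0 \<in> D" unfolding D_def using Q0 by (auto intro!: exI[of _ "\<lambda>_ _ _. 0"])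
  next
    fix s t assume "s \<in> D" "t \<in> D"
    then obtain T U where
      T: "\<forall>b\<in>B. Q b (T b)" "\<forall>e\<in>E. \<forall>f\<in>E. s [Inl e, Inr a] [Inl f, Inr a] = (\<Sum>b\<in>B. T b e f)" and
      U: "\<forall>b\<in>B. Q b (U b)" "\<forall>e\<in>E. \<forall>f\<in>E. t [Inl e, Inr a] [Inl f, Inr a] = (\<Sum>b\<in>B. U b e f)"
      unfolding D_def by blast
    show "s + t \<in> D" unfolding D_def mem_Collect_eq
    proof (intro exI[of _ "\<lambda>b e f. T b e f + U b e f"] conjI ballI)
      show "Q b (\<lambda>e f. T b e f + U b e f)" if "b \<in> B" for b using Qadd T U that by blast
    qed (use T U in \<open>simp add: sum.distrib\<close>)
  next
    fix c t assume "t \<in> D"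
    then obtain T where
      T: "\<forall>b\<in>B. Q b (T b)" "\<forall>e\<in>E. \<forall>f\<in>E. t [Inl e, Inr a] [Inl f, Inr a] = (\<Sum>b\<in>B. T b e f)"
      unfolding D_def by blast
    show "scale_op c t \<in> D" unfolding D_def mem_Collect_eq
    proof (intro exI[of _ "\<lambda>b e f. c * T b e f"] conjI ballI)
      show "Q b (\<lambda>e f. c * T b e f)" if "b \<in> B" for b using Qscale T that by blast
    qed (use T in \<open>simp add: scale_op_def sum_distrib_left\<close>)
  qed
  have "oper.span {op_mult [point b] (op_adj s) r |b s r. b \<in> B \<and> s \<in> S b \<and> r \<in> S b} \<subseteq> D"
  proof (rule oper.span_minimal[OF _ subD], clarify)
    fix b s r assume b: "b \<in> B" "s \<in> S b" "r \<in> S b"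
    show "op_mult [point b] (op_adj s) r \<in> D" unfolding D_def mem_Collect_eq
    proof (intro exI[of _ "\<lambda>b' e f. if b' = b then cnj (row b s e) * row b r f else 0"] conjI ballI)
      show "Q b' (\<lambda>e f. if b' = b then cnj (row b s e) * row b r f else 0)" if "b' \<in> B" for b'
        using Qgen[OF b] Q0 by (cases "b' = b") simp_all
      show "op_mult [point b] (op_adj s) r [Inl e, Inr a] [Inl f, Inr a] =
          (\<Sum>b'\<in>B. if b' = b then cnj (row b s e) * row b r f else 0)" for e f
        using fin b by (simp add: op_mult_def idx_point op_adj_def row_def)
    qed
  qed
  then have "op_one [hspace E, point a] \<in> D" using tot by blast
  then obtain T where T: "\<And>b. b \<in> B \<Longrightarrow> Q b (T b)"
    and one': "\<And>e f. e \<in> E \<Longrightarrow> f \<in> E \<Longrightarrow> op_one [hspace E, point a] [Inl e, Inr a] [Inl f, Inr a] = (\<Sum>b\<in>B. T b e f)"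
    unfolding D_def by blast
  have one: "(\<Sum>b\<in>B. T b e f) = (if e = f then 1 else 0)" if "e \<in> E" "f \<in> E" for e f
    using one'[OF that] that by (simp add: op_one_def idx_hspace_point)
  have rowT: "\<exists>r\<in>S b. \<forall>f\<in>E. row b r f = T b e f" if be: "b \<in> B" "e \<in> E" for b e
  proof -
    (* The rows of T b are the images of the basis vectors. *)
    obtain r where "r \<in> S b" "\<forall>f\<in>E. row b r f = (\<Sum>e'\<in>E. (if e' = e then 1 else 0) * T b e' f)"
      using T[OF be(1)] unfolding Q_def by meson
    moreover have "(\<Sum>e'\<in>E. (if e' = e then 1 else 0) * T b e' f) = T b e f" for f
      using finE that by (simp add: if_distrib[of "\<lambda>x. x * _"] cong: if_cong)
    ultimately show ?thesis by auto
  qed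
  have kill: "(\<Sum>e\<in>E. row b' r e * T b e f) = 0" if "b \<in> B" "b' \<in> B" "b' \<noteq> b" "r \<in> S b'" "f \<in> E" for b b' r f
    using T[OF that(1)] that unfolding Q_def by blast
  have cross: "(\<Sum>g\<in>E. T b e g * T b' g f) = 0" if "b \<in> B" "b' \<in> B" "b \<noteq> b'" "e \<in> E" "f \<in> E" for b b' e f
  proof -
    obtain r where r: "r \<in> S b" "\<forall>f\<in>E. row b r f = T b e f" using rowT \<open>b \<in> B\<close> \<open>e \<in> E\<close> by blast
    have "(\<Sum>g\<in>E. row b r g * T b' g f) = 0" using kill that r by blast
    then show ?thesis using r by simp
  qed
  have cross': "(\<Sum>g\<in>E. T b e g * cnj (T b' f g)) = 0" if "b \<in> B" "b' \<in> B" "b \<noteq> b'" "e \<in> E" "f \<in> E" for b b' e f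
  proof -
    obtain r where r: "r \<in> S b" "\<forall>f\<in>E. row b r f = T b e f" using rowT \<open>b \<in> B\<close> \<open>e \<in> E\<close> by blast
    obtain s where s: "s \<in> S b'" "\<forall>g\<in>E. row b' s g = T b' f g" using rowT \<open>b' \<in> B\<close> \<open>f \<in> E\<close> by blast
    have "(\<Sum>g\<in>E. row b r g * cnj (row b' s g)) = 0" using uni[of b' b r s] that r s by auto
    then show ?thesis using r s by simp
  qed
  have pick: "(\<Sum>b'\<in>B. X b') = X b" if "b \<in> B" "\<And>b'. b' \<in> B \<Longrightarrow> b' \<noteq> b \<Longrightarrow> X b' = 0" for X :: "'v \<Rightarrow> complex" and b
  proof -
    have "(\<Sum>b'\<in>B. X b') = (\<Sum>b'\<in>{b}. X b')"
      by (rule sum.mono_neutral_right) (use fin that in auto)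
    then show ?thesis by simp
  qed
  have unit_right: "w f = (\<Sum>g\<in>E. w g * (\<Sum>b'\<in>B. T b' g f))" if "f \<in> E" for w :: "'h \<Rightarrow> complex" and f
    using finE that by (simp add: one if_distrib[of "(*) _"] cong: if_cong sum.cong)
  have idem: "(\<Sum>g\<in>E. T b e g * T b g f) = T b e f" if "b \<in> B" "e \<in> E" "f \<in> E" for b e f
  proof -
    have "T b e f = (\<Sum>g\<in>E. T b e g * (\<Sum>b'\<in>B. T b' g f))" by (rule unit_right[OF that(3)])
    also have "\<dots> = (\<Sum>b'\<in>B. \<Sum>g\<in>E. T b e g * T b' g f)"
      unfolding sum_distrib_left by (rule sum.swap)
    also have "\<dots> = (\<Sum>g\<in>E. T b e g * T b g f)" by (rule pick) (use that cross in auto)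
    finally show ?thesis ..
  qed
  have TT: "(\<Sum>g\<in>E. T b e g * cnj (T b f g)) = T b e f" if "b \<in> B" "e \<in> E" "f \<in> E" for b e f
  proof -
    have "(\<Sum>g\<in>E. T b e g * cnj (T b f g)) = (\<Sum>b'\<in>B. \<Sum>g\<in>E. T b e g * cnj (T b' f g))"
      by (rule pick[symmetric]) (use that cross' in auto)
    also have "\<dots> = (\<Sum>g\<in>E. T b e g * cnj (\<Sum>b'\<in>B. T b' f g))"
      unfolding cnj_sum sum_distrib_left by (rule sum.swap)
    also have "\<dots> = T b e f"
      using finE that by (simp add: one if_distrib[of "(*) _"] if_distrib[of cnj] cong: if_cong sum.cong)
    finally show ?thesis .
  qed
  have herm: "T b f e = cnj (T b e f)" if "b \<in> B" "e \<in> E" "f \<in> E" for b e f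
  proof -
    have "cnj (T b e f) = cnj (\<Sum>g\<in>E. T b e g * cnj (T b f g))"
      by (rule arg_cong[OF TT[OF that, symmetric]])
    also have "\<dots> = (\<Sum>g\<in>E. T b f g * cnj (T b e g))"
      unfolding cnj_sum by (intro sum.cong refl) (simp add: mult.commute)
    also have "\<dots> = T b f e" by (rule TT[OF that(1,3,2)])
    finally show ?thesis ..
  qed
  have fixed: "S b = rows_fixed_by E (T b) a b" if b: "b \<in> B" for b
  proof (intro equalityI subsetI)
    fix r assume r: "r \<in> S b"
    have "row b r f = (\<Sum>e\<in>E. row b r e * T b e f)" if f: "f \<in> E" for f
    proof -
      have "row b r f = (\<Sum>e\<in>E. row b r e * (\<Sum>b'\<in>B. T b' e f))" by (rule unit_right[OF f])
      also have "\<dots> = (\<Sum>b'\<in>B. \<Sum>e\<in>E. row b r e * T b' e f)"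
        unfolding sum_distrib_left by (rule sum.swap)
      also have "\<dots> = (\<Sum>e\<in>E. row b r e * T b e f)" by (rule pick) (use b kill r f in auto)
      finally show ?thesis .
    qed
    then show "r \<in> rows_fixed_by E (T b) a b" using r SL unfolding rows_fixed_by_def row_def by blast
  next
    fix r assume r: "r \<in> rows_fixed_by E (T b) a b"
    obtain r' where r': "r' \<in> S b" "\<forall>f\<in>E. row b r' f = (\<Sum>e\<in>E. row b r e * T b e f)"
      using T[OF b] unfolding Q_def by meson
    have "r = r'"
    proof (rule L_row_eqI)
      show "r \<in> L [hspace E, point a] [point b]" "r' \<in> L [hspace E, point a] [point b]"
        using r r' SL by (auto simp: rows_fixed_by_def)
      show "r [Inr b] [Inl e, Inr a] = r' [Inr b] [Inl e, Inr a]" if "e \<in> E" for e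
        using r r' that unfolding rows_fixed_by_def row_def by simp
    qed
    then show "r \<in> S b" using r' by simp
  qed
  show thesis
    by (rule that[of T]) (erule (2) idem, erule (2) herm, erule (1) one, erule fixed[unfolded S_def])
qed

lemma bij_betw_family_to_rel:
  fixes E :: "'h::complex_inner set" and A B :: "'v set"
  assumes onb: "orthonormal_basis E" and fin: "finite B"
  shows "bij_betw (family_to_rel E A B)
    {p \<in> A \<times> B \<rightarrow>\<^sub>E (projections :: ('h \<Rightarrow> 'h) set). sums_to_one A B p}
    (qfunctions [{hspace E}, classical A] [classical B])"
  unfolding bij_betw_def
proof (intro conjI equalityI subsetI)
  show "inj_on (family_to_rel E A B) {p \<in> A \<times> B \<rightarrow>\<^sub>E (projections :: ('h \<Rightarrow> 'h) set). sums_to_one A B p}"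
  proof (rule inj_onI)
    fix p q assume p: "p \<in> {p \<in> A \<times> B \<rightarrow>\<^sub>E (projections :: ('h \<Rightarrow> 'h) set). sums_to_one A B p}"
      and q: "q \<in> {p \<in> A \<times> B \<rightarrow>\<^sub>E (projections :: ('h \<Rightarrow> 'h) set). sums_to_one A B p}"
      and eq: "family_to_rel E A B p = family_to_rel E A B q"
    have "p (a, b) = q (a, b)" if ab: "a \<in> A" "b \<in> B" for a b
    proof -
      have pr: "p (a, b) \<in> projections" "q (a, b) \<in> projections" using p q ab by auto
      have "rows_fixed_by E (\<lambda>e f. cinner e (p (a, b) f)) a b = rows_fixed_by E (\<lambda>e f. cinner e (q (a, b) f)) a b"
        using cmpt_family_to_rel[of E p a b A B] cmpt_family_to_rel[of E q a b A B] onb pr ab eq by metis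
      note same = this
      have "cinner e (p (a, b) f) = cinner e (q (a, b) f)" if "e \<in> E" "f \<in> E" for e f
        by (rule rows_fixed_by_inject[OF onb_finite[OF onb] projection_mat[OF onb pr(1)] projection_mat[OF onb pr(2)] same that])
      then show ?thesis
        using linear_eqI[OF onb linear_projection[OF pr(1)] linear_projection[OF pr(2)]] by blast
    qed
    moreover have "p \<in> A \<times> B \<rightarrow>\<^sub>E projections" "q \<in> A \<times> B \<rightarrow>\<^sub>E projections" using p q by auto
    ultimately show "p = q" by (intro PiE_ext[of p "A \<times> B" "\<lambda>_. projections" q]) auto
  qed
  fix F assume "F \<in> family_to_rel E A B ` {p \<in> A \<times> B \<rightarrow>\<^sub>E (projections :: ('h \<Rightarrow> 'h) set). sums_to_one A B p}"
  then show "F \<in> qfunctions [{hspace E}, classical A] [classical B]"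
    using family_to_rel_qfunction[OF onb fin] by blast
next
  fix F :: "('h, 'v) label brel"
  assume F: "F \<in> qfunctions [{hspace E}, classical A] [classical B]"
  have FB: "F \<in> brels [{hspace E}, classical A] [classical B]" using F by (simp add: qfunctions_def)
  define good where "good a T \<longleftrightarrow>
      (\<forall>b\<in>B. \<forall>e\<in>E. \<forall>f\<in>E. (\<Sum>g\<in>E. T b e g * T b g f) = T b e f) \<and>
      (\<forall>b\<in>B. \<forall>e\<in>E. \<forall>f\<in>E. T b f e = cnj (T b e f)) \<and>
      (\<forall>e\<in>E. \<forall>f\<in>E. (\<Sum>b\<in>B. T b e f) = (if e = f then 1 else 0)) \<and>
      (\<forall>b\<in>B. cmpt F [hspace E, point a] [point b] = rows_fixed_by E (T b) a b)"
    for a and T :: "'v \<Rightarrow> 'h \<Rightarrow> 'h \<Rightarrow> complex"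
  have "\<exists>T. good a T" if a: "a \<in> A" for a
  proof (rule qfunction_projections[OF onb fin F a], goal_cases)
    case (1 T)
    show ?case unfolding good_def by (intro exI[of _ T] conjI ballI; (rule 1; assumption))
  qed
  then obtain T where T: "\<And>a. a \<in> A \<Longrightarrow> good a (T a)" by metis
  note Tg = T[unfolded good_def]
  have idem: "(\<Sum>g\<in>E. T a b e g * T a b g f) = T a b e f" if "a \<in> A" "b \<in> B" "e \<in> E" "f \<in> E" for a b e f
    by (rule Tg[OF that(1), THEN conjunct1, rule_format, OF that(2-4)])
  have herm: "T a b f e = cnj (T a b e f)" if "a \<in> A" "b \<in> B" "e \<in> E" "f \<in> E" for a b e f
    by (rule Tg[OF that(1), THEN conjunct2, THEN conjunct1, rule_format, OF that(2-4)])
  have one: "(\<Sum>b\<in>B. T a b e f) = (if e = f then 1 else 0)" if "a \<in> A" "e \<in> E" "f \<in> E" for a e f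
    by (rule Tg[OF that(1), THEN conjunct2, THEN conjunct2, THEN conjunct1, rule_format, OF that(2-3)])
  have c: "cmpt F [hspace E, point a] [point b] = rows_fixed_by E (T a b) a b" if "a \<in> A" "b \<in> B" for a b
    by (rule Tg[OF that(1), THEN conjunct2, THEN conjunct2, THEN conjunct2, rule_format, OF that(2)])
  define p where "p = restrict (\<lambda>(a, b). op_mat E (T a b)) (A \<times> B)"
  have pr: "p (a, b) \<in> projections" if "a \<in> A" "b \<in> B" for a b
  proof -
    have "op_mat E (T a b) \<in> projections"
      by (rule op_mat_projection[OF onb]) (erule (1) idem[OF that], erule (1) herm[OF that])
    then show ?thesis using that by (simp add: p_def)
  qed
  have mat: "cinner e (p (a, b) f) = T a b e f" if "a \<in> A" "b \<in> B" "e \<in> E" "f \<in> E" for a b e f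
    using mat_op_mat[OF onb] that by (simp add: p_def)
  have pfam: "p \<in> A \<times> B \<rightarrow>\<^sub>E projections" using pr by (auto simp: p_def)
  have "sums_to_one A B p" unfolding sums_to_one_def
  proof
    fix a assume a: "a \<in> A"
    show "(\<Sum>b\<in>B. p (a, b)) = id"
      using sum_projections_iff[OF onb, of B "\<lambda>b. p (a, b)"] pr[OF a] mat[OF a] one[OF a] by simp
  qed
  moreover have "F = family_to_rel E A B p"
  proof (rule brel_eqI[OF FB family_to_rel_in_brels])
    fix X Y :: "('h, 'v) label atom list"
    assume X: "X \<in> listset [{hspace E}, classical A]" and Y: "Y \<in> listset [classical B]"
    obtain a where a: "a \<in> A" "X = [hspace E, point a]" using X by (rule in_classical_pair)
    obtain b where b: "b \<in> B" "Y = [point b]" using Y by (rule in_classical_single)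
    have "rows_fixed_by E (T a b) a b = rows_fixed_by E (\<lambda>e f. cinner e (p (a, b) f)) a b"
      unfolding rows_fixed_by_def using mat[OF a(1) b(1)] by simp
    then show "cmpt F X Y = cmpt (family_to_rel E A B p) X Y"
      using c[OF a(1) b(1)] cmpt_family_to_rel[of E p a b A B, OF onb pr[OF a(1) b(1)] a(1) b(1)] unfolding a(2) b(2) by simp
  qed
  ultimately show "F \<in> family_to_rel E A B ` {p \<in> A \<times> B \<rightarrow>\<^sub>E (projections :: ('h \<Rightarrow> 'h) set). sums_to_one A B p}"
    using pfam by blast
qed

section \<open>Atomic formulas with composite terms\<close>

lemma perp_UN_perp_perp:
  assumes "\<And>i. i \<in> I \<Longrightarrow> U i \<subseteq> L X []"
  shows "perp X (\<Union>i\<in>I. perp X (perp X (U i))) = perp X (\<Union>i\<in>I. U i)"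
  unfolding perp_UN using assms perp_perp_perp by blast

lemma good_ctx_pair:
  assumes g: "good_ctx hs Cs \<alpha>"
    and v: "v \<notin> set (Cs @ hs)" "v' \<notin> set (Cs @ hs)" "v \<noteq> v'" "vsort v' = dual (vsort v)"
      "\<And>A. A \<in> vsort v \<Longrightarrow> one_dim A"
    and A: "A \<in> vsort v"
  shows "good_ctx hs (v # v' # Cs) (\<alpha>(v' := dual_atom A, v := A))"
proof (rule good_ctx_Cons[OF good_ctx_Cons[OF g v(2)]])
  show "one_dim B" if "B \<in> vsort v'" for B
    using that v(4) v(5)[of "dual_atom B"] by (simp add: in_dual)
qed (use v A in auto)

lemma wf_fm_ForallEq:
  assumes v: "v \<notin> set \<Gamma>" "v' \<notin> set \<Gamma>" "v \<noteq> v'" "vsort v' = dual (vsort v)"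
      "\<And>A. A \<in> vsort v \<Longrightarrow> finite (basis A)"
    and wf: "wf_fm \<phi> (v # v' # \<Gamma>)"
  shows "wf_fm (ForallEq v v' \<phi>) \<Gamma>" "wf_fm (ExistsEq v v' \<phi>) \<Gamma>"
proof -
  have "finite (basis A)" if "A \<in> vsort v'" for A
    using that v(4) v(5)[of "dual_atom A"] by (simp add: in_dual)
  then show "wf_fm (ForallEq v v' \<phi>) \<Gamma>" "wf_fm (ExistsEq v v' \<phi>) \<Gamma>"
    using assms rel_eq_in_brels by (auto simp: ForallEq_def ExistsEq_def Imp_def Or_def)
qed

text \<open>
  The quantifier prefix of an atomic formula with two terms.  The inner double complements are
  absorbed by the outer one.
\<close>

lemma val_ExistsEq_ExistsEq:
  assumes g: "good_ctx hs Cs \<alpha>"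
    and dist: "distinct ([u, u', v, v'] @ Cs @ hs)"
    and u: "vsort u' = dual (vsort u)" "\<And>A. A \<in> vsort u \<Longrightarrow> one_dim A"
    and v: "vsort v' = dual (vsort v)" "\<And>A. A \<in> vsort v \<Longrightarrow> one_dim A"
    and wf: "wf_fm \<phi> (u # u' # v # v' # Cs @ hs)"
  shows "val hs (ExistsEq v v' (ExistsEq u u' \<phi>)) Cs \<alpha> = perp (map \<alpha> hs) (perp (map \<alpha> hs)
    (\<Union>B\<in>vsort v. \<Union>A\<in>vsort u. val hs \<phi> (u # u' # v # v' # Cs)
      (\<alpha>(v' := dual_atom B, v := B, u' := dual_atom A, u := A))))"
proof -
  let ?X = "map \<alpha> hs"
  have fin: "finite (basis A)" if "one_dim A" for A using basis_one_dim[OF that] by simp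
  have wf1: "wf_fm (ExistsEq u u' \<phi>) (v # v' # Cs @ hs)"
    by (rule wf_fm_ForallEq(2)) (use dist u fin wf in auto)
  let ?U = "\<lambda>B. \<Union>A\<in>vsort u. val hs \<phi> (u # u' # v # v' # Cs)
      (\<alpha>(v' := dual_atom B, v := B, u' := dual_atom A, u := A))"
  have 1: "val hs (ExistsEq u u' \<phi>) (v # v' # Cs) (\<alpha>(v' := dual_atom B, v := B)) = perp ?X (perp ?X (?U B))"
    if B: "B \<in> vsort v" for B
  proof -
    have X: "map (\<alpha>(v' := dual_atom B, v := B)) hs = ?X" using dist by auto
    have g1: "good_ctx hs (v # v' # Cs) (\<alpha>(v' := dual_atom B, v := B))"
      by (rule good_ctx_pair[OF g]) (use dist v B in auto)
    show ?thesis
      unfolding X[symmetric]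
      by (rule val_ExistsEq[OF g1]) (use dist u wf in auto)
  qed
  have "?U B \<subseteq> L ?X []" if "B \<in> vsort v" for B
  proof -
    have X: "map (\<alpha>(v' := dual_atom B, v := B, u' := dual_atom A, u := A)) hs = ?X" for A using dist by auto
    show ?thesis
    proof (rule UN_least)
      fix A
      show "val hs \<phi> (u # u' # v # v' # Cs)
          (\<alpha>(v' := dual_atom B, v := B, u' := dual_atom A, u := A)) \<subseteq> L ?X []"
        unfolding X[of A, symmetric] by (rule val_subset_L)
    qed
  qed
  then have 2: "perp ?X (\<Union>B\<in>vsort v. perp ?X (perp ?X (?U B))) = perp ?X (\<Union>B\<in>vsort v. ?U B)"
    by (rule perp_UN_perp_perp)
  have "val hs (ExistsEq v v' (ExistsEq u u' \<phi>)) Cs \<alpha> =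
    perp ?X (perp ?X (\<Union>B\<in>vsort v. val hs (ExistsEq u u' \<phi>) (v # v' # Cs) (\<alpha>(v' := dual_atom B, v := B))))"
    by (rule val_ExistsEq[OF g]) (use dist v wf1 in auto)
  then show ?thesis using 1 2 by simp
qed

lemma atomic_variables: "atomic R [V u, V v] = Rel R [u, v]"
  by (simp add: atomic_def)

lemma atomic_App_variable:
  "atomic R [App F [V u, V v], V w] =
    ExistsEq (Var (vsort w) 1 2) (Var (dual (vsort w)) 1 3)
     (ExistsEq (Var (hd (tgt F)) 1 0) (Var (dual (hd (tgt F))) 1 1)
       (Conj (Conj (Rel R [Var (hd (tgt F)) 1 0, Var (vsort w) 1 2])
         (Rel (rel_hat F) [u, v, Var (dual (hd (tgt F))) 1 1]))
         (Rel (rel_eq (vsort w)) [w, Var (dual (vsort w)) 1 3])))"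
  by (simp add: atomic_def Let_def numeral_2_eq_2 numeral_3_eq_3)

lemma atomic_App_App:
  "atomic R [App F [V u, V v], App G [V s, V t]] =
    ExistsEq (Var (hd (tgt G)) 1 2) (Var (dual (hd (tgt G))) 1 3)
     (ExistsEq (Var (hd (tgt F)) 1 0) (Var (dual (hd (tgt F))) 1 1)
       (Conj (Conj (Rel R [Var (hd (tgt F)) 1 0, Var (hd (tgt G)) 1 2])
         (Rel (rel_hat F) [u, v, Var (dual (hd (tgt F))) 1 1]))
         (Rel (rel_hat G) [s, t, Var (dual (hd (tgt G))) 1 3])))"
  by (simp add: atomic_def Let_def numeral_2_eq_2 numeral_3_eq_3)

lemma op_conj_rows_fixed_by:
  "op_conj ` rows_fixed_by E M a b = rows_fixed_by E (\<lambda>e f. cnj (M e f)) a b"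
proof (intro equalityI subsetI)
  fix r assume "r \<in> op_conj ` rows_fixed_by E M a b"
  then obtain s where s: "r = op_conj s" "s \<in> rows_fixed_by E M a b" by blast
  have "s [Inr b] [Inl f, Inr a] = (\<Sum>e\<in>E. s [Inr b] [Inl e, Inr a] * M e f)" if "f \<in> E" for f
    using s that by (simp add: rows_fixed_by_def)
  then show "r \<in> rows_fixed_by E (\<lambda>e f. cnj (M e f)) a b"
    using s op_conj_in_L unfolding rows_fixed_by_def
    by (auto simp: op_conj_eq simp flip: cnj_sum complex_cnj_mult)
next
  fix r assume r: "r \<in> rows_fixed_by E (\<lambda>e f. cnj (M e f)) a b"
  have "r [Inr b] [Inl f, Inr a] = (\<Sum>e\<in>E. r [Inr b] [Inl e, Inr a] * cnj (M e f))" if "f \<in> E" for f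
    using r that by (simp add: rows_fixed_by_def)
  then have "cnj (r [Inr b] [Inl f, Inr a]) = (\<Sum>e\<in>E. cnj (r [Inr b] [Inl e, Inr a]) * M e f)" if "f \<in> E" for f
    using that by simp
  then have "op_conj r \<in> rows_fixed_by E M a b"
    using r op_conj_in_L unfolding rows_fixed_by_def by (auto simp: op_conj_eq)
  moreover have "r = op_conj (op_conj r)" by (simp add: op_conj_eq)
  ultimately show "r \<in> op_conj ` rows_fixed_by E M a b" by blast
qed

lemma idx_hspace_point_point:
  assumes "basis A = Inl ` E" "basis B = {Inr a}" "basis C = {Inr b}"
  shows "idx [A, B, C] = (\<lambda>e. [Inl e, Inr a, Inr b]) ` E"
  using assms by (auto simp: in_idx list_all2_Cons2)

lemma in_bend_rows_fixed_by:
  assumes fin: "finite E" and X: "basis A = Inl ` E" "basis B = {Inr a}" "basis C = {Inr b}"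
    and G: "G \<in> L [A, B, C] []"
  shows "G \<in> bend 2 ` rows_fixed_by E M a b \<longleftrightarrow>
    (\<forall>f\<in>E. G [] [Inl f, Inr a, Inr b] = (\<Sum>e\<in>E. G [] [Inl e, Inr a, Inr b] * M e f))"
proof
  assume "G \<in> bend 2 ` rows_fixed_by E M a b"
  then obtain r where r: "G = bend 2 r" "r \<in> rows_fixed_by E M a b" by blast
  then show "\<forall>f\<in>E. G [] [Inl f, Inr a, Inr b] = (\<Sum>e\<in>E. G [] [Inl e, Inr a, Inr b] * M e f)"
    by (simp add: bend_def rows_fixed_by_def)
next
  assume *: "\<forall>f\<in>E. G [] [Inl f, Inr a, Inr b] = (\<Sum>e\<in>E. G [] [Inl e, Inr a, Inr b] * M e f)"
  let ?r = "unrow E a b (\<lambda>e. G [] [Inl e, Inr a, Inr b])"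
  have r: "?r \<in> rows_fixed_by E M a b"
    using * fin unrow_in_L[of E a b] unfolding rows_fixed_by_def by (simp add: unrow_apply)
  have "G = bend 2 ?r"
  proof (intro ext)
    fix u k
    show "G u k = bend 2 ?r u k"
    proof (cases "u = [] \<and> k \<in> idx [A, B, C]")
      case True
      then show ?thesis unfolding idx_hspace_point_point[OF X] using fin by (auto simp: bend_def unrow_apply)
    next
      case False
      have 0: "G u k = 0" using False G[unfolded L_iff, rule_format, of u k] by argo
      have "bend 2 ?r u k = 0"
      proof (rule ccontr)
        assume nz: "bend 2 ?r u k \<noteq> 0"
        then have u: "u = []" and "?r (drop 2 k) (take 2 k) \<noteq> 0" by (auto simp: bend_def split: if_splits)
        then have "drop 2 k \<in> idx [point b] \<and> take 2 k \<in> idx [hspace E, point a]"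
          using unrow_in_L[of E a b, unfolded L_def mem_Collect_eq, rule_format] by blast
        then obtain e where "drop 2 k = [Inr b]" "take 2 k = [Inl e, Inr a]" "e \<in> E"
          unfolding idx_point idx_hspace_point by auto
        then have "k = [Inl e, Inr a] @ [Inr b]" by (metis append_take_drop_id)
        then have "k \<in> idx [A, B, C]" unfolding idx_hspace_point_point[OF X] using \<open>e \<in> E\<close> by simp
        then show False using False u by simp
      qed
      then show ?thesis using 0 by simp
    qed
  qed
  then show "G \<in> bend 2 ` rows_fixed_by E M a b" using r by blast
qed

text \<open>
  This is the meaning of \<open>F\<close>, or of its conjugate, applied to a nonclassical variable
  \<open>u\<close> and a classical one \<open>v\<close>, with value \<open>w\<close>: with the other variables fixed, the
  functional of \<open>u\<close> is a row that \<open>M\<close> fixes.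
\<close>

lemma val_Rel_bend:
  assumes g: "good_ctx hs Cs \<alpha>" and wf: "wf_fm (Rel R [u, v, w]) (Cs @ hs)"
    and vw: "v \<in> set Cs" "w \<in> set Cs" and fin: "finite E"
    and X: "basis (\<alpha> u) = Inl ` E" "basis (\<alpha> v) = {Inr a}" "basis (\<alpha> w) = {Inr b}"
    and R: "cmpt R [\<alpha> u, \<alpha> v, \<alpha> w] [] = bend 2 ` rows_fixed_by E M a b"
  shows "val hs (Rel R [u, v, w]) Cs \<alpha> = {m \<in> L (map \<alpha> hs) [].
    \<forall>\<eta>. (\<forall>v\<in>set (Cs @ hs). \<eta> v \<in> basis (\<alpha> v)) \<longrightarrow>
      (\<forall>f\<in>E. m [] (map (\<eta>(u := Inl f)) hs) = (\<Sum>e\<in>E. m [] (map (\<eta>(u := Inl e)) hs) * M e f))}"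
proof -
  let ?G = "\<lambda>m \<eta> k y. if y \<in> idx (map \<alpha> [u, v, w]) then m k (map (override \<eta> [u, v, w] y) hs) else 0"
  have dis: "u \<noteq> v" "u \<noteq> w" "v \<noteq> w" using wf by auto
  have nin: "v \<notin> set hs" "w \<notin> set hs" using good_ctxD(3)[OF g] vw by auto
  have ov: "map (override \<eta> [u, v, w] [Inl e, Inr a, Inr b]) hs = map (\<eta>(u := Inl e)) hs" for \<eta> e
    using nin by (intro map_cong) auto
  have idx3: "idx (map \<alpha> [u, v, w]) = (\<lambda>e. [Inl e, Inr a, Inr b]) ` E"
    using idx_hspace_point_point[OF X] by simp
  have "?G m \<eta> \<in> cmpt R (map \<alpha> [u, v, w]) [] \<longleftrightarrow>
      (\<forall>f\<in>E. m [] (map (\<eta>(u := Inl f)) hs) = (\<Sum>e\<in>E. m [] (map (\<eta>(u := Inl e)) hs) * M e f))"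
    if m: "m \<in> L (map \<alpha> hs) []" for m \<eta>
  proof -
    have GL: "?G m \<eta> \<in> L [\<alpha> u, \<alpha> v, \<alpha> w] []"
      using m unfolding L_iff by auto
    have app: "?G m \<eta> [] [Inl e, Inr a, Inr b] = m [] (map (\<eta>(u := Inl e)) hs)" if "e \<in> E" for e
      unfolding idx3 ov using that by simp
    have "?G m \<eta> \<in> cmpt R (map \<alpha> [u, v, w]) [] \<longleftrightarrow>
      (\<forall>f\<in>E. ?G m \<eta> [] [Inl f, Inr a, Inr b] = (\<Sum>e\<in>E. ?G m \<eta> [] [Inl e, Inr a, Inr b] * M e f))"
      using in_bend_rows_fixed_by[OF fin X GL, of M] R by (simp only: list.map)
    also have "\<dots> \<longleftrightarrow> (\<forall>f\<in>E. m [] (map (\<eta>(u := Inl f)) hs) = (\<Sum>e\<in>E. m [] (map (\<eta>(u := Inl e)) hs) * M e f))"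
      using app by (intro ball_cong refl arg_cong2[of _ _ _ _ "(=)"] sum.cong arg_cong2[of _ _ _ _ "(*)"])
    finally show ?thesis .
  qed
  then show ?thesis unfolding val_Rel[OF g wf] by blast
qed

lemma good_ctx_choice:
  assumes "good_ctx hs Cs \<alpha>" "\<And>v. v \<in> set hs \<Longrightarrow> basis (\<alpha> v) \<noteq> {}"
  obtains \<eta> where "\<And>v. v \<in> set (Cs @ hs) \<Longrightarrow> \<eta> v \<in> basis (\<alpha> v)"
proof
  fix v assume v: "v \<in> set (Cs @ hs)"
  have "basis (\<alpha> v) \<noteq> {}"
    using v good_ctxD(4)[OF assms(1), of v] assms(2)[of v] by (auto simp: one_dim_def)
  then show "(SOME l. l \<in> basis (\<alpha> v)) \<in> basis (\<alpha> v)" by (simp add: some_in_eq)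
qed

lemma val_Rel_bend_single:
  assumes g: "good_ctx [x] Cs \<alpha>" and wf: "wf_fm (Rel R [x, v, w]) (Cs @ [x])"
    and vw: "v \<in> set Cs" "w \<in> set Cs" and E: "finite E" "E \<noteq> {}"
    and X: "basis (\<alpha> x) = Inl ` E" "basis (\<alpha> v) = {Inr a}" "basis (\<alpha> w) = {Inr b}"
    and R: "cmpt R [\<alpha> x, \<alpha> v, \<alpha> w] [] = bend 2 ` rows_fixed_by E M a b"
  shows "val [x] (Rel R [x, v, w]) Cs \<alpha> = {m \<in> L (map \<alpha> [x]) [].
    \<forall>f\<in>E. m [] [Inl f] = (\<Sum>e\<in>E. m [] [Inl e] * M e f)}"
  unfolding val_Rel_bend[OF g wf vw E(1) X R]
proof (intro Collect_cong conj_cong refl iffI)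
  fix m assume *: "\<forall>\<eta>. (\<forall>v\<in>set (Cs @ [x]). \<eta> v \<in> basis (\<alpha> v)) \<longrightarrow>
    (\<forall>f\<in>E. m [] (map (\<eta>(x := Inl f)) [x]) = (\<Sum>e\<in>E. m [] (map (\<eta>(x := Inl e)) [x]) * M e f))"
  have "basis (\<alpha> v) \<noteq> {}" if "v \<in> set [x]" for v using that X(1) E by auto
  then obtain \<eta> where "\<And>v. v \<in> set (Cs @ [x]) \<Longrightarrow> \<eta> v \<in> basis (\<alpha> v)"
    using good_ctx_choice[OF g] by blast
  then have "\<forall>v\<in>set (Cs @ [x]). \<eta> v \<in> basis (\<alpha> v)" by blast
  from *[THEN spec, THEN mp, OF this]
  show "\<forall>f\<in>E. m [] [Inl f] = (\<Sum>e\<in>E. m [] [Inl e] * M e f)" by simp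
qed simp

lemma good_ctx_pair_choice:
  assumes g: "good_ctx [x, x'] Cs \<alpha>" and E: "E \<noteq> {}"
    and X: "basis (\<alpha> x) = Inl ` E" "basis (\<alpha> x') = Inl ` E" and u: "u \<in> {x, x'}" and e: "e \<in> E"
  obtains \<eta> where "\<forall>v\<in>set (Cs @ [x, x']). \<eta> v \<in> basis (\<alpha> v)" "\<eta> u = Inl e"
proof -
  have "basis (\<alpha> v) \<noteq> {}" if "v \<in> set [x, x']" for v using that X E by auto
  then obtain \<eta> where \<eta>: "\<And>v. v \<in> set (Cs @ [x, x']) \<Longrightarrow> \<eta> v \<in> basis (\<alpha> v)"
    using good_ctx_choice[OF g] by blast
  have "\<forall>v\<in>set (Cs @ [x, x']). (\<eta>(u := Inl e)) v \<in> basis (\<alpha> v)" using \<eta> e u X by auto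
  then show thesis by (rule that) simp
qed

lemma val_Rel_bend_fst:
  assumes g: "good_ctx [x, x'] Cs \<alpha>" and wf: "wf_fm (Rel R [x, v, w]) (Cs @ [x, x'])"
    and vw: "v \<in> set Cs" "w \<in> set Cs" and E: "finite E" "E \<noteq> {}"
    and X: "basis (\<alpha> x) = Inl ` E" "basis (\<alpha> x') = Inl ` E" "basis (\<alpha> v) = {Inr a}" "basis (\<alpha> w) = {Inr b}"
    and R: "cmpt R [\<alpha> x, \<alpha> v, \<alpha> w] [] = bend 2 ` rows_fixed_by E M a b"
  shows "val [x, x'] (Rel R [x, v, w]) Cs \<alpha> = {m \<in> L (map \<alpha> [x, x']) [].
    \<forall>f'\<in>E. \<forall>f\<in>E. m [] [Inl f, Inl f'] = (\<Sum>e\<in>E. m [] [Inl e, Inl f'] * M e f)}"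
  unfolding val_Rel_bend[OF g wf vw E(1) X(1,3,4) R]
proof (intro Collect_cong conj_cong refl iffI)
  have nx: "x \<noteq> x'" "x' \<noteq> x" using good_ctxD(3)[OF g] by auto
  fix m
  show "\<forall>f'\<in>E. \<forall>f\<in>E. m [] [Inl f, Inl f'] = (\<Sum>e\<in>E. m [] [Inl e, Inl f'] * M e f)"
    if l: "\<forall>\<eta>. (\<forall>v\<in>set (Cs @ [x, x']). \<eta> v \<in> basis (\<alpha> v)) \<longrightarrow> (\<forall>f\<in>E. m [] (map (\<eta>(x := Inl f)) [x, x']) =
      (\<Sum>e\<in>E. m [] (map (\<eta>(x := Inl e)) [x, x']) * M e f))"
  proof
    fix f' assume "f' \<in> E"
    then obtain \<eta> where \<eta>: "\<forall>v\<in>set (Cs @ [x, x']). \<eta> v \<in> basis (\<alpha> v)" "\<eta> x' = Inl f'"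
      using good_ctx_pair_choice[OF g E(2) X(1,2), of x'] by blast
    show "\<forall>f\<in>E. m [] [Inl f, Inl f'] = (\<Sum>e\<in>E. m [] [Inl e, Inl f'] * M e f)"
      using l[THEN spec, THEN mp, OF \<eta>(1)] \<eta>(2) nx by simp
  qed
  show "\<forall>\<eta>. (\<forall>v\<in>set (Cs @ [x, x']). \<eta> v \<in> basis (\<alpha> v)) \<longrightarrow> (\<forall>f\<in>E. m [] (map (\<eta>(x := Inl f)) [x, x']) =
      (\<Sum>e\<in>E. m [] (map (\<eta>(x := Inl e)) [x, x']) * M e f))"
    if r: "\<forall>f'\<in>E. \<forall>f\<in>E. m [] [Inl f, Inl f'] = (\<Sum>e\<in>E. m [] [Inl e, Inl f'] * M e f)"
  proof (intro allI impI)
    fix \<eta> assume "\<forall>v\<in>set (Cs @ [x, x']). \<eta> v \<in> basis (\<alpha> v)"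
    then have "\<eta> x' \<in> Inl ` E" unfolding X(2)[symmetric] by simp
    then obtain f' where "f' \<in> E" "\<eta> x' = Inl f'" by blast
    then show "\<forall>f\<in>E. m [] (map (\<eta>(x := Inl f)) [x, x']) = (\<Sum>e\<in>E. m [] (map (\<eta>(x := Inl e)) [x, x']) * M e f)"
      using r[rule_format, of f'] nx by simp
  qed
qed

lemma val_Rel_bend_snd:
  assumes g: "good_ctx [x, x'] Cs \<alpha>" and wf: "wf_fm (Rel R [x', v, w]) (Cs @ [x, x'])"
    and vw: "v \<in> set Cs" "w \<in> set Cs" and E: "finite E" "E \<noteq> {}"
    and X: "basis (\<alpha> x) = Inl ` E" "basis (\<alpha> x') = Inl ` E" "basis (\<alpha> v) = {Inr a}" "basis (\<alpha> w) = {Inr b}"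
    and R: "cmpt R [\<alpha> x', \<alpha> v, \<alpha> w] [] = bend 2 ` rows_fixed_by E M a b"
  shows "val [x, x'] (Rel R [x', v, w]) Cs \<alpha> = {m \<in> L (map \<alpha> [x, x']) [].
    \<forall>e\<in>E. \<forall>f\<in>E. m [] [Inl e, Inl f] = (\<Sum>g\<in>E. m [] [Inl e, Inl g] * M g f)}"
  unfolding val_Rel_bend[OF g wf vw E(1) X(2,3,4) R]
proof (intro Collect_cong conj_cong refl iffI)
  have nx: "x \<noteq> x'" "x' \<noteq> x" using good_ctxD(3)[OF g] by auto
  fix m
  show "\<forall>e\<in>E. \<forall>f\<in>E. m [] [Inl e, Inl f] = (\<Sum>g\<in>E. m [] [Inl e, Inl g] * M g f)"
    if l: "\<forall>\<eta>. (\<forall>v\<in>set (Cs @ [x, x']). \<eta> v \<in> basis (\<alpha> v)) \<longrightarrow> (\<forall>f\<in>E. m [] (map (\<eta>(x' := Inl f)) [x, x']) =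
      (\<Sum>e\<in>E. m [] (map (\<eta>(x' := Inl e)) [x, x']) * M e f))"
  proof
    fix e assume "e \<in> E"
    then obtain \<eta> where \<eta>: "\<forall>v\<in>set (Cs @ [x, x']). \<eta> v \<in> basis (\<alpha> v)" "\<eta> x = Inl e"
      using good_ctx_pair_choice[OF g E(2) X(1,2), of x] by blast
    show "\<forall>f\<in>E. m [] [Inl e, Inl f] = (\<Sum>g\<in>E. m [] [Inl e, Inl g] * M g f)"
      using l[THEN spec, THEN mp, OF \<eta>(1)] \<eta>(2) nx by simp
  qed
  show "\<forall>\<eta>. (\<forall>v\<in>set (Cs @ [x, x']). \<eta> v \<in> basis (\<alpha> v)) \<longrightarrow> (\<forall>f\<in>E. m [] (map (\<eta>(x' := Inl f)) [x, x']) =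
      (\<Sum>e\<in>E. m [] (map (\<eta>(x' := Inl e)) [x, x']) * M e f))"
    if r: "\<forall>e\<in>E. \<forall>f\<in>E. m [] [Inl e, Inl f] = (\<Sum>g\<in>E. m [] [Inl e, Inl g] * M g f)"
  proof (intro allI impI)
    fix \<eta> assume "\<forall>v\<in>set (Cs @ [x, x']). \<eta> v \<in> basis (\<alpha> v)"
    then have "\<eta> x \<in> Inl ` E" unfolding X(1)[symmetric] by simp
    then obtain e where "e \<in> E" "\<eta> x = Inl e" by blast
    then show "\<forall>f\<in>E. m [] (map (\<eta>(x' := Inl f)) [x, x']) = (\<Sum>e\<in>E. m [] (map (\<eta>(x' := Inl e)) [x, x']) * M e f)"
      using r[rule_format, of e] nx by simp
  qed
qed

section \<open>The evaluation functional and products of projections\<close>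

lemma pairing_sum_left: "pairing X (\<Sum>c\<in>C. N c) m = (\<Sum>c\<in>C. pairing X (N c) m)"
proof -
  have app: "(\<Sum>c\<in>C. N c) u j = (\<Sum>c\<in>C. N c u j)" for u j
    by (simp add: sum_fun_apply)
  show ?thesis
    unfolding pairing_def app cnj_sum sum_distrib_right by (rule sum.swap)
qed

text \<open>
  For \<open>m\<close> in \<open>W c\<close> only the summand \<open>N c\<close> of \<open>\<epsilon>\<close> pairs with \<open>m\<close>.
  In particular \<open>\<epsilon>\<close> and \<open>N c\<close> pair to the squared norm of \<open>N c\<close>.  So if
  \<open>\<epsilon>\<close> is orthogonal to \<open>W c\<close>, then \<open>N c\<close> vanishes; and if \<open>c\<close> is not in
  \<open>S\<close>, then \<open>N c\<close> is orthogonal to all the \<open>W c'\<close> with \<open>c'\<close> in \<open>S\<close>, hence to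
  \<open>\<epsilon>\<close> if that lies in their closed sum, and again \<open>N c\<close> vanishes.  Conversely, if the
  \<open>N c\<close> outside \<open>S\<close> vanish, then \<open>\<epsilon>\<close> is a sum of elements of the \<open>W c\<close> with
  \<open>c\<close> in \<open>S\<close>.
\<close>

lemma resolution_perp:
  assumes fin: "finite (idx X)" "finite C" and eps: "\<epsilon> = (\<Sum>c\<in>C. N c)"
    and W: "\<And>c. c \<in> C \<Longrightarrow> W c \<subseteq> L X []" "\<And>c. c \<in> C \<Longrightarrow> N c \<in> W c"
    and orth: "\<And>c c' m. c \<in> C \<Longrightarrow> c' \<in> C \<Longrightarrow> c \<noteq> c' \<Longrightarrow> m \<in> W c \<Longrightarrow> pairing X (N c') m = 0"
    and S: "S \<subseteq> C"
  shows "\<epsilon> \<in> perp X (\<Union>c\<in>S. W c) \<longleftrightarrow> (\<forall>c\<in>S. N c = 0)"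
    and "\<epsilon> \<in> perp X (perp X (\<Union>c\<in>S. W c)) \<longleftrightarrow> (\<forall>c\<in>C - S. N c = 0)"
proof -
  have NL: "N c \<in> L X []" if "c \<in> C" for c using W that by blast
  have eL: "\<epsilon> \<in> L X []" unfolding eps by (intro oper.subspace_sum subspace_L NL)
  have ep: "pairing X \<epsilon> m = pairing X (N c) m" if "c \<in> C" "m \<in> W c" for c m
  proof -
    have "pairing X \<epsilon> m = (\<Sum>c'\<in>{c}. pairing X (N c') m)"
      unfolding eps pairing_sum_left
      by (rule sum.mono_neutral_right) (use that fin orth in auto)
    then show ?thesis by simp
  qed
  have zero: "N c = 0" if "c \<in> C" "pairing X (N c) \<epsilon> = 0" for c
  proof -
    have "pairing X (N c) (N c) = 0"
      using ep[OF that(1) W(2)[OF that(1)]] that(2) pairing_commute[of X \<epsilon> "N c"] by simp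
    then show ?thesis using pairing_self[OF fin(1) NL[OF that(1)]] by simp
  qed
  have p0: "pairing X 0 m = 0" for m by (simp add: pairing_def)
  show "\<epsilon> \<in> perp X (\<Union>c\<in>S. W c) \<longleftrightarrow> (\<forall>c\<in>S. N c = 0)"
  proof
    assume *: "\<epsilon> \<in> perp X (\<Union>c\<in>S. W c)"
    show "\<forall>c\<in>S. N c = 0"
    proof
      fix c assume c: "c \<in> S"
      then have "pairing X (N c) \<epsilon> = 0" using * W S unfolding perp_def by blast
      then show "N c = 0" using zero c S by blast
    qed
  next
    assume N: "\<forall>c\<in>S. N c = 0"
    have "pairing X m \<epsilon> = 0" if "c \<in> S" "m \<in> W c" for c m
    proof -
      have "pairing X \<epsilon> m = 0" using ep[of c m] that S N p0 by auto
      then show ?thesis using pairing_commute[of X m \<epsilon>] by simp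
    qed
    then show "\<epsilon> \<in> perp X (\<Union>c\<in>S. W c)" using eL unfolding perp_def by blast
  qed
  show "\<epsilon> \<in> perp X (perp X (\<Union>c\<in>S. W c)) \<longleftrightarrow> (\<forall>c\<in>C - S. N c = 0)"
  proof
    assume *: "\<epsilon> \<in> perp X (perp X (\<Union>c\<in>S. W c))"
    show "\<forall>c\<in>C - S. N c = 0"
    proof
      fix c assume c: "c \<in> C - S"
      have "pairing X m (N c) = 0" if "c' \<in> S" "m \<in> W c'" for c' m
      proof -
        have "pairing X (N c) m = 0" using orth[of c' c m] that c S by blast
        then show ?thesis using pairing_commute[of X m "N c"] by simp
      qed
      then have "N c \<in> perp X (\<Union>c\<in>S. W c)" using NL c unfolding perp_def by blast
      then have "pairing X (N c) \<epsilon> = 0" using * unfolding perp_def by blast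
      then show "N c = 0" using zero c by blast
    qed
  next
    assume N: "\<forall>c\<in>C - S. N c = 0"
    have sub: "oper.subspace (perp X (perp X (\<Union>c\<in>S. W c)))"
      unfolding perp_def[of X "perp X _"] by (rule subspace_pairing)
    have "N c \<in> perp X (perp X (\<Union>c\<in>S. W c))" if "c \<in> C" for c
    proof (cases "c \<in> S")
      case True
      have "(\<Union>c\<in>S. W c) \<subseteq> L X []" using W S by blast
      then show ?thesis using subset_perp_perp W(2)[OF that] True by blast
    next
      case False
      then show ?thesis using N that oper.subspace_0[OF sub] by simp
    qed
    then show "\<epsilon> \<in> perp X (perp X (\<Union>c\<in>S. W c))"
      unfolding eps by (intro oper.subspace_sum[OF sub]) auto
  qed
qed

lemma val_ForallEq_ForallEq:
  assumes g: "good_ctx hs Cs \<alpha>"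
    and dist: "distinct ([u, u', v, v'] @ Cs @ hs)"
    and u: "vsort u' = dual (vsort u)" "\<And>A. A \<in> vsort u \<Longrightarrow> one_dim A"
    and v: "vsort v' = dual (vsort v)" "\<And>A. A \<in> vsort v \<Longrightarrow> one_dim A"
    and wf: "wf_fm \<phi> (u # u' # v # v' # Cs @ hs)"
  shows "val hs (ForallEq v v' (ForallEq u u' \<phi>)) Cs \<alpha> = {m \<in> L (map \<alpha> hs) [].
    \<forall>B\<in>vsort v. \<forall>A\<in>vsort u. m \<in> perp (map \<alpha> hs) (perp (map \<alpha> hs) (val hs \<phi> (u # u' # v # v' # Cs)
      (\<alpha>(v' := dual_atom B, v := B, u' := dual_atom A, u := A))))}"
proof -
  let ?X = "map \<alpha> hs"
  have fin: "finite (basis A)" if "one_dim A" for A using basis_one_dim[OF that] by simp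
  have wf1: "wf_fm (ForallEq u u' \<phi>) (v # v' # Cs @ hs)"
    by (rule wf_fm_ForallEq(1)) (use dist u fin wf in auto)
  let ?U = "\<lambda>B A. val hs \<phi> (u # u' # v # v' # Cs)
      (\<alpha>(v' := dual_atom B, v := B, u' := dual_atom A, u := A))"
  have 1: "val hs (ForallEq u u' \<phi>) (v # v' # Cs) (\<alpha>(v' := dual_atom B, v := B)) =
      perp ?X (\<Union>A\<in>vsort u. perp ?X (?U B A))"
    if B: "B \<in> vsort v" for B
  proof -
    have X: "map (\<alpha>(v' := dual_atom B, v := B)) hs = ?X" using dist by auto
    have g1: "good_ctx hs (v # v' # Cs) (\<alpha>(v' := dual_atom B, v := B))"
      by (rule good_ctx_pair[OF g]) (use dist v B in auto)
    show ?thesis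
      unfolding X[symmetric] perp_UN
      by (rule val_ForallEq[OF g1]) (use dist u wf in auto)
  qed
  have "(\<Union>A\<in>vsort u. perp ?X (?U B A)) \<subseteq> L ?X []" for B
    using perp_subset_L by (intro UN_least) blast
  note 2 = perp_perp_perp[OF this]
  have "val hs (ForallEq v v' (ForallEq u u' \<phi>)) Cs \<alpha> = {m \<in> L ?X []. \<forall>B\<in>vsort v.
    m \<in> perp ?X (perp ?X (val hs (ForallEq u u' \<phi>) (v # v' # Cs) (\<alpha>(v' := dual_atom B, v := B))))}"
    by (rule val_ForallEq[OF g]) (use dist v wf1 in auto)
  also have "\<dots> = {m \<in> L ?X []. \<forall>B\<in>vsort v. m \<in> perp ?X (\<Union>A\<in>vsort u. perp ?X (?U B A))}"
    using 1 2 by simp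
  also have "\<dots> = {m \<in> L ?X []. \<forall>B\<in>vsort v. \<forall>A\<in>vsort u. m \<in> perp ?X (perp ?X (?U B A))}"
    unfolding perp_UN by blast
  finally show ?thesis .
qed

text \<open>
  The functional on \<open>H \<otimes> H*\<close> with values \<open>K e f\<close> on the basis.
\<close>

definition mat_fun :: "'h set \<Rightarrow> ('h \<Rightarrow> 'h \<Rightarrow> complex) \<Rightarrow> ('h, 'v) label oper" where
  "mat_fun E K = (\<lambda>u j. \<Sum>e\<in>E. \<Sum>f\<in>E. if u = [] \<and> j = [Inl e, Inl f] then K e f else 0)"

lemma idx_hspace_dual: "idx [hspace E, dual_atom (hspace E)] = (\<lambda>(e, f). [Inl e, Inl f]) ` (E \<times> E)"
  by (auto simp: in_idx list_all2_Cons2)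

lemma mat_fun_apply:
  assumes "finite E" "e \<in> E" "f \<in> E" shows "mat_fun E K [] [Inl e, Inl f] = K e f"
proof -
  have "mat_fun E K [] [Inl e, Inl f] = (\<Sum>e'\<in>E. if e' = e then \<Sum>f'\<in>E. if f' = f then K e' f' else 0 else 0)"
    unfolding mat_fun_def by (intro sum.cong refl) (auto intro!: sum.cong)
  then show ?thesis using assms by simp
qed

lemma mat_fun_in_L: "mat_fun E K \<in> L [hspace E, dual_atom (hspace E)] []"
proof -
  have "mat_fun E K u j = 0" if "\<not> (u = [] \<and> j \<in> idx [hspace E, dual_atom (hspace E)])" for u j
    unfolding mat_fun_def using that unfolding idx_hspace_dual by (intro sum.neutral ballI) auto
  then show ?thesis unfolding L_iff by blast
qed

lemma pairing_mat_fun: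
  fixes E :: "'h set" and m :: "('h, 'v) label oper"
  assumes "finite E"
  shows "pairing [hspace E, dual_atom (hspace E)] (mat_fun E K) m =
    (\<Sum>e\<in>E. \<Sum>f\<in>E. cnj (K e f) * m [] [Inl e, Inl f])"
proof -
  have inj: "inj_on (\<lambda>(e, f). [Inl e, Inl f] :: ('h, 'v) label list) (E \<times> E)" by (auto simp: inj_on_def)
  have "pairing [hspace E, dual_atom (hspace E)] (mat_fun E K) m =
    (\<Sum>(e, f)\<in>E \<times> E. cnj ((mat_fun E K :: ('h, 'v) label oper) [] [Inl e, Inl f]) * m [] [Inl e, Inl f])"
    unfolding pairing_def idx_hspace_dual sum.reindex[OF inj] by (simp add: split_def)
  also have "\<dots> = (\<Sum>(e, f)\<in>E \<times> E. cnj (K e f) * m [] [Inl e, Inl f])"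
    by (intro sum.cong refl) (auto simp: mat_fun_apply[OF assms])
  also have "\<dots> = (\<Sum>e\<in>E. \<Sum>f\<in>E. cnj (K e f) * m [] [Inl e, Inl f])"
    by (simp add: sum.cartesian_product)
  finally show ?thesis .
qed

definition mprod :: "'h set \<Rightarrow> ('h \<Rightarrow> 'h \<Rightarrow> complex) \<Rightarrow> ('h \<Rightarrow> 'h \<Rightarrow> complex) \<Rightarrow> 'h \<Rightarrow> 'h \<Rightarrow> complex" where
  "mprod E P Q e f = (\<Sum>g\<in>E. P e g * Q g f)"

lemma mprod_assoc: "mprod E (mprod E P Q) R e f = mprod E P (mprod E Q R) e f"
  unfolding mprod_def sum_distrib_left sum_distrib_right
  by (subst sum.swap) (simp add: mult.assoc)

lemma mprod_cong_left:
  assumes "\<And>g. g \<in> E \<Longrightarrow> P e g = P' e g" shows "mprod E P Q e f = mprod E P' Q e f"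
  unfolding mprod_def using assms by simp

lemma mprod_cong_right:
  assumes "\<And>g. g \<in> E \<Longrightarrow> Q g f = Q' g f" shows "mprod E P Q e f = mprod E P Q' e f"
  unfolding mprod_def using assms by simp

text \<open>
  Functionals on \<open>H \<otimes> H*\<close>, as matrices, that are fixed by \<open>P\<close> in the first index and by
  the conjugate of \<open>Q\<close> in the second.  For hermitian \<open>P\<close> and \<open>Q\<close> these are the complex
  conjugates of the matrices \<open>m\<close> with \<open>P m Q = m\<close>.
\<close>

definition sandwiched :: "'h set \<Rightarrow> ('h \<Rightarrow> 'h \<Rightarrow> complex) \<Rightarrow> ('h \<Rightarrow> 'h \<Rightarrow> complex) \<Rightarrow> ('h, 'v) label oper set" where
  "sandwiched E P Q = {m \<in> L [hspace E, dual_atom (hspace E)] [].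
    (\<forall>f'\<in>E. \<forall>f\<in>E. m [] [Inl f, Inl f'] = (\<Sum>e\<in>E. m [] [Inl e, Inl f'] * P e f)) \<and>
    (\<forall>e\<in>E. \<forall>f\<in>E. m [] [Inl e, Inl f] = (\<Sum>g\<in>E. m [] [Inl e, Inl g] * cnj (Q g f)))}"

text \<open>
  Instance of \<open>resolution_perp\<close>: \<open>\<epsilon>\<close> is the identity matrix, and
  multiplying the two resolutions of the identity writes it as the sum of the products
  \<open>P b \<cdot> Q c\<close>, whose conjugates lie in the sandwiched spaces.  Spaces for different pairs are
  orthogonal because one of the two resolutions separates them.
\<close>

lemma evaluation_sandwiched:
  fixes E :: "'h set" and P Q :: "'b \<Rightarrow> 'h \<Rightarrow> 'h \<Rightarrow> complex"
  assumes fin: "finite E" "finite B"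
    and P: "\<And>b e f. b \<in> B \<Longrightarrow> e \<in> E \<Longrightarrow> f \<in> E \<Longrightarrow> P b f e = cnj (P b e f)"
      "\<And>b e f. b \<in> B \<Longrightarrow> e \<in> E \<Longrightarrow> f \<in> E \<Longrightarrow> mprod E (P b) (P b) e f = P b e f"
      "\<And>b b' e f. b \<in> B \<Longrightarrow> b' \<in> B \<Longrightarrow> b \<noteq> b' \<Longrightarrow> e \<in> E \<Longrightarrow> f \<in> E \<Longrightarrow> mprod E (P b) (P b') e f = 0"
      "\<And>e f. e \<in> E \<Longrightarrow> f \<in> E \<Longrightarrow> (\<Sum>b\<in>B. P b e f) = (if e = f then 1 else 0)"
    and Q: "\<And>b e f. b \<in> B \<Longrightarrow> e \<in> E \<Longrightarrow> f \<in> E \<Longrightarrow> Q b f e = cnj (Q b e f)"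
      "\<And>b e f. b \<in> B \<Longrightarrow> e \<in> E \<Longrightarrow> f \<in> E \<Longrightarrow> mprod E (Q b) (Q b) e f = Q b e f"
      "\<And>b b' e f. b \<in> B \<Longrightarrow> b' \<in> B \<Longrightarrow> b \<noteq> b' \<Longrightarrow> e \<in> E \<Longrightarrow> f \<in> E \<Longrightarrow> mprod E (Q b) (Q b') e f = 0"
      "\<And>e f. e \<in> E \<Longrightarrow> f \<in> E \<Longrightarrow> (\<Sum>b\<in>B. Q b e f) = (if e = f then 1 else 0)"
    and S: "S \<subseteq> B \<times> B"
  defines "X \<equiv> [hspace E, dual_atom (hspace E)] :: ('h, 'v) label atom list"
    and "U \<equiv> \<Union>(b, c)\<in>S. (sandwiched E (P b) (Q c) :: ('h, 'v) label oper set)"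
  shows "evaluation (hspace E) \<in> perp X U \<longleftrightarrow>
      (\<forall>(b, c)\<in>S. \<forall>e\<in>E. \<forall>f\<in>E. mprod E (P b) (Q c) e f = 0)"
    and "evaluation (hspace E) \<in> perp X (perp X U) \<longleftrightarrow>
      (\<forall>(b, c)\<in>B \<times> B - S. \<forall>e\<in>E. \<forall>f\<in>E. mprod E (P b) (Q c) e f = 0)"
proof -
  define N :: "'b \<times> 'b \<Rightarrow> ('h, 'v) label oper" where
    "N = (\<lambda>(b, c). mat_fun E (\<lambda>e f. cnj (mprod E (P b) (Q c) e f)))"
  define W :: "'b \<times> 'b \<Rightarrow> ('h, 'v) label oper set" where "W = (\<lambda>(b, c). sandwiched E (P b) (Q c))"
  have finX: "finite (idx X)" unfolding X_def using fin by (intro finite_idx) auto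
  have finC: "finite (B \<times> B)" using fin by simp
  have Napp: "N (b, c) [] [Inl e, Inl f] = cnj (mprod E (P b) (Q c) e f)" if "e \<in> E" "f \<in> E" for b c e f
    unfolding N_def using that fin by (simp add: mat_fun_apply)
  have NL: "N k \<in> L X []" for k unfolding N_def X_def by (simp add: split_def mat_fun_in_L)
  have N0: "N (b, c) = 0 \<longleftrightarrow> (\<forall>e\<in>E. \<forall>f\<in>E. mprod E (P b) (Q c) e f = 0)" for b c
  proof
    assume *: "N (b, c) = 0"
    show "\<forall>e\<in>E. \<forall>f\<in>E. mprod E (P b) (Q c) e f = 0"
    proof (intro ballI)
      fix e f assume "e \<in> E" "f \<in> E"
      then show "mprod E (P b) (Q c) e f = 0" using Napp[of e f b c] * by simp
    qed
  next
    assume *: "\<forall>e\<in>E. \<forall>f\<in>E. mprod E (P b) (Q c) e f = 0"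
    show "N (b, c) = 0"
    proof (rule functional_eqI[OF NL oper.subspace_0[OF subspace_L]])
      fix j assume "j \<in> idx X"
      then obtain e f where "e \<in> E" "f \<in> E" "j = [Inl e, Inl f]" unfolding X_def idx_hspace_dual by auto
      then show "N (b, c) [] j = (0 :: ('h, 'v) label oper) [] j" using Napp * by simp
    qed
  qed
  have eps: "evaluation (hspace E) = (\<Sum>k\<in>B \<times> B. N k)"
  proof (rule functional_eqI[of _ X])
    show "evaluation (hspace E) \<in> L X []" unfolding X_def by (rule evaluation_in_L)
    show "(\<Sum>k\<in>B \<times> B. N k) \<in> L X []" by (intro oper.subspace_sum subspace_L NL)
    fix j assume "j \<in> idx X"
    then obtain e f where j: "e \<in> E" "f \<in> E" "j = [Inl e, Inl f]" unfolding X_def idx_hspace_dual by auto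
    have "(\<Sum>k\<in>B \<times> B. N k) [] j = (\<Sum>(b, c)\<in>B \<times> B. cnj (mprod E (P b) (Q c) e f))"
      unfolding sum_fun_apply j(3) using Napp[OF j(1,2)] by (intro sum.cong refl) auto
    also have "\<dots> = cnj (\<Sum>b\<in>B. \<Sum>c\<in>B. \<Sum>g\<in>E. P b e g * Q c g f)"
      by (simp add: sum.cartesian_product[symmetric] mprod_def)
    also have "(\<Sum>b\<in>B. \<Sum>c\<in>B. \<Sum>g\<in>E. P b e g * Q c g f) = (\<Sum>g\<in>E. \<Sum>b\<in>B. \<Sum>c\<in>B. P b e g * Q c g f)"
    proof -
      have "(\<Sum>b\<in>B. \<Sum>c\<in>B. \<Sum>g\<in>E. P b e g * Q c g f) = (\<Sum>b\<in>B. \<Sum>g\<in>E. \<Sum>c\<in>B. P b e g * Q c g f)"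
        by (rule sum.cong[OF refl sum.swap])
      also have "\<dots> = (\<Sum>g\<in>E. \<Sum>b\<in>B. \<Sum>c\<in>B. P b e g * Q c g f)" by (rule sum.swap)
      finally show ?thesis .
    qed
    also have "\<dots> = (\<Sum>g\<in>E. (\<Sum>b\<in>B. P b e g) * (\<Sum>c\<in>B. Q c g f))" by (simp add: sum_product)
    also have "\<dots> = (\<Sum>g\<in>E. if g = e then (if g = f then 1 else 0) else 0)"
      by (intro sum.cong refl) (use P(4)[OF j(1)] Q(4)[OF _ j(2)] in auto)
    also have "\<dots> = (if e = f then 1 else 0)" using fin j by simp
    finally show "evaluation (hspace E) [] j = (\<Sum>k\<in>B \<times> B. N k) [] j"
      using j by (auto simp: evaluation_def)
  qed
  have WL: "W k \<subseteq> L X []" if "k \<in> B \<times> B" for k unfolding W_def X_def by (auto simp: split_def sandwiched_def)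
  have NW: "N k \<in> W k" if k: "k \<in> B \<times> B" for k
  proof -
    obtain b c where bc: "k = (b, c)" "b \<in> B" "c \<in> B" using k by blast
    have 1: "N (b, c) [] [Inl f, Inl f'] = (\<Sum>e\<in>E. N (b, c) [] [Inl e, Inl f'] * P b e f)" if "f \<in> E" "f' \<in> E" for f f'
    proof -
      have "(\<Sum>e\<in>E. N (b, c) [] [Inl e, Inl f'] * P b e f) = (\<Sum>e\<in>E. cnj (P b f e * mprod E (P b) (Q c) e f'))"
        using that Napp P(1)[OF bc(2), of f] by (intro sum.cong refl) (simp add: mult.commute)
      also have "\<dots> = cnj (mprod E (P b) (mprod E (P b) (Q c)) f f')"
        by (simp add: mprod_def)
      also have "mprod E (P b) (mprod E (P b) (Q c)) f f' = mprod E (P b) (Q c) f f'"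
        unfolding mprod_assoc[symmetric] using P(2)[OF bc(2) that(1)] by (rule mprod_cong_left)
      finally show ?thesis using Napp that by simp
    qed
    have 2: "N (b, c) [] [Inl e, Inl f] = (\<Sum>g\<in>E. N (b, c) [] [Inl e, Inl g] * cnj (Q c g f))" if "e \<in> E" "f \<in> E" for e f
    proof -
      have "(\<Sum>g\<in>E. N (b, c) [] [Inl e, Inl g] * cnj (Q c g f)) = cnj (mprod E (mprod E (P b) (Q c)) (Q c) e f)"
        using that Napp by (simp add: mprod_def[of E "mprod E (P b) (Q c)"])
      also have "mprod E (mprod E (P b) (Q c)) (Q c) e f = mprod E (P b) (Q c) e f"
        unfolding mprod_assoc using Q(2)[OF bc(3) _ that(2)] by (rule mprod_cong_right)
      finally show ?thesis using Napp that by simp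
    qed
    show ?thesis using 1 2 NL[of "(b, c)"] unfolding bc W_def X_def sandwiched_def by auto
  qed
  have orth: "pairing X (N k') m = 0" if k: "k \<in> B \<times> B" "k' \<in> B \<times> B" "k \<noteq> k'" "m \<in> W k" for k k' m
  proof -
    obtain b c b' c' where bc: "k = (b, c)" "b \<in> B" "c \<in> B" "k' = (b', c')" "b' \<in> B" "c' \<in> B" using k by blast
    let ?m = "\<lambda>e f. m [] [Inl e, Inl f]"
    have m1: "?m f f' = (\<Sum>e\<in>E. ?m e f' * P b e f)" if "f \<in> E" "f' \<in> E" for f f'
      using k(4) that unfolding bc W_def sandwiched_def by blast
    have m2: "?m e f = (\<Sum>g\<in>E. ?m e g * Q c f g)" if "e \<in> E" "f \<in> E" for e f
    proof -
      have "?m e f = (\<Sum>g\<in>E. ?m e g * cnj (Q c g f))" using k(4) that unfolding bc W_def sandwiched_def by blast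
      also have "\<dots> = (\<Sum>g\<in>E. ?m e g * Q c f g)"
        using Q(1)[OF bc(3) _ that(2)] by (intro sum.cong refl) simp
      finally show ?thesis .
    qed
    have eq: "pairing X (N k') m = (\<Sum>e\<in>E. \<Sum>f\<in>E. mprod E (P b') (Q c') e f * ?m e f)"
      unfolding bc N_def X_def by (simp add: pairing_mat_fun[OF fin(1)])
    show ?thesis
    proof (cases "b = b'")
      case False
      have "(\<Sum>e\<in>E. \<Sum>f\<in>E. mprod E (P b') (Q c') e f * ?m e f) =
        (\<Sum>e\<in>E. \<Sum>f\<in>E. \<Sum>g\<in>E. ?m g f * (P b g e * mprod E (P b') (Q c') e f))"
      proof (intro sum.cong refl)
        fix e f assume "e \<in> E" "f \<in> E"
        then have "mprod E (P b') (Q c') e f * ?m e f = mprod E (P b') (Q c') e f * (\<Sum>g\<in>E. ?m g f * P b g e)"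
          by (rule arg_cong[OF m1])
        then show "mprod E (P b') (Q c') e f * ?m e f = (\<Sum>g\<in>E. ?m g f * (P b g e * mprod E (P b') (Q c') e f))"
          by (simp add: sum_distrib_left mult_ac)
      qed
      also have "\<dots> = (\<Sum>f\<in>E. \<Sum>e\<in>E. \<Sum>g\<in>E. ?m g f * (P b g e * mprod E (P b') (Q c') e f))" by (rule sum.swap)
      also have "\<dots> = (\<Sum>f\<in>E. \<Sum>g\<in>E. \<Sum>e\<in>E. ?m g f * (P b g e * mprod E (P b') (Q c') e f))"
        by (rule sum.cong[OF refl sum.swap])
      also have "\<dots> = (\<Sum>f\<in>E. \<Sum>g\<in>E. ?m g f * mprod E (mprod E (P b) (P b')) (Q c') g f)"
        unfolding mprod_assoc unfolding mprod_def[of E "P b"] sum_distrib_left ..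
      also have "\<dots> = 0"
      proof -
        have "mprod E (mprod E (P b) (P b')) (Q c') g f = 0" if "g \<in> E" for g f
          unfolding mprod_def[of E "mprod E (P b) (P b')"] using P(3)[OF bc(2,5) False that] by simp
        then show ?thesis by simp
      qed
      finally show ?thesis unfolding eq .
    next
      case True
      then have c: "c' \<noteq> c" using k(3) bc by simp
      have "(\<Sum>e\<in>E. \<Sum>f\<in>E. mprod E (P b') (Q c') e f * ?m e f) =
        (\<Sum>e\<in>E. \<Sum>f\<in>E. \<Sum>g\<in>E. ?m e g * (mprod E (P b') (Q c') e f * Q c f g))"
      proof (intro sum.cong refl)
        fix e f assume "e \<in> E" "f \<in> E"
        then have "mprod E (P b') (Q c') e f * ?m e f = mprod E (P b') (Q c') e f * (\<Sum>g\<in>E. ?m e g * Q c f g)"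
          by (rule arg_cong[OF m2])
        then show "mprod E (P b') (Q c') e f * ?m e f = (\<Sum>g\<in>E. ?m e g * (mprod E (P b') (Q c') e f * Q c f g))"
          by (simp add: sum_distrib_left mult_ac)
      qed
      also have "\<dots> = (\<Sum>e\<in>E. \<Sum>g\<in>E. \<Sum>f\<in>E. ?m e g * (mprod E (P b') (Q c') e f * Q c f g))"
        by (rule sum.cong[OF refl sum.swap])
      also have "\<dots> = (\<Sum>e\<in>E. \<Sum>g\<in>E. ?m e g * mprod E (P b') (mprod E (Q c') (Q c)) e g)"
        unfolding mprod_assoc[symmetric] unfolding mprod_def[of E "mprod E (P b') (Q c')"] sum_distrib_left ..
      also have "\<dots> = 0"
      proof -
        have "mprod E (P b') (mprod E (Q c') (Q c)) e g = 0" if "g \<in> E" for e g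
          unfolding mprod_def[of E "P b'"] using Q(3)[OF bc(6,3) c _ that] by simp
        then show ?thesis by simp
      qed
      finally show ?thesis unfolding eq .
    qed
  qed
  have U: "U = (\<Union>k\<in>S. W k)" unfolding U_def W_def by (simp add: split_def)
  have r1: "evaluation (hspace E) \<in> perp X (\<Union>k\<in>S. W k) \<longleftrightarrow> (\<forall>k\<in>S. N k = 0)"
    by (rule resolution_perp(1)[OF finX finC eps _ _ _ S]) (erule WL, erule NW, erule (3) orth)
  have r2: "evaluation (hspace E) \<in> perp X (perp X (\<Union>k\<in>S. W k)) \<longleftrightarrow> (\<forall>k\<in>B \<times> B - S. N k = 0)"
    by (rule resolution_perp(2)[OF finX finC eps _ _ _ S]) (erule WL, erule NW, erule (3) orth)
  show "evaluation (hspace E) \<in> perp X U \<longleftrightarrow>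
      (\<forall>(b, c)\<in>S. \<forall>e\<in>E. \<forall>f\<in>E. mprod E (P b) (Q c) e f = 0)"
    unfolding U r1 by (rule ball_cong[OF refl]) (simp add: N0 split: prod.split)
  show "evaluation (hspace E) \<in> perp X (perp X U) \<longleftrightarrow>
      (\<forall>(b, c)\<in>B \<times> B - S. \<forall>e\<in>E. \<forall>f\<in>E. mprod E (P b) (Q c) e f = 0)"
    unfolding U r2 by (rule ball_cong[OF refl]) (simp add: N0 split: prod.split)
qed

section \<open>Formulas that compare a classical relation with its pullback\<close>

lemma family_mat:
  fixes E :: "'h::complex_inner set" and p :: "'v \<times> 'v \<Rightarrow> 'h \<Rightarrow> 'h"
  assumes onb: "orthonormal_basis E" and fin: "finite B"
    and p: "p \<in> A \<times> B \<rightarrow>\<^sub>E projections" and one: "sums_to_one A B p" and a: "a \<in> A"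
  defines "M \<equiv> \<lambda>b e f. cinner e (p (a, b) f)"
  shows "b \<in> B \<Longrightarrow> e \<in> E \<Longrightarrow> f \<in> E \<Longrightarrow> M b f e = cnj (M b e f)"
    and "b \<in> B \<Longrightarrow> e \<in> E \<Longrightarrow> f \<in> E \<Longrightarrow> mprod E (M b) (M b) e f = M b e f"
    and "b \<in> B \<Longrightarrow> b' \<in> B \<Longrightarrow> b \<noteq> b' \<Longrightarrow> e \<in> E \<Longrightarrow> f \<in> E \<Longrightarrow> mprod E (M b) (M b') e f = 0"
    and "e \<in> E \<Longrightarrow> f \<in> E \<Longrightarrow> (\<Sum>b\<in>B. M b e f) = (if e = f then 1 else 0)"
proof -
  have pr: "p (a, b) \<in> projections" if "b \<in> B" for b using p a that by auto
  have one_a: "(\<Sum>b\<in>B. p (a, b)) = id" using one a by (simp add: sums_to_one_def)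
  show "b \<in> B \<Longrightarrow> e \<in> E \<Longrightarrow> f \<in> E \<Longrightarrow> M b f e = cnj (M b e f)"
    unfolding M_def by (rule projection_mat(2)[OF onb pr])
  show "b \<in> B \<Longrightarrow> e \<in> E \<Longrightarrow> f \<in> E \<Longrightarrow> mprod E (M b) (M b) e f = M b e f"
    unfolding M_def mprod_def by (rule projection_mat(1)[OF onb pr])
  show "mprod E (M b) (M b') e f = 0" if b: "b \<in> B" "b' \<in> B" "b \<noteq> b'" and ef: "e \<in> E" "f \<in> E"
  proof -
    have "p (a, b) (p (a, b') x) = 0" for x
      by (rule sum_projections_orthogonal[of B "\<lambda>c. p (a, c)" b b', OF fin pr one_a b])
    then have "p (a, b) \<circ> p (a, b') = (\<lambda>_. 0)" by (simp add: fun_eq_iff)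
    then show ?thesis
      using compose_zero_mat[OF onb pr[OF b(1)] pr[OF b(2)]] ef unfolding M_def mprod_def by blast
  qed
  show "e \<in> E \<Longrightarrow> f \<in> E \<Longrightarrow> (\<Sum>b\<in>B. M b e f) = (if e = f then 1 else 0)"
    using sum_projections_iff[OF onb, of B "\<lambda>b. p (a, b)"] pr one_a unfolding M_def by blast
qed

lemma cmpt_hat_family:
  fixes E :: "'h::complex_inner set" and p :: "'v \<times> 'v \<Rightarrow> 'h \<Rightarrow> 'h"
  assumes onb: "orthonormal_basis E" and p: "p \<in> A \<times> B \<rightarrow>\<^sub>E projections" and ab: "a \<in> A" "b \<in> B"
  defines "F \<equiv> family_to_rel E A B p" and "M \<equiv> \<lambda>e f. cinner e (p (a, b) f)"
  shows "cmpt (rel_hat F) [hspace E, point a, dual_atom (point b)] [] = bend 2 ` rows_fixed_by E M a b"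
    and "cmpt (rel_hat (rel_conjugate F)) [dual_atom (hspace E), dual_atom (point a), point b] [] =
      bend 2 ` rows_fixed_by E (\<lambda>e f. cnj (M e f)) a b"
proof -
  have F: "F \<in> brels [{hspace E}, classical A] [classical B]"
    unfolding F_def by (rule family_to_rel_in_brels)
  have X: "[hspace E, point a] \<in> listset [{hspace E}, classical A]" using ab by (intro pair_in_listset)
  have pr: "p (a, b) \<in> projections" using p ab by auto
  have c: "cmpt F [hspace E, point a] [point b] = rows_fixed_by E M a b"
    unfolding F_def M_def by (rule cmpt_family_to_rel[of E p a b A B, OF onb pr ab])
  show "cmpt (rel_hat F) [hspace E, point a, dual_atom (point b)] [] = bend 2 ` rows_fixed_by E M a b"
    using cmpt_rel_hat[OF F X, of "point b"] ab c by (simp add: numeral_2_eq_2)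
  have F': "rel_conjugate F \<in> brels [dual {hspace E}, dual (classical A)] [dual (classical B)]"
    using rel_conjugate_in_brels[OF F] by simp
  have X': "[dual_atom (hspace E), dual_atom (point a)] \<in> listset [dual {hspace E}, dual (classical A)]"
    using ab unfolding in_listset by simp
  have "cmpt (rel_conjugate F) [dual_atom (hspace E), dual_atom (point a)] [dual_atom (point b)] =
      rows_fixed_by E (\<lambda>e f. cnj (M e f)) a b"
    using cmpt_rel_conjugate[OF F X single_in_listset[OF ab(2)]] c op_conj_rows_fixed_by[of E M a b] by simp
  then show "cmpt (rel_hat (rel_conjugate F)) [dual_atom (hspace E), dual_atom (point a), point b] [] =
      bend 2 ` rows_fixed_by E (\<lambda>e f. cnj (M e f)) a b"
    using cmpt_rel_hat[OF F' X', of "dual_atom (point b)"] ab by (simp add: numeral_2_eq_2)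
qed

text \<open>
  The second and third sentence have the same shape and differ only in the classical relations \<open>R\<close> and
  \<open>T\<close> that are compared, with extensions \<open>PA\<close> and \<open>PB\<close>.  At values \<open>a, a'\<close> the left side
  is \<open>\<top>\<close> or \<open>\<bottom>\<close>, so the equivalence is the closure or the complement of the right side,
  and evaluation belongs to it exactly if the products for the pairs outside or inside \<open>PB\<close>
  vanish.
\<close>

lemma holds_comparison:
  fixes E :: "'h::complex_inner set" and p :: "'v \<times> 'v \<Rightarrow> 'h \<Rightarrow> 'h"
    and PA PB :: "'v \<Rightarrow> 'v \<Rightarrow> bool"
  assumes onb: "orthonormal_basis E" and E0: "E \<noteq> {}" and finB: "finite B"
    and p: "p \<in> A \<times> B \<rightarrow>\<^sub>E projections" and one: "sums_to_one A B p"
    and R: "R \<in> brels [classical A, dual (classical A)] []"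
      "\<And>a a'. a \<in> A \<Longrightarrow> a' \<in> A \<Longrightarrow> cmpt R [point a, dual_atom (point a')] [] =
        (if PA a a' then L [point a, dual_atom (point a')] [] else {0})"
    and T: "T \<in> brels [dual (classical B), classical B] []"
      "\<And>b b'. b \<in> B \<Longrightarrow> b' \<in> B \<Longrightarrow> cmpt T [dual_atom (point b), point b'] [] =
        (if PB b b' then L [dual_atom (point b), point b'] [] else {0})"
  defines "F \<equiv> family_to_rel E A B p :: ('h, 'v) label brel"
  defines "x \<equiv> Var {hspace E} 0 0" and "x' \<equiv> Var (dual {hspace E}) 0 1"
    and "a1 \<equiv> Var (classical A) 0 4" and "a1' \<equiv> Var (dual (classical A)) 0 5"
    and "a2 \<equiv> Var (classical A) 0 6" and "a2' \<equiv> Var (dual (classical A)) 0 7"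
  shows "holds (ForallEq x x' (ForallEq a1 a1' (ForallEq a2 a2'
      (Iff (atomic R [V a1, V a2']) (atomic T [App (rel_conjugate F) [V x', V a1'], App F [V x, V a2]]))))) \<longleftrightarrow>
    (\<forall>a\<in>A. \<forall>a'\<in>A. \<forall>b\<in>B. \<forall>b'\<in>B. PA a a' \<noteq> PB b b' \<longrightarrow> p (a', b') \<circ> p (a, b) = (\<lambda>_. 0))"
proof -
  let ?H = "hspace E :: ('h, 'v) label atom"
  let ?qA = "classical A :: ('h, 'v) label qset" and ?qB = "classical B :: ('h, 'v) label qset"
  let ?X = "[?H, dual_atom ?H]" and ?hs = "[x, x']"
  (* The variables that expanding the terms introduces: y0 and y1 stand for the two terms. *)
  define y0 where "y0 = Var (dual ?qB) 1 0"
  define y0' where "y0' = Var ?qB 1 1"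
  define y1 where "y1 = Var ?qB 1 2"
  define y1' where "y1' = Var (dual ?qB) 1 3"
  define body where "body = Conj (Conj (Rel T [y0, y1]) (Rel (rel_hat (rel_conjugate F)) [x', a1', y0']))
     (Rel (rel_hat F) [x, a2, y1'])"
  define \<Phi> where "\<Phi> = ExistsEq y1 y1' (ExistsEq y0 y0' body)"
  define \<psi> where "\<psi> = Iff (Rel R [a1, a2']) \<Phi>"
  define M where "M a b e f = cinner e (p (a, b) f)" for a b e f
  note finE = onb_finite[OF onb]
  have pr: "p (a, b) \<in> projections" if "a \<in> A" "b \<in> B" for a b using p that by auto
  have F: "F \<in> brels [{?H}, ?qA] [?qB]" unfolding F_def by (rule family_to_rel_in_brels)
  have F': "rel_conjugate F \<in> brels [dual {?H}, dual ?qA] [dual ?qB]" using rel_conjugate_in_brels[OF F] by simp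
  have hatF: "rel_hat F \<in> brels [{?H}, ?qA, dual ?qB] []" using rel_hat_in_brels[OF F] by simp
  have hatF': "rel_hat (rel_conjugate F) \<in> brels [dual {?H}, dual ?qA, ?qB] []" using rel_hat_in_brels[OF F'] by simp
  have vs: "vsort x = {?H}" "vsort x' = dual {?H}" "vsort a1 = ?qA" "vsort a1' = dual ?qA" "vsort a2 = ?qA"
    "vsort a2' = dual ?qA" "vsort y0 = dual ?qB" "vsort y0' = ?qB" "vsort y1 = ?qB" "vsort y1' = dual ?qB"
    by (simp_all add: x_def x'_def a1_def a1'_def a2_def a2'_def y0_def y0'_def y1_def y1'_def)
  have dist: "distinct [y0, y0', y1, y1', a2, a2', a1, a1', x, x']"
    "distinct [x', x, a1', a1, a2', a2, y1', y1, y0', y0]"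
    by (simp_all add: x_def x'_def a1_def a1'_def a2_def a2'_def y0_def y0'_def y1_def y1'_def)
  have atomT: "atomic T [App (rel_conjugate F) [V x', V a1'], App F [V x, V a2]] = \<Phi>"
    unfolding \<Phi>_def body_def y0_def y0'_def y1_def y1'_def
    by (simp add: atomic_App_App brelsD(2)[OF F] brelsD(2)[OF F'])
  have od: "one_dim D" if "D \<in> ?qA \<or> D \<in> ?qB \<or> D \<in> dual ?qA \<or> D \<in> dual ?qB" for D
  proof -
    have "one_dim D'" if "D' \<in> ?qA \<union> ?qB" for D' using that by (auto simp: classical_def)
    then show ?thesis using that in_dual[of D] one_dim_dual_atom[of D] by blast
  qed
  have fin: "finite (basis D)" if "one_dim D" for D :: "('h, 'v) label atom" using basis_one_dim[OF that] by simp
  have wf_body: "wf_fm body [y0, y0', y1, y1', a2, a2', a1, a1', x, x']"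
    using dist hatF hatF' T(1) by (simp add: body_def vs)
  have wf_E0: "wf_fm (ExistsEq y0 y0' body) [y1, y1', a2, a2', a1, a1', x, x']"
    by (rule wf_fm_ForallEq(2)) (use dist wf_body fin od in \<open>auto simp: vs\<close>)
  have wf_\<Phi>: "wf_fm \<Phi> [a2, a2', a1, a1', x, x']"
    unfolding \<Phi>_def by (rule wf_fm_ForallEq(2)) (use dist wf_E0 fin od in \<open>auto simp: vs\<close>)
  have wf_R: "wf_fm (Rel R [a1, a2']) [a2, a2', a1, a1', x, x']"
    using dist R(1) by (simp add: vs)
  have wf_\<psi>: "wf_fm \<psi> [a2, a2', a1, a1', x, x']"
    using wf_\<Phi> wf_R unfolding \<psi>_def by (simp add: Iff_def Imp_def Or_def)
  have wf_F2: "wf_fm (ForallEq a2 a2' \<psi>) [a1, a1', x, x']"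
    by (rule wf_fm_ForallEq(1)) (use dist wf_\<psi> fin od in \<open>auto simp: vs\<close>)
  have wf_F1: "wf_fm (ForallEq a1 a1' (ForallEq a2 a2' \<psi>)) [x, x']"
    by (rule wf_fm_ForallEq(1)) (use dist wf_F2 fin od in \<open>auto simp: vs\<close>)
  define \<alpha>0 where "\<alpha>0 = (\<lambda>_. ?H)(x' := dual_atom ?H)"
  have \<alpha>0: "\<alpha>0 x = ?H" "\<alpha>0 x' = dual_atom ?H" using dist by (auto simp: \<alpha>0_def)
  have g0: "good_ctx ?hs [] \<alpha>0"
    using dist \<alpha>0 finE by (simp add: good_ctx_def ok_ctx_def vs dual_def)
  let ?A2 = "\<lambda>a a'. \<alpha>0(a1' := dual_atom (point a), a1 := point a, a2' := dual_atom (point a'), a2 := point a')"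
  have "holds (ForallEq x x' (ForallEq a1 a1' (ForallEq a2 a2' \<psi>))) \<longleftrightarrow>
      evaluation ?H \<in> val ?hs (ForallEq a1 a1' (ForallEq a2 a2' \<psi>)) [] \<alpha>0"
    by (rule holds_ForallEq) (use wf_F1 vs dist \<alpha>0 finE E0 in auto)
  also have "\<dots> \<longleftrightarrow> (\<forall>a\<in>A. \<forall>a'\<in>A. evaluation ?H \<in> perp ?X (perp ?X (val ?hs \<psi> [a2, a2', a1, a1'] (?A2 a a'))))"
  proof -
    have "val ?hs (ForallEq a1 a1' (ForallEq a2 a2' \<psi>)) [] \<alpha>0 = {m \<in> L (map \<alpha>0 ?hs) [].
      \<forall>D\<in>vsort a1. \<forall>C\<in>vsort a2. m \<in> perp (map \<alpha>0 ?hs) (perp (map \<alpha>0 ?hs) (val ?hs \<psi> [a2, a2', a1, a1']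
        (\<alpha>0(a1' := dual_atom D, a1 := D, a2' := dual_atom C, a2 := C))))}"
      by (rule val_ForallEq_ForallEq[OF g0]) (use dist wf_\<psi> od in \<open>auto simp: vs\<close>)
    then show ?thesis
      using evaluation_in_L[of ?H] by (simp add: vs \<alpha>0 classical_def)
  qed
  also have "\<dots> \<longleftrightarrow> (\<forall>a\<in>A. \<forall>a'\<in>A. \<forall>b\<in>B. \<forall>b'\<in>B. PA a a' \<noteq> PB b b' \<longrightarrow> p (a', b') \<circ> p (a, b) = (\<lambda>_. 0))"
  proof (intro ball_cong refl)
    fix a a' assume a: "a \<in> A" "a' \<in> A"
    let ?\<alpha> = "?A2 a a'" and ?Cs = "[a2, a2', a1, a1']"
    have hs: "map ?\<alpha> ?hs = ?X" using dist \<alpha>0 by auto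
    have g1: "good_ctx ?hs [a1, a1'] (\<alpha>0(a1' := dual_atom (point a), a1 := point a))"
      by (rule good_ctx_pair[OF g0]) (use dist a od in \<open>auto simp: vs\<close>)
    have g: "good_ctx ?hs ?Cs ?\<alpha>"
      by (rule good_ctx_pair[OF g1]) (use dist a od in \<open>auto simp: vs\<close>)
    have valR: "val ?hs (Rel R [a1, a2']) ?Cs ?\<alpha> = (if PA a a' then L ?X [] else {0})"
    proof -
      have "cmpt R (map ?\<alpha> [a1, a2']) [] = (if PA a a' then L (map ?\<alpha> [a1, a2']) [] else {0})"
        using R(2)[OF a] dist by auto
      from val_Rel_classical[OF g _ _ this] show ?thesis
        using wf_R unfolding hs by auto
    qed
    let ?B = "\<lambda>D C. ?\<alpha>(y1' := dual_atom D, y1 := D, y0' := dual_atom C, y0 := C)"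
    let ?Ds = "[y0, y0', y1, y1', a2, a2', a1, a1']"
    define U where "U = (\<Union>D\<in>?qB. \<Union>C\<in>dual ?qB. val ?hs body ?Ds (?B D C))"
    have val\<Phi>: "val ?hs \<Phi> ?Cs ?\<alpha> = perp ?X (perp ?X U)"
    proof -
      have "val ?hs (ExistsEq y1 y1' (ExistsEq y0 y0' body)) ?Cs ?\<alpha> = perp (map ?\<alpha> ?hs) (perp (map ?\<alpha> ?hs)
          (\<Union>D\<in>vsort y1. \<Union>C\<in>vsort y0. val ?hs body (y0 # y0' # y1 # y1' # ?Cs) (?B D C)))"
        by (rule val_ExistsEq_ExistsEq[OF g]) (use dist wf_body od in \<open>auto simp: vs\<close>)
      then show ?thesis unfolding \<Phi>_def U_def hs vs .
    qed
    have body: "val ?hs body ?Ds (?B (point b') (dual_atom (point b))) =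
        (if PB b b' then sandwiched E (M a' b') (M a b) else {0})" if b: "b \<in> B" "b' \<in> B" for b b'
    proof -
      define \<beta> where "\<beta> = ?B (point b') (dual_atom (point b))"
      have hs': "map \<beta> ?hs = ?X" unfolding \<beta>_def using dist \<alpha>0 by auto
      have \<beta>: "\<beta> x = ?H" "\<beta> x' = dual_atom ?H" "\<beta> a1' = dual_atom (point a)" "\<beta> a2 = point a'"
        "\<beta> y0 = dual_atom (point b)" "\<beta> y0' = point b" "\<beta> y1 = point b'" "\<beta> y1' = dual_atom (point b')"
        unfolding \<beta>_def using dist \<alpha>0 by auto
      have gb1: "good_ctx ?hs (y1 # y1' # ?Cs) (?\<alpha>(y1' := dual_atom (point b'), y1 := point b'))"
        by (rule good_ctx_pair[OF g]) (use dist b od in \<open>auto simp: vs\<close>)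
      have gb: "good_ctx ?hs ?Ds \<beta>"
        unfolding \<beta>_def
        by (rule good_ctx_pair[OF gb1]) (use dist b od in \<open>auto simp: vs\<close>)
      have wfs: "wf_fm (Rel T [y0, y1]) (?Ds @ ?hs)" "wf_fm (Rel (rel_hat (rel_conjugate F)) [x', a1', y0']) (?Ds @ ?hs)"
        "wf_fm (Rel (rel_hat F) [x, a2, y1']) (?Ds @ ?hs)"
        using wf_body unfolding body_def by simp_all
      have cT: "cmpt T (map \<beta> [y0, y1]) [] = (if PB b b' then L (map \<beta> [y0, y1]) [] else {0})"
        unfolding list.map \<beta> by (rule T(2)[OF b])
      have valT: "val ?hs (Rel T [y0, y1]) ?Ds \<beta> = (if PB b b' then L ?X [] else {0})"
        using val_Rel_classical[OF gb wfs(1) _ cT] unfolding hs' by simp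
      have valF': "val ?hs (Rel (rel_hat (rel_conjugate F)) [x', a1', y0']) ?Ds \<beta> = {m \<in> L (map \<beta> ?hs) [].
          \<forall>e\<in>E. \<forall>f\<in>E. m [] [Inl e, Inl f] = (\<Sum>g\<in>E. m [] [Inl e, Inl g] * cnj (M a b g f))}"
      proof (rule val_Rel_bend_snd[OF gb wfs(2) _ _ finE E0])
        show "cmpt (rel_hat (rel_conjugate F)) [\<beta> x', \<beta> a1', \<beta> y0'] [] =
            bend 2 ` rows_fixed_by E (\<lambda>e f. cnj (M a b e f)) a b"
          unfolding \<beta> F_def M_def using cmpt_hat_family(2)[OF onb p a(1) b(1)] .
      qed (simp_all add: \<beta>)
      have valF: "val ?hs (Rel (rel_hat F) [x, a2, y1']) ?Ds \<beta> = {m \<in> L (map \<beta> ?hs) [].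
          \<forall>f'\<in>E. \<forall>f\<in>E. m [] [Inl f, Inl f'] = (\<Sum>e\<in>E. m [] [Inl e, Inl f'] * M a' b' e f)}"
      proof (rule val_Rel_bend_fst[OF gb wfs(3) _ _ finE E0])
        show "cmpt (rel_hat F) [\<beta> x, \<beta> a2, \<beta> y1'] [] = bend 2 ` rows_fixed_by E (M a' b') a' b'"
          unfolding \<beta> F_def M_def using cmpt_hat_family(1)[OF onb p a(2) b(2)] .
      qed (simp_all add: \<beta>)
      have "val ?hs body ?Ds \<beta> = (if PB b b' then L ?X [] else {0}) \<inter> sandwiched E (M a' b') (M a b)"
        unfolding body_def val_Conj[OF gb] valT valF' valF hs' sandwiched_def by blast
      moreover have "(sandwiched E (M a' b') (M a b) :: ('h, 'v) label oper set) \<subseteq> L ?X []"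
        "(0 :: ('h, 'v) label oper) \<in> sandwiched E (M a' b') (M a b)"
        using oper.subspace_0[OF subspace_L[of ?X "[]"]] by (auto simp: sandwiched_def)
      ultimately show ?thesis unfolding \<beta>_def[symmetric] by auto
    qed
    define S where "S = {(b', b) \<in> B \<times> B. PB b b'}"
    define W where "W = (\<Union>(b', b)\<in>S. (sandwiched E (M a' b') (M a b) :: ('h, 'v) label oper set))"
    have UW: "perp ?X U = perp ?X W"
    proof -
      have "dual ?qB = (\<lambda>b. dual_atom (point b)) ` B" "?qB = point ` B"
        by (auto simp: dual_def classical_def)
      then have "U = (\<Union>b'\<in>B. \<Union>b\<in>B. val ?hs body ?Ds (?B (point b') (dual_atom (point b))))"
        unfolding U_def by simp
      also have "\<dots> = (\<Union>b'\<in>B. \<Union>b\<in>B. if PB b b' then sandwiched E (M a' b') (M a b) else {0})"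
        using body by (intro SUP_cong refl) blast
      finally have U: "U = (\<Union>b'\<in>B. \<Union>b\<in>B. if PB b b' then sandwiched E (M a' b') (M a b) else {0})" .
      have p0: "pairing ?X 0 m = 0" for m by (simp add: pairing_def)
      have "(\<forall>f\<in>U. pairing ?X f m = 0) \<longleftrightarrow> (\<forall>f\<in>W. pairing ?X f m = 0)" for m
        unfolding U W_def S_def using p0 by (auto split: if_splits)
      then show ?thesis unfolding perp_def by blast
    qed
    have WL: "W \<subseteq> L ?X []" unfolding W_def sandwiched_def by auto
    have val\<psi>: "perp ?X (perp ?X (val ?hs \<psi> ?Cs ?\<alpha>)) = (if PA a a' then perp ?X (perp ?X W) else perp ?X W)"
    proof (cases "PA a a'")
      case True
      have "val ?hs \<psi> ?Cs ?\<alpha> = perp ?X (perp ?X (val ?hs \<Phi> ?Cs ?\<alpha>))"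
        unfolding \<psi>_def hs[symmetric]
        by (rule val_Iff_top[OF g]) (use wf_R wf_\<Phi> valR True hs in auto)
      then show ?thesis using True unfolding val\<Phi> UW
        by (simp add: perp_perp_perp[OF perp_subset_L] perp_perp_perp[OF WL])
    next
      case False
      have "val ?hs \<psi> ?Cs ?\<alpha> = perp ?X (val ?hs \<Phi> ?Cs ?\<alpha>)"
        unfolding \<psi>_def hs[symmetric]
        by (rule val_Iff_bot[OF g]) (use wf_R wf_\<Phi> valR False hs in auto)
      then show ?thesis using False unfolding val\<Phi> UW
        by (simp add: perp_perp_perp[OF perp_subset_L] perp_perp_perp[OF WL])
    qed
    have S: "S \<subseteq> B \<times> B" unfolding S_def by auto
    note fm = family_mat[OF onb finB p one a(2), folded M_def] family_mat[OF onb finB p one a(1), folded M_def]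
    have ev1: "evaluation ?H \<in> perp ?X W \<longleftrightarrow> (\<forall>(b', b)\<in>S. \<forall>e\<in>E. \<forall>f\<in>E. mprod E (M a' b') (M a b) e f = 0)"
      unfolding W_def
      by (rule evaluation_sandwiched(1)[OF finE finB _ _ _ _ _ _ _ _ S]) (rule fm; assumption)+
    have ev2: "evaluation ?H \<in> perp ?X (perp ?X W) \<longleftrightarrow>
        (\<forall>(b', b)\<in>B \<times> B - S. \<forall>e\<in>E. \<forall>f\<in>E. mprod E (M a' b') (M a b) e f = 0)"
      unfolding W_def
      by (rule evaluation_sandwiched(2)[OF finE finB _ _ _ _ _ _ _ _ S]) (rule fm; assumption)+
    define Z where "Z b' b \<longleftrightarrow> (\<forall>e\<in>E. \<forall>f\<in>E. mprod E (M a' b') (M a b) e f = 0)" for b' b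
    have zero: "p (a', b') \<circ> p (a, b) = (\<lambda>_. 0) \<longleftrightarrow> Z b' b"
      if "b \<in> B" "b' \<in> B" for b b'
      unfolding Z_def M_def mprod_def using compose_zero_mat[OF onb pr[OF a(2) that(2)] pr[OF a(1) that(1)]] .
    show "evaluation ?H \<in> perp ?X (perp ?X (val ?hs \<psi> ?Cs ?\<alpha>)) \<longleftrightarrow>
        (\<forall>b\<in>B. \<forall>b'\<in>B. PA a a' \<noteq> PB b b' \<longrightarrow> p (a', b') \<circ> p (a, b) = (\<lambda>_. 0))"
    proof (cases "PA a a'")
      case True
      have "evaluation ?H \<in> perp ?X (perp ?X (val ?hs \<psi> ?Cs ?\<alpha>)) \<longleftrightarrow>
          (\<forall>(b', b)\<in>B \<times> B - S. \<forall>e\<in>E. \<forall>f\<in>E. mprod E (M a' b') (M a b) e f = 0)"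
        unfolding val\<psi> if_P[OF True] by (rule ev2)
      also have "\<dots> \<longleftrightarrow> (\<forall>b\<in>B. \<forall>b'\<in>B. PA a a' \<noteq> PB b b' \<longrightarrow> p (a', b') \<circ> p (a, b) = (\<lambda>_. 0))"
        using True unfolding S_def Z_def[symmetric] by (auto simp: zero)
      finally show ?thesis .
    next
      case False
      have "evaluation ?H \<in> perp ?X (perp ?X (val ?hs \<psi> ?Cs ?\<alpha>)) \<longleftrightarrow>
          (\<forall>(b', b)\<in>S. \<forall>e\<in>E. \<forall>f\<in>E. mprod E (M a' b') (M a b) e f = 0)"
        unfolding val\<psi> if_not_P[OF False] by (rule ev1)
      also have "\<dots> \<longleftrightarrow> (\<forall>b\<in>B. \<forall>b'\<in>B. PA a a' \<noteq> PB b b' \<longrightarrow> p (a', b') \<circ> p (a, b) = (\<lambda>_. 0))"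
        using False unfolding S_def Z_def[symmetric] by (auto simp: zero)
      finally show ?thesis .
    qed
  qed
  finally show ?thesis unfolding atomT \<psi>_def atomic_variables .
qed

section \<open>The formula that expresses surjectivity\<close>

definition vec_fun :: "'h set \<Rightarrow> ('h \<Rightarrow> complex) \<Rightarrow> ('h, 'v) label oper" where
  "vec_fun E w = (\<lambda>u j. \<Sum>e\<in>E. if u = [] \<and> j = [Inl e] then w e else 0)"

lemma idx_hspace: "idx [hspace E] = (\<lambda>e. [Inl e]) ` E"
  by (auto simp: in_idx list_all2_Cons2)

lemma vec_fun_apply: "finite E \<Longrightarrow> e \<in> E \<Longrightarrow> vec_fun E w [] [Inl e] = w e"
  by (simp add: vec_fun_def)

lemma vec_fun_in_L: "vec_fun E w \<in> L [hspace E] []"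
proof -
  have "vec_fun E w u j = 0" if "\<not> (u = [] \<and> j \<in> idx [hspace E])" for u j
    unfolding vec_fun_def using that unfolding idx_hspace by (intro sum.neutral ballI) auto
  then show ?thesis unfolding L_iff by blast
qed

lemma pairing_hspace: "pairing [hspace E] m n = (\<Sum>e\<in>E. cnj (m [] [Inl e]) * n [] [Inl e])"
  unfolding pairing_def idx_hspace by (simp add: sum.reindex inj_on_def)

definition row_space :: "'h set \<Rightarrow> ('h \<Rightarrow> 'h \<Rightarrow> complex) \<Rightarrow> ('h, 'v) label oper set" where
  "row_space E P = {m \<in> L [hspace E] []. \<forall>f\<in>E. m [] [Inl f] = (\<Sum>e\<in>E. m [] [Inl e] * P e f)}"

text \<open>
  The row \<open>w\<close> of \<open>1 - (\<Sum>a\<in>A. P a)\<close> at \<open>e\<close> is orthogonal to all the row spaces,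
  because each \<open>P a\<close> annihilates \<open>1 - (\<Sum>a\<in>A. P a)\<close>.  If the row spaces span everything,
  then \<open>w\<close> is orthogonal to itself and vanishes.  Conversely, a functional that is orthogonal to
  all row spaces is orthogonal to each of its images \<open>n a\<close> under the \<open>P a\<close>, which lie in the row spaces and
  sum to it.
\<close>

lemma row_spaces_total:
  fixes E :: "'h set" and P :: "'a \<Rightarrow> 'h \<Rightarrow> 'h \<Rightarrow> complex"
  assumes fin: "finite E" "finite A"
    and herm: "\<And>a e f. a \<in> A \<Longrightarrow> e \<in> E \<Longrightarrow> f \<in> E \<Longrightarrow> P a f e = cnj (P a e f)"
    and idem: "\<And>a e f. a \<in> A \<Longrightarrow> e \<in> E \<Longrightarrow> f \<in> E \<Longrightarrow> mprod E (P a) (P a) e f = P a e f"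
    and orth: "\<And>a a' e f. a \<in> A \<Longrightarrow> a' \<in> A \<Longrightarrow> a \<noteq> a' \<Longrightarrow> e \<in> E \<Longrightarrow> f \<in> E \<Longrightarrow> mprod E (P a) (P a') e f = 0"
  defines "X \<equiv> [hspace E :: ('h, 'v) label atom]"
  shows "L X [] \<subseteq> perp X (perp X (\<Union>a\<in>A. row_space E (P a))) \<longleftrightarrow>
    (\<forall>e\<in>E. \<forall>f\<in>E. (\<Sum>a\<in>A. P a e f) = (if e = f then 1 else 0))"
    (is "?l \<longleftrightarrow> ?r")
proof
  assume l: ?l
  show ?r
  proof (intro ballI)
    fix e f assume ef: "e \<in> E" "f \<in> E"
    define w where "w g = (if e = g then 1 else 0) - (\<Sum>a\<in>A. P a e g)" for g
    define u :: "('h, 'v) label oper" where "u = vec_fun E w"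
    have uL: "u \<in> L X []" unfolding u_def X_def by (rule vec_fun_in_L)
    have "pairing X m u = 0" if a': "a' \<in> A" and m: "m \<in> row_space E (P a')" for a' m
    proof -
      let ?m = "\<lambda>g. m [] [Inl g]"
      have m': "cnj (?m g) = (\<Sum>h\<in>E. P a' g h * cnj (?m h))" if "g \<in> E" for g
      proof -
        have "cnj (?m g) = cnj (\<Sum>h\<in>E. ?m h * P a' h g)" using m that unfolding row_space_def by simp
        also have "\<dots> = (\<Sum>h\<in>E. P a' g h * cnj (?m h))"
          unfolding cnj_sum by (intro sum.cong refl) (use herm[OF a' _ that] in \<open>simp add: mult.commute\<close>)
        finally show ?thesis .
      qed
      have part: "(\<Sum>g\<in>E. cnj (?m g) * P a e g) = (\<Sum>h\<in>E. mprod E (P a) (P a') e h * cnj (?m h))" for a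
      proof -
        have "(\<Sum>g\<in>E. cnj (?m g) * P a e g) = (\<Sum>g\<in>E. \<Sum>h\<in>E. P a e g * P a' g h * cnj (?m h))"
          by (intro sum.cong refl) (simp add: m' sum_distrib_left sum_distrib_right mult_ac)
        also have "\<dots> = (\<Sum>h\<in>E. \<Sum>g\<in>E. P a e g * P a' g h * cnj (?m h))" by (rule sum.swap)
        finally show ?thesis by (simp add: mprod_def sum_distrib_right)
      qed
      have "(\<Sum>g\<in>E. cnj (?m g) * (\<Sum>a\<in>A. P a e g)) = (\<Sum>a\<in>A. \<Sum>g\<in>E. cnj (?m g) * P a e g)"
        unfolding sum_distrib_left by (rule sum.swap)
      also have "\<dots> = (\<Sum>a\<in>A. if a = a' then cnj (?m e) else 0)"
      proof (intro sum.cong refl)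
        fix a assume a: "a \<in> A"
        show "(\<Sum>g\<in>E. cnj (?m g) * P a e g) = (if a = a' then cnj (?m e) else 0)"
        proof (cases "a = a'")
          case True
          then show ?thesis unfolding part using m'[OF ef(1)] idem[OF a' ef(1)] by simp
        next
          case False
          then show ?thesis unfolding part using orth[OF a a' False ef(1)] by simp
        qed
      qed
      also have "\<dots> = cnj (?m e)" using fin a' by simp
      finally have 1: "(\<Sum>g\<in>E. cnj (?m g) * (\<Sum>a\<in>A. P a e g)) = cnj (?m e)" .
      have 2: "(\<Sum>g\<in>E. cnj (?m g) * (if e = g then 1 else 0)) = cnj (?m e)"
        using fin ef by (simp add: if_distrib[of "(*) _"] cong: if_cong)
      have "pairing X m u = (\<Sum>g\<in>E. cnj (?m g) * w g)"
        unfolding X_def pairing_hspace u_def using fin by (simp add: vec_fun_apply)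
      also have "\<dots> = (\<Sum>g\<in>E. cnj (?m g) * (if e = g then 1 else 0)) - (\<Sum>g\<in>E. cnj (?m g) * (\<Sum>a\<in>A. P a e g))"
        unfolding w_def right_diff_distrib by (rule sum_subtractf)
      finally show ?thesis unfolding 1 2 by simp
    qed
    then have "u \<in> perp X (\<Union>a\<in>A. row_space E (P a))" using uL unfolding perp_def by blast
    then have "pairing X u u = 0" using l uL unfolding perp_def by blast
    then have "u = 0" using pairing_self[OF _ uL] fin unfolding X_def by (simp add: idx_hspace)
    then have "w f = 0" using vec_fun_apply[of E f w] fin ef unfolding u_def
      by (metis zero_fun_def)
    then show "(\<Sum>a\<in>A. P a e f) = (if e = f then 1 else 0)" unfolding w_def by simp
  qed
next
  assume r: ?r
  have "perp X (\<Union>a\<in>A. row_space E (P a)) \<subseteq> {0}"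
  proof
    fix m assume m: "m \<in> perp X (\<Union>a\<in>A. row_space E (P a))"
    then have mL: "m \<in> L X []" by (simp add: perp_def)
    let ?m = "\<lambda>g. m [] [Inl g]"
    define n :: "'a \<Rightarrow> ('h, 'v) label oper" where "n a = vec_fun E (\<lambda>f. \<Sum>e\<in>E. ?m e * P a e f)" for a
    have n: "n a \<in> row_space E (P a)" if a: "a \<in> A" for a
    proof -
      have "(\<Sum>e\<in>E. ?m e * P a e f) = (\<Sum>e\<in>E. (\<Sum>g\<in>E. ?m g * P a g e) * P a e f)" if f: "f \<in> E" for f
      proof -
        have "(\<Sum>e\<in>E. (\<Sum>g\<in>E. ?m g * P a g e) * P a e f) = (\<Sum>g\<in>E. ?m g * mprod E (P a) (P a) g f)"
          unfolding mprod_def sum_distrib_left sum_distrib_right by (subst sum.swap) (simp add: mult.assoc)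
        also have "\<dots> = (\<Sum>g\<in>E. ?m g * P a g f)" by (intro sum.cong refl) (simp add: idem[OF a _ f])
        finally show ?thesis ..
      qed
      then show ?thesis unfolding row_space_def n_def using fin vec_fun_in_L[of E]
        by (simp add: vec_fun_apply)
    qed
    have "(\<Sum>f\<in>E. cnj (\<Sum>e\<in>E. ?m e * P a e f) * ?m f) = 0" if a: "a \<in> A" for a
    proof -
      have "pairing X (n a) m = 0" using m n[OF a] a unfolding perp_def by blast
      then show ?thesis unfolding X_def pairing_hspace n_def using fin by (simp add: vec_fun_apply)
    qed
    then have "(\<Sum>a\<in>A. \<Sum>f\<in>E. cnj (\<Sum>e\<in>E. ?m e * P a e f) * ?m f) = 0" by simp
    also have "(\<Sum>a\<in>A. \<Sum>f\<in>E. cnj (\<Sum>e\<in>E. ?m e * P a e f) * ?m f) = pairing X m m"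
    proof -
      have "(\<Sum>a\<in>A. \<Sum>f\<in>E. cnj (\<Sum>e\<in>E. ?m e * P a e f) * ?m f) =
          (\<Sum>f\<in>E. \<Sum>a\<in>A. cnj (\<Sum>e\<in>E. ?m e * P a e f) * ?m f)" by (rule sum.swap)
      also have "\<dots> = (\<Sum>f\<in>E. cnj (?m f) * ?m f)"
      proof (intro sum.cong refl)
        fix f assume f: "f \<in> E"
        have "(\<Sum>a\<in>A. \<Sum>e\<in>E. ?m e * P a e f) = (\<Sum>e\<in>E. ?m e * (\<Sum>a\<in>A. P a e f))"
          unfolding sum_distrib_left by (rule sum.swap)
        also have "\<dots> = (\<Sum>e\<in>E. if e = f then ?m f else 0)"
          by (intro sum.cong refl) (use r f in auto)
        also have "\<dots> = ?m f" using fin f by simp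
        finally have "cnj (\<Sum>a\<in>A. \<Sum>e\<in>E. ?m e * P a e f) = cnj (?m f)" by simp
        then show "(\<Sum>a\<in>A. cnj (\<Sum>e\<in>E. ?m e * P a e f) * ?m f) = cnj (?m f) * ?m f"
          unfolding sum_distrib_right[symmetric] cnj_sum[symmetric] by simp
      qed
      finally show ?thesis unfolding X_def pairing_hspace .
    qed
    finally have "pairing X m m = 0" .
    then show "m \<in> {0}" using pairing_self[OF _ mL] fin unfolding X_def by (simp add: idx_hspace)
  qed
  then show ?l using perp_antimono[of _ "{0}" X] perp_zero[of X] by blast
qed

text \<open>
  At values \<open>b\<close> and \<open>a\<close>, the atomic formula is the row space of \<open>p (a, b)\<close>: the two
  quantified pairs of variables that stand for the terms are forced to the value \<open>b\<close> by the
  equalities.  The existential quantifier over \<open>a\<close> takes the closed sum of these row spaces.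
\<close>

lemma holds_surjective:
  fixes E :: "'h::complex_inner set" and p :: "'v \<times> 'v \<Rightarrow> 'h \<Rightarrow> 'h"
  assumes onb: "orthonormal_basis E" and E0: "E \<noteq> {}" and fin: "finite A"
    and p: "p \<in> A \<times> B \<rightarrow>\<^sub>E projections"
    and orth: "\<And>a a' b. a \<in> A \<Longrightarrow> a' \<in> A \<Longrightarrow> b \<in> B \<Longrightarrow> a \<noteq> a' \<Longrightarrow> p (a, b) \<circ> p (a', b) = (\<lambda>_. 0)"
  defines "F \<equiv> family_to_rel E A B p :: ('h, 'v) label brel"
  defines "x \<equiv> Var {hspace E} 0 0" and "a \<equiv> Var (classical A) 0 2" and "b' \<equiv> Var (dual (classical B)) 0 3"
  shows "holds (Forall x (Forall b' (Exists a (atomic (rel_eq (classical B)) [App F [V x, V a], V b'])))) \<longleftrightarrow>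
    (\<forall>b\<in>B. (\<Sum>a\<in>A. p (a, b)) = id)"
proof -
  let ?H = "hspace E :: ('h, 'v) label atom"
  let ?qA = "classical A :: ('h, 'v) label qset" and ?qB = "classical B :: ('h, 'v) label qset"
  let ?hs = "[x]"
  (* The variables that expanding the terms introduces: y0 stands for F(x, a), and y1 for b'. *)
  define y0 where "y0 = Var ?qB 1 0"
  define y0' where "y0' = Var (dual ?qB) 1 1"
  define y1 where "y1 = Var (dual ?qB) 1 2"
  define y1' where "y1' = Var ?qB 1 3"
  define body where "body = Conj (Conj (Rel (rel_eq ?qB) [y0, y1]) (Rel (rel_hat F) [x, a, y0']))
     (Rel (rel_eq (dual ?qB)) [b', y1'])"
  define \<Phi> where "\<Phi> = ExistsEq y1 y1' (ExistsEq y0 y0' body)"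
  define M where "M b a e f = cinner e (p (a, b) f)" for a b e f
  note finE = onb_finite[OF onb]
  have pr: "p (a, b) \<in> projections" if "a \<in> A" "b \<in> B" for a b using p that by auto
  have F: "F \<in> brels [{?H}, ?qA] [?qB]" unfolding F_def by (rule family_to_rel_in_brels)
  have hatF: "rel_hat F \<in> brels [{?H}, ?qA, dual ?qB] []" using rel_hat_in_brels[OF F] by simp
  have eqd: "rel_eq (dual ?qB) \<in> brels [dual ?qB, ?qB] []" using rel_eq_in_brels[of "dual ?qB"] by simp
  have vs: "vsort x = {?H}" "vsort a = ?qA" "vsort b' = dual ?qB"
    "vsort y0 = ?qB" "vsort y0' = dual ?qB" "vsort y1 = dual ?qB" "vsort y1' = ?qB"
    by (simp_all add: x_def a_def b'_def y0_def y0'_def y1_def y1'_def)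
  have dist: "distinct [y0, y0', y1, y1', a, b', x]" "distinct [x, b', a, y1', y1, y0', y0]"
    by (simp_all add: x_def a_def b'_def y0_def y0'_def y1_def y1'_def)
  have atomE: "atomic (rel_eq ?qB) [App F [V x, V a], V b'] = \<Phi>"
    unfolding \<Phi>_def body_def y0_def y0'_def y1_def y1'_def
    by (simp add: atomic_App_variable brelsD(2)[OF F] b'_def)
  have od: "one_dim D" if "D \<in> ?qA \<or> D \<in> ?qB \<or> D \<in> dual ?qA \<or> D \<in> dual ?qB" for D
  proof -
    have "one_dim D'" if "D' \<in> ?qA \<union> ?qB" for D' using that by (auto simp: classical_def)
    then show ?thesis using that in_dual[of D] one_dim_dual_atom[of D] by blast
  qed
  have finb: "finite (basis D)" if "one_dim D" for D :: "('h, 'v) label atom" using basis_one_dim[OF that] by simp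
  have wf_body: "wf_fm body [y0, y0', y1, y1', a, b', x]"
    using dist hatF rel_eq_in_brels[of ?qB] eqd by (simp add: body_def vs)
  have wf_E0: "wf_fm (ExistsEq y0 y0' body) [y1, y1', a, b', x]"
    by (rule wf_fm_ForallEq(2)) (use dist wf_body finb od in \<open>auto simp: vs\<close>)
  have wf_\<Phi>: "wf_fm \<Phi> [a, b', x]"
    unfolding \<Phi>_def by (rule wf_fm_ForallEq(2)) (use dist wf_E0 finb od in \<open>auto simp: vs\<close>)
  have wf_E: "wf_fm (Exists a \<Phi>) [b', x]"
    using wf_\<Phi> dist finb od unfolding Exists_def by (auto simp: vs)
  have wf_F: "wf_fm (Forall b' (Exists a \<Phi>)) [x]"
    using wf_E dist finb od by (auto simp: vs)
  have wf_FF: "wf_fm (Forall x (Forall b' (Exists a \<Phi>))) []"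
    using wf_F finE by (simp add: vs)
  define \<alpha>0 where "\<alpha>0 = (\<lambda>_ :: ('h, 'v) label var. ?H)"
  have g0: "good_ctx ?hs [] \<alpha>0"
    using finE by (simp add: \<alpha>0_def good_ctx_def ok_ctx_def vs)
  have "holds (Forall x (Forall b' (Exists a \<Phi>))) \<longleftrightarrow> L [?H] [] \<subseteq> val ?hs (Forall b' (Exists a \<Phi>)) [] \<alpha>0"
    by (rule holds_Forall[OF wf_FF]) (simp_all add: vs \<alpha>0_def)
  also have "val ?hs (Forall b' (Exists a \<Phi>)) [] \<alpha>0 =
      {m \<in> L [?H] []. \<forall>D\<in>dual ?qB. m \<in> val ?hs (Exists a \<Phi>) [b'] (\<alpha>0(b' := D))}"
    using val_Forall[OF g0, of b' "Exists a \<Phi>"] dist wf_E od by (simp add: vs \<alpha>0_def)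
  also have "L [?H] [] \<subseteq> \<dots> \<longleftrightarrow> (\<forall>b\<in>B. L [?H] [] \<subseteq> val ?hs (Exists a \<Phi>) [b'] (\<alpha>0(b' := dual_atom (point b))))"
    unfolding dual_def classical_def by blast
  also have "\<dots> \<longleftrightarrow> (\<forall>b\<in>B. (\<Sum>a\<in>A. p (a, b)) = id)"
  proof (intro ball_cong refl)
    fix b assume b: "b \<in> B"
    let ?\<alpha>b = "\<alpha>0(b' := dual_atom (point b))"
    have hsb: "map ?\<alpha>b ?hs = [?H]" using dist by (simp add: \<alpha>0_def)
    have gb: "good_ctx ?hs [b'] ?\<alpha>b"
      by (rule good_ctx_Cons[OF g0]) (use dist b od in \<open>auto simp: vs\<close>)
    have val\<Phi>: "val ?hs \<Phi> [a, b'] (?\<alpha>b(a := point a0)) = perp [?H] (perp [?H] (row_space E (M b a0)))"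
      if a0: "a0 \<in> A" for a0
    proof -
      let ?\<alpha> = "?\<alpha>b(a := point a0)" and ?Cs = "[a, b']" and ?Ds = "[y0, y0', y1, y1', a, b']"
      let ?B = "\<lambda>D C. ?\<alpha>(y1' := dual_atom D, y1 := D, y0' := dual_atom C, y0 := C)"
      have hs: "map ?\<alpha> ?hs = [?H]" using dist by (simp add: \<alpha>0_def)
      have g: "good_ctx ?hs ?Cs ?\<alpha>"
        by (rule good_ctx_Cons[OF gb]) (use dist a0 od in \<open>auto simp: vs\<close>)
      have body: "val ?hs body ?Ds (?B (dual_atom (point b1)) (point b0)) =
          (if b0 = b1 \<and> b1 = b then row_space E (M b a0) else {0})" if b01: "b0 \<in> B" "b1 \<in> B" for b0 b1
      proof -
        define \<beta> where "\<beta> = ?B (dual_atom (point b1)) (point b0)"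
        have hs': "map \<beta> ?hs = [?H]" unfolding \<beta>_def using dist by (simp add: \<alpha>0_def)
        have \<beta>: "\<beta> x = ?H" "\<beta> a = point a0" "\<beta> b' = dual_atom (point b)" "\<beta> y0 = point b0"
          "\<beta> y0' = dual_atom (point b0)" "\<beta> y1 = dual_atom (point b1)" "\<beta> y1' = point b1"
          unfolding \<beta>_def using dist by (auto simp: \<alpha>0_def)
        have g1: "good_ctx ?hs (y1 # y1' # ?Cs) (?\<alpha>(y1' := dual_atom (dual_atom (point b1)), y1 := dual_atom (point b1)))"
          by (rule good_ctx_pair[OF g]) (use dist b01 od in \<open>auto simp: vs\<close>)
        have g\<beta>: "good_ctx ?hs ?Ds \<beta>"
          unfolding \<beta>_def by (rule good_ctx_pair[OF g1]) (use dist b01 od in \<open>auto simp: vs\<close>)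
        have wfs: "wf_fm (Rel (rel_eq ?qB) [y0, y1]) (?Ds @ ?hs)" "wf_fm (Rel (rel_hat F) [x, a, y0']) (?Ds @ ?hs)"
          "wf_fm (Rel (rel_eq (dual ?qB)) [b', y1']) (?Ds @ ?hs)"
          using wf_body unfolding body_def by simp_all
        have c1: "cmpt (rel_eq ?qB) (map \<beta> [y0, y1]) [] = (if b0 = b1 then L (map \<beta> [y0, y1]) [] else {0})"
          unfolding list.map \<beta> using cmpt_rel_eq_one_dim[of "point b0" ?qB "dual_atom (point b1)"] b01 by auto
        have v1: "val ?hs (Rel (rel_eq ?qB) [y0, y1]) ?Ds \<beta> = (if b0 = b1 then L [?H] [] else {0})"
          using val_Rel_classical[OF g\<beta> wfs(1) _ c1] unfolding hs' by simp
        have c2: "cmpt (rel_eq (dual ?qB)) (map \<beta> [b', y1']) [] = (if b1 = b then L (map \<beta> [b', y1']) [] else {0})"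
          unfolding list.map \<beta> using cmpt_rel_eq_one_dim[of "dual_atom (point b)" "dual ?qB" "point b1"] b b01 by auto
        have v2: "val ?hs (Rel (rel_eq (dual ?qB)) [b', y1']) ?Ds \<beta> = (if b1 = b then L [?H] [] else {0})"
          using val_Rel_classical[OF g\<beta> wfs(3) _ c2] unfolding hs' by simp
        have v3: "val ?hs (Rel (rel_hat F) [x, a, y0']) ?Ds \<beta> = row_space E (M b0 a0)"
          unfolding row_space_def hs'[symmetric]
        proof (rule val_Rel_bend_single[OF g\<beta> wfs(2) _ _ finE E0])
          show "cmpt (rel_hat F) [\<beta> x, \<beta> a, \<beta> y0'] [] = bend 2 ` rows_fixed_by E (M b0 a0) a0 b0"
            unfolding \<beta> F_def M_def using cmpt_hat_family(1)[OF onb p a0 b01(1)] .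
        qed (simp_all add: \<beta>)
        have z: "0 \<in> (row_space E (M b0 a0) :: ('h, 'v) label oper set)" "(row_space E (M b0 a0) :: ('h, 'v) label oper set) \<subseteq> L [?H] []"
          using oper.subspace_0[OF subspace_L[of "[?H]" "[]"]] by (auto simp: row_space_def)
        have "val ?hs body ?Ds \<beta> = (if b0 = b1 then L [?H] [] else {0}) \<inter> row_space E (M b0 a0) \<inter> (if b1 = b then L [?H] [] else {0})"
          unfolding body_def val_Conj[OF g\<beta>] v1 v2 v3 ..
        also have "\<dots> = (if b0 = b1 \<and> b1 = b then row_space E (M b a0) else {0})"
          using z by auto
        finally show ?thesis unfolding \<beta>_def .
      qed
      define U where "U = (\<Union>D\<in>dual ?qB. \<Union>C\<in>?qB. val ?hs body ?Ds (?B D C))"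
      have v\<Phi>: "val ?hs \<Phi> ?Cs ?\<alpha> = perp [?H] (perp [?H] U)"
      proof -
        have "val ?hs (ExistsEq y1 y1' (ExistsEq y0 y0' body)) ?Cs ?\<alpha> = perp (map ?\<alpha> ?hs) (perp (map ?\<alpha> ?hs)
            (\<Union>D\<in>vsort y1. \<Union>C\<in>vsort y0. val ?hs body (y0 # y0' # y1 # y1' # ?Cs) (?B D C)))"
          by (rule val_ExistsEq_ExistsEq[OF g]) (use dist wf_body od in \<open>auto simp: vs\<close>)
        then show ?thesis unfolding \<Phi>_def U_def hs vs .
      qed
      have UW: "perp [?H] U = perp [?H] (row_space E (M b a0))"
      proof -
        have "dual ?qB = (\<lambda>b. dual_atom (point b)) ` B" "?qB = point ` B"
          by (auto simp: dual_def classical_def)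
        then have "U = (\<Union>b1\<in>B. \<Union>b0\<in>B. val ?hs body ?Ds (?B (dual_atom (point b1)) (point b0)))"
          unfolding U_def by simp
        also have "\<dots> = (\<Union>b1\<in>B. \<Union>b0\<in>B. if b0 = b1 \<and> b1 = b then row_space E (M b a0) else {0})"
          using body by (intro SUP_cong refl) blast
        finally have U: "U = (\<Union>b1\<in>B. \<Union>b0\<in>B. if b0 = b1 \<and> b1 = b then row_space E (M b a0) else {0})" .
        have p0: "pairing [?H] 0 m = 0" for m by (simp add: pairing_def)
        have "(\<forall>f\<in>U. pairing [?H] f m = 0) \<longleftrightarrow> (\<forall>f\<in>row_space E (M b a0). pairing [?H] f m = 0)" for m
          unfolding U using p0 b by (auto split: if_splits)
        then show ?thesis unfolding perp_def by blast
      qed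
      show ?thesis unfolding v\<Phi> UW ..
    qed
    have "val ?hs (Exists a \<Phi>) [b'] ?\<alpha>b = perp [?H] (perp [?H] (\<Union>C\<in>?qA. val ?hs \<Phi> [a, b'] (?\<alpha>b(a := C))))"
    proof -
      have "val ?hs (Exists a \<Phi>) [b'] ?\<alpha>b = perp (map ?\<alpha>b ?hs) (perp (map ?\<alpha>b ?hs)
          (\<Union>C\<in>vsort a. val ?hs \<Phi> [a, b'] (?\<alpha>b(a := C))))"
        by (rule val_Exists[OF gb]) (use dist wf_\<Phi> od in \<open>auto simp: vs\<close>)
      then show ?thesis unfolding hsb vs .
    qed
    also have "(\<Union>C\<in>?qA. val ?hs \<Phi> [a, b'] (?\<alpha>b(a := C))) = (\<Union>a0\<in>A. perp [?H] (perp [?H] (row_space E (M b a0))))"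
      unfolding classical_def using val\<Phi> by simp
    also have "perp [?H] \<dots> = perp [?H] (\<Union>a0\<in>A. row_space E (M b a0))"
      by (rule perp_UN_perp_perp) (auto simp: row_space_def)
    finally have "L [?H] [] \<subseteq> val ?hs (Exists a \<Phi>) [b'] ?\<alpha>b \<longleftrightarrow>
        L [?H] [] \<subseteq> perp [?H] (perp [?H] (\<Union>a0\<in>A. row_space E (M b a0)))" by (simp only:)
    also have "\<dots> \<longleftrightarrow> (\<forall>e\<in>E. \<forall>f\<in>E. (\<Sum>a0\<in>A. M b a0 e f) = (if e = f then 1 else 0))"
    proof (rule row_spaces_total[OF finE fin])
      show "M b a0 f e = cnj (M b a0 e f)" if "a0 \<in> A" "e \<in> E" "f \<in> E" for a0 e f
        unfolding M_def by (rule projection_mat(2)[OF onb pr[OF that(1) b] that(2,3)])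
      show "mprod E (M b a0) (M b a0) e f = M b a0 e f" if "a0 \<in> A" "e \<in> E" "f \<in> E" for a0 e f
        unfolding M_def mprod_def by (rule projection_mat(1)[OF onb pr[OF that(1) b] that(2,3)])
      show "mprod E (M b a0) (M b a1) e f = 0" if "a0 \<in> A" "a1 \<in> A" "a0 \<noteq> a1" "e \<in> E" "f \<in> E" for a0 a1 e f
        using compose_zero_mat[OF onb pr[OF that(1) b] pr[OF that(2) b]] orth[OF that(1,2) b that(3)] that(4,5)
        unfolding M_def mprod_def by blast
    qed
    also have "\<dots> \<longleftrightarrow> (\<Sum>a\<in>A. p (a, b)) = id"
      unfolding M_def using sum_projections_iff[OF onb, of A "\<lambda>a. p (a, b)"] pr[OF _ b] by blast
    finally show "L [?H] [] \<subseteq> val ?hs (Exists a \<Phi>) [b'] ?\<alpha>b \<longleftrightarrow> (\<Sum>a\<in>A. p (a, b)) = id" .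
  qed
  finally show ?thesis unfolding atomE .
qed

section \<open>Graphs\<close>

lemma classical_rel_in_brels: "classical_rel A B r \<in> brels [classical A] [classical B]"
  unfolding classical_rel_def
proof (rule mk_brel_in_brels)
  fix X Y :: "('a, 'b) label atom list"
  show "oper.subspace (if \<exists>(a, b)\<in>r. X = [point a] \<and> Y = [point b] then L X Y else {0})"
    by (simp add: subspace_L oper.subspace_single_0)
  show "(if \<exists>(a, b)\<in>r. X = [point a] \<and> Y = [point b] then L X Y else {0}) \<subseteq> L X Y"
    using oper.subspace_0[OF subspace_L[of X Y]] by simp
qed

lemma cmpt_classical_rel:
  assumes "a \<in> A" "b \<in> B"
  shows "cmpt (classical_rel A B r) [point a] [point b] =
    (if (a, b) \<in> r then L [point a] [point b] else {0})"
  unfolding classical_rel_def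
  by (subst cmpt_mk_brel[OF single_in_listset[OF assms(1)] single_in_listset[OF assms(2)]]) auto

lemma bend_L_point:
  "bend 1 ` L [point a] [point b] = (L [point a, dual_atom (point b)] [] :: ('h, 'v) label oper set)"
proof -
  let ?Z = "[point a, dual_atom (point b)] :: ('h, 'v) label atom list"
  let ?U = "bend 1 ` L [point a] [point b] :: ('h, 'v) label oper set"
  have idx: "idx ?Z = {[Inr a, Inr b]}" using idx_pair[of "point a" "dual_atom (point b)"] by simp
  have sub: "oper.subspace ?U" by (rule subspace_bend[OF subspace_L])
  have UL: "?U \<subseteq> L ?Z []"
  proof clarify
    fix r :: "('h, 'v) label oper" assume r: "r \<in> L [point a] [point b]"
    have "u = [] \<and> k \<in> idx ?Z" if nz: "bend 1 r u k \<noteq> 0" for u k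
    proof -
      have u: "u = []" "r (drop 1 k) (take 1 k) \<noteq> 0" using nz by (auto simp: bend_def split: if_splits)
      then have "drop 1 k = [Inr b]" "take 1 k = [Inr a]"
        using r[unfolded L_def mem_Collect_eq idx_point, rule_format, OF u(2)] by simp_all
      then have "k = [Inr a] @ [Inr b]" by (metis append_take_drop_id)
      then show ?thesis using u idx by simp
    qed
    then show "bend 1 r \<in> L ?Z []" unfolding L_iff by blast
  qed
  define r1 :: "('h, 'v) label oper" where "r1 = (\<lambda>i j. if i = [Inr b] \<and> j = [Inr a] then 1 else 0)"
  have "r1 \<in> L [point a] [point b]" by (auto simp: L_def r1_def idx_point split: if_splits)
  then have r1: "bend 1 r1 \<in> ?U" by blast
  have "oper.span {bend 1 r1} = L ?Z []"
    by (rule L_one_dim_span[OF idx]) (use r1 UL in \<open>auto simp: bend_def r1_def\<close>)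
  moreover have "oper.span {bend 1 r1} \<subseteq> ?U" using r1 by (intro oper.span_minimal sub) simp
  ultimately show ?thesis using UL by blast
qed

lemma cmpt_hat_classical_rel:
  fixes A B :: "'v set"
  assumes "a \<in> A" "b \<in> B"
  shows "cmpt (rel_hat (classical_rel A B r)) [point a, dual_atom (point b) :: ('h, 'v) label atom] [] =
    (if (a, b) \<in> r then L [point a, dual_atom (point b)] [] else {0})"
proof -
  have "cmpt (rel_hat (classical_rel A B r)) ([point a] @ [dual_atom (point b) :: ('h, 'v) label atom]) [] =
      bend (length [point a :: ('h, 'v) label atom]) ` cmpt (classical_rel A B r) [point a] [point b]"
    by (rule cmpt_rel_hat[OF classical_rel_in_brels single_in_listset[OF assms(1)]]) (use assms in simp_all)
  moreover have "bend 1 (0 :: ('h, 'v) label oper) = 0" by (simp add: bend_def zero_fun_def fun_eq_iff)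
  ultimately show ?thesis
    using bend_L_point[of a b] by (auto simp: cmpt_classical_rel[OF assms])
qed

lemma op_conj_L: "op_conj ` L X Y = L X Y"
proof (intro equalityI subsetI)
  fix r :: "'a oper" assume "r \<in> L X Y"
  then have "op_conj r \<in> L X Y" by (rule op_conj_in_L)
  moreover have "r = op_conj (op_conj r)" by (simp add: op_conj_eq)
  ultimately show "r \<in> op_conj ` L X Y" by blast
qed (use op_conj_in_L in blast)

lemma cmpt_conjugate_classical:
  fixes R :: "'i brel"
  assumes R: "R \<in> brels [Q, dual Q'] []" and AB: "C \<in> Q" "D \<in> Q'"
    and c: "cmpt R [C, dual_atom D] [] = (if P then L [C, dual_atom D] [] else {0})"
  shows "cmpt (rel_conjugate R) [dual_atom C, D] [] = (if P then L [dual_atom C, D] [] else {0})"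
proof -
  have "[C, dual_atom D] \<in> listset [Q, dual Q']" unfolding in_listset using AB by simp
  from cmpt_rel_conjugate[OF R this, of "[]"]
  have "cmpt (rel_conjugate R) [dual_atom C, D] [] = op_conj ` cmpt R [C, dual_atom D] []" by simp
  moreover have "L [dual_atom C, D] [] = L [C, dual_atom D] []"
    using L_dual[of "[C, dual_atom D]" "[]"] by simp
  moreover have "op_conj (0 :: 'i oper) = 0" by (simp add: op_conj_eq zero_fun_def fun_eq_iff)
  ultimately show ?thesis using c op_conj_L[of "[C, dual_atom D]" "[]"] by simp
qed

lemma bij_betw_restrict:
  assumes bij: "bij_betw f {p \<in> D. Q p} T"
    and W: "\<And>p. p \<in> D \<Longrightarrow> W p \<Longrightarrow> Q p" "\<And>p. p \<in> D \<Longrightarrow> Q p \<Longrightarrow> W p \<longleftrightarrow> C (f p)"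
  shows "bij_betw f {p \<in> D. W p} {F \<in> T. C F}"
  unfolding bij_betw_def
proof
  show "inj_on f {p \<in> D. W p}"
    using bij_betw_imp_inj_on[OF bij] by (rule inj_on_subset) (use W(1) in blast)
  have T: "T = f ` {p \<in> D. Q p}" using bij_betw_imp_surj_on[OF bij] by simp
  show "f ` {p \<in> D. W p} = {F \<in> T. C F}" unfolding T using W by blast
qed

text \<open>
  The conditions for the two homomorphisms forbid, for each pair of pairs, one of the two ways in which
  equality or adjacency can hold on one side only.  Adjacency is symmetric, so the order of the
  factors in the products does not matter.
\<close>

lemma witnesses_iso_iff:
  assumes A: "sym adjA" and B: "sym adjB" and one: "sums_to_one A B p"
  shows "witnesses_iso A adjA B adjB p \<longleftrightarrow>
    (\<forall>a\<in>A. \<forall>a'\<in>A. \<forall>b\<in>B. \<forall>b'\<in>B. (a = a') \<noteq> (b = b') \<longrightarrow> p (a', b') \<circ> p (a, b) = (\<lambda>_. 0)) \<and>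
    (\<forall>b\<in>B. (\<Sum>a\<in>A. p (a, b)) = id) \<and>
    (\<forall>a\<in>A. \<forall>a'\<in>A. \<forall>b\<in>B. \<forall>b'\<in>B. ((a, a') \<in> adjA) \<noteq> ((b, b') \<in> adjB) \<longrightarrow> p (a', b') \<circ> p (a, b) = (\<lambda>_. 0))"
proof -
  define Z where "Z a b a' b' \<longleftrightarrow> p (a, b) \<circ> p (a', b') = (\<lambda>_. 0)" for a b a' b'
  have sA: "(a, a') \<in> adjA \<longleftrightarrow> (a', a) \<in> adjA" for a a' using A by (auto dest: symD)
  have sB: "(b, b') \<in> adjB \<longleftrightarrow> (b', b) \<in> adjB" for b b' using B by (auto dest: symD)
  have "(\<forall>a1\<in>A. \<forall>a2\<in>A. \<forall>b1\<in>B. \<forall>b2\<in>B.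
        a1 = a2 \<and> b1 \<noteq> b2 \<or> (a1, a2) \<in> adjA \<and> (b1, b2) \<notin> adjB \<longrightarrow> Z a1 b1 a2 b2) \<and>
      (\<forall>b1\<in>B. \<forall>b2\<in>B. \<forall>a1\<in>A. \<forall>a2\<in>A.
        b1 = b2 \<and> a1 \<noteq> a2 \<or> (b1, b2) \<in> adjB \<and> (a1, a2) \<notin> adjA \<longrightarrow> Z a1 b1 a2 b2) \<longleftrightarrow>
      (\<forall>a\<in>A. \<forall>a'\<in>A. \<forall>b\<in>B. \<forall>b'\<in>B. (a = a') \<noteq> (b = b') \<longrightarrow> Z a' b' a b) \<and>
      (\<forall>a\<in>A. \<forall>a'\<in>A. \<forall>b\<in>B. \<forall>b'\<in>B. ((a, a') \<in> adjA) \<noteq> ((b, b') \<in> adjB) \<longrightarrow> Z a' b' a b)"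
    (is "?l \<longleftrightarrow> ?r")
  proof
    assume l: ?l
    show ?r
    proof (intro conjI ballI impI)
      fix a a' b b' assume "a \<in> A" "a' \<in> A" "b \<in> B" "b' \<in> B"
      note l1 = l[THEN conjunct1, THEN bspec, OF \<open>a' \<in> A\<close>, THEN bspec, OF \<open>a \<in> A\<close>,
          THEN bspec, OF \<open>b' \<in> B\<close>, THEN bspec, OF \<open>b \<in> B\<close>]
      note l2 = l[THEN conjunct2, THEN bspec, OF \<open>b' \<in> B\<close>, THEN bspec, OF \<open>b \<in> B\<close>,
          THEN bspec, OF \<open>a' \<in> A\<close>, THEN bspec, OF \<open>a \<in> A\<close>]
      show "Z a' b' a b" if "(a = a') \<noteq> (b = b')" using that l1 l2 by argo
      show "Z a' b' a b" if "((a, a') \<in> adjA) \<noteq> ((b, b') \<in> adjB)"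
        using that l1 l2 sA[of a a'] sB[of b b'] by argo
    qed
  next
    assume r: ?r
    have Z: "Z a' b' a b" if "a \<in> A" "a' \<in> A" "b \<in> B" "b' \<in> B"
      "(a = a') \<noteq> (b = b') \<or> ((a, a') \<in> adjA) \<noteq> ((b, b') \<in> adjB)" for a a' b b'
      using r that by blast
    show ?l
    proof (intro conjI ballI impI)
      fix a1 a2 b1 b2 assume in_AB: "a1 \<in> A" "a2 \<in> A" "b1 \<in> B" "b2 \<in> B"
      show "Z a1 b1 a2 b2" if "a1 = a2 \<and> b1 \<noteq> b2 \<or> (a1, a2) \<in> adjA \<and> (b1, b2) \<notin> adjB"
        by (rule Z[OF in_AB(2,1,4,3)]) (use that sA[of a1 a2] sB[of b1 b2] in argo)
      show "Z a1 b1 a2 b2" if "b1 = b2 \<and> a1 \<noteq> a2 \<or> (b1, b2) \<in> adjB \<and> (a1, a2) \<notin> adjA"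
        by (rule Z[OF in_AB(2,1,4,3)]) (use that sA[of a1 a2] sB[of b1 b2] in argo)
    qed
  qed
  then show ?thesis
    unfolding witnesses_iso_def witnesses_hom_def sums_to_one_def[of B A] case_prod_conv Z_def[symmetric]
    using one by argo
qed

theorem corollary4p6p12:
  fixes A B :: "'v set" and adjA adjB :: "('v \<times> 'v) set" and E :: "'h::complex_inner set"
  assumes "simple_graph A adjA" and "simple_graph B adjB"
    and "\<exists>T::'h set. finite T \<and> hilb.span T = UNIV" and "\<exists>v::'h. v \<noteq> 0"
    and "orthonormal_basis E"
  defines "\<X> \<equiv> {hspace E :: ('h, 'v) label atom}"
    and "qA \<equiv> classical A" and "qB \<equiv> classical B"
    and "R \<equiv> classical_rel A A adjA" and "S \<equiv> classical_rel B B adjB"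
  defines "x \<equiv> Var \<X> 0 0" and "x' \<equiv> Var (dual \<X>) 0 1"
    and "a \<equiv> Var qA 0 2" and "b' \<equiv> Var (dual qB) 0 3"
    and "a1 \<equiv> Var qA 0 4" and "a1' \<equiv> Var (dual qA) 0 5"
    and "a2 \<equiv> Var qA 0 6" and "a2' \<equiv> Var (dual qA) 0 7"
  defines "families \<equiv> A \<times> B \<rightarrow>\<^sub>E (projections :: ('h \<Rightarrow> 'h) set)"
  shows "bij_betw (family_to_rel E A B)
      {p \<in> families. sums_to_one A B p}
      (qfunctions [\<X>, qA] [qB]) \<and>
    bij_betw (family_to_rel E A B)
      {p \<in> families. witnesses_iso A adjA B adjB p}
      {F \<in> qfunctions [\<X>, qA] [qB].
         holds (Forall x (Forall b' (Exists a (atomic (rel_eq qB) [App F [V x, V a], V b'])))) \<and>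
         holds (ForallEq x x' (ForallEq a1 a1' (ForallEq a2 a2'
           (Iff (atomic (rel_eq qA) [V a1, V a2'])
                (atomic (rel_conjugate (rel_eq qB)) [App (rel_conjugate F) [V x', V a1'], App F [V x, V a2]]))))) \<and>
         holds (ForallEq x x' (ForallEq a1 a1' (ForallEq a2 a2'
           (Iff (atomic (rel_hat R) [V a1, V a2'])
                (atomic (rel_conjugate (rel_hat S)) [App (rel_conjugate F) [V x', V a1'], App F [V x, V a2]])))))}"
proof -
  have onb: "orthonormal_basis E" by fact
  have finA: "finite A" and finB: "finite B" and symA: "sym adjA" and symB: "sym adjB"
    using assms(1,2) by (auto simp: simple_graph_def)
  have E0: "E \<noteq> {}"
  proof
    assume "E = {}"
    then have "(UNIV :: 'h set) = {0}" using onb by (simp add: orthonormal_basis_def)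
    then show False using assms(4) by blast
  qed
  let ?qA = "classical A :: ('h, 'v) label qset" and ?qB = "classical B :: ('h, 'v) label qset"
  let ?F = "family_to_rel E A B"
  let ?C1 = "\<lambda>F. holds (Forall x (Forall b' (Exists a (atomic (rel_eq qB) [App F [V x, V a], V b']))))"
  let ?C2 = "\<lambda>F. holds (ForallEq x x' (ForallEq a1 a1' (ForallEq a2 a2'
           (Iff (atomic (rel_eq qA) [V a1, V a2'])
                (atomic (rel_conjugate (rel_eq qB)) [App (rel_conjugate F) [V x', V a1'], App F [V x, V a2]])))))"
  let ?C3 = "\<lambda>F. holds (ForallEq x x' (ForallEq a1 a1' (ForallEq a2 a2'
           (Iff (atomic (rel_hat R) [V a1, V a2'])
                (atomic (rel_conjugate (rel_hat S)) [App (rel_conjugate F) [V x', V a1'], App F [V x, V a2]])))))"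
  have bij: "bij_betw ?F {p \<in> families. sums_to_one A B p} (qfunctions [\<X>, qA] [qB])"
    unfolding families_def \<X>_def qA_def qB_def by (rule bij_betw_family_to_rel[OF onb finB])
  have eqB: "rel_conjugate (rel_eq ?qB) \<in> brels [dual ?qB, ?qB] []"
    using rel_conjugate_in_brels[OF rel_eq_in_brels[of ?qB]] by simp
  have hatS: "rel_conjugate (rel_hat S) \<in> brels [dual ?qB, ?qB] []"
    unfolding S_def using rel_conjugate_in_brels[OF rel_hat_in_brels[OF classical_rel_in_brels[of B B adjB]]] by simp
  have hatR: "rel_hat R \<in> brels [?qA, dual ?qA] []"
    unfolding R_def using rel_hat_in_brels[OF classical_rel_in_brels[of A A adjA]] by simp
  have hatB: "rel_hat S \<in> brels [?qB, dual ?qB] []"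
    unfolding S_def using rel_hat_in_brels[OF classical_rel_in_brels[of B B adjB]] by simp
  have eq: "cmpt (rel_eq (classical C)) [point c, dual_atom (point c')] [] =
      (if c = c' then L [point c, dual_atom (point c')] [] else ({0} :: ('h, 'v) label oper set))"
    if "c \<in> C" "c' \<in> C" for c c' and C :: "'v set"
  proof -
    have same: "dual_atom (point c') = dual_atom (point c :: ('h, 'v) label atom) \<longleftrightarrow> c = c'" by auto
    show ?thesis
      unfolding same[symmetric] by (rule cmpt_rel_eq_one_dim) (use that in simp_all)
  qed
  have iff: "witnesses_iso A adjA B adjB p \<longleftrightarrow> ?C1 (?F p) \<and> ?C2 (?F p) \<and> ?C3 (?F p)"
    if p: "p \<in> families" and one: "sums_to_one A B p" for p
  proof -
    have pf: "p \<in> A \<times> B \<rightarrow>\<^sub>E projections" using p by (simp add: families_def)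
    let ?D2 = "\<forall>a\<in>A. \<forall>a'\<in>A. \<forall>b\<in>B. \<forall>b'\<in>B. (a = a') \<noteq> (b = b') \<longrightarrow> p (a', b') \<circ> p (a, b) = (\<lambda>_. 0)"
    have C2: "?C2 (?F p) \<longleftrightarrow> ?D2"
      unfolding x_def x'_def a1_def a1'_def a2_def a2'_def qA_def qB_def \<X>_def
    proof (rule holds_comparison[where PA = "(=)" and PB = "(=)", OF onb E0 finB pf one rel_eq_in_brels _ eqB])
      fix c c' assume "c \<in> A" "c' \<in> A"
      then show "cmpt (rel_eq ?qA) [point c, dual_atom (point c')] [] =
          (if c = c' then L [point c, dual_atom (point c')] [] else {0})" by (rule eq)
    next
      fix c c' assume c: "c \<in> B" "c' \<in> B"
      show "cmpt (rel_conjugate (rel_eq ?qB)) [dual_atom (point c), point c'] [] =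
          (if c = c' then L [dual_atom (point c), point c'] [] else {0})"
        by (rule cmpt_conjugate_classical[OF rel_eq_in_brels _ _ eq[OF c]]) (use c in simp_all)
    qed
    have C3: "?C3 (?F p) \<longleftrightarrow> (\<forall>a\<in>A. \<forall>a'\<in>A. \<forall>b\<in>B. \<forall>b'\<in>B. ((a, a') \<in> adjA) \<noteq> ((b, b') \<in> adjB) \<longrightarrow>
        p (a', b') \<circ> p (a, b) = (\<lambda>_. 0))"
      unfolding x_def x'_def a1_def a1'_def a2_def a2'_def qA_def \<X>_def
    proof (rule holds_comparison[where PA = "\<lambda>c c'. (c, c') \<in> adjA" and PB = "\<lambda>c c'. (c, c') \<in> adjB",
          OF onb E0 finB pf one hatR _ hatS])
      fix c c' assume "c \<in> A" "c' \<in> A"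
      then show "cmpt (rel_hat R) [point c, dual_atom (point c')] [] =
          (if (c, c') \<in> adjA then L [point c, dual_atom (point c')] [] else {0})"
        unfolding R_def by (rule cmpt_hat_classical_rel)
    next
      fix c c' assume c: "c \<in> B" "c' \<in> B"
      show "cmpt (rel_conjugate (rel_hat S)) [dual_atom (point c), point c'] [] =
          (if (c, c') \<in> adjB then L [dual_atom (point c), point c'] [] else {0})"
      proof (rule cmpt_conjugate_classical[OF hatB])
        show "cmpt (rel_hat S) [point c, dual_atom (point c')] [] =
            (if (c, c') \<in> adjB then L [point c, dual_atom (point c')] [] else {0})"
          unfolding S_def by (rule cmpt_hat_classical_rel[OF c])
      qed (use c in simp_all)
    qed
    have C1: "?C1 (?F p) \<longleftrightarrow> (\<forall>b\<in>B. (\<Sum>a\<in>A. p (a, b)) = id)" if "?D2"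
      unfolding x_def a_def b'_def qA_def qB_def \<X>_def
    proof (rule holds_surjective[OF onb E0 finA pf])
      fix a a' b assume "a \<in> A" "a' \<in> A" "b \<in> B" "a \<noteq> a'"
      then show "p (a, b) \<circ> p (a', b) = (\<lambda>_. 0)" using that[rule_format, of a' a b b] by simp
    qed
    have reorder: "d2 \<and> d1 \<and> d3 \<longleftrightarrow> c1 \<and> d2 \<and> d3" if "d2 \<Longrightarrow> c1 \<longleftrightarrow> d1" for c1 d1 d2 d3
      using that by blast
    show ?thesis
      unfolding witnesses_iso_iff[OF symA symB one] C2 C3 by (rule reorder[OF C1])
  qed
  have "bij_betw ?F {p \<in> families. witnesses_iso A adjA B adjB p}
      {F \<in> qfunctions [\<X>, qA] [qB]. ?C1 F \<and> ?C2 F \<and> ?C3 F}"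
  proof (rule bij_betw_restrict[OF bij])
    show "sums_to_one A B p" if "witnesses_iso A adjA B adjB p" for p
      using that by (simp add: witnesses_iso_def witnesses_hom_def)
  qed (rule iff)
  with bij show ?thesis by (rule conjI)
qed

end
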